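(* Let $\Xi\subseteq\mathbb{R}^m$ be convex with a norm $\|\cdot\|$ on $\mathbb{R}^m$, $h:\mathbb{R}^n\times\mathbb{R}^m\to\mathbb{R}$ a loss function and $\mathbb X\subseteq\mathbb{R}^n$. Let $\rho_\alpha$ be a risk measure with a representation $\rho_\alpha(X)=\sup_{g\in\mathcal H_{\rho_\alpha}}\int_0^1{\rm VaR}_u(X)\,dg(u)$, where $\mathcal H_{\rho_\alpha}$ is a subset of convex distortion functions such that, for some $c\in\mathbb{R}$, $g'(1)\le c$ for all $g\in\mathcal H_{\rho_\alpha}$. Let $\mathbb P$ be a distribution on $\Xi$ with $\mathbb{E}^{\mathbb P}[\exp(\|\xi\|^a)]<\infty$ for some $a>1$. Let $m_2=\max\{m,2\}$ and $\varepsilon_N=(k_N/N)^{1/m_2}$, $N\in\mathbb{N}$, where $k_N/N^\delta\to0$ for some $\delta<1$ and $\log N/k_N\to0$ as $N\to\infty$. Let $\widehat J_N$ and $\widehat x_N$ be the optimal value and an optimizer of $$\inf_{x\in\mathbb X}\ \sup_{\mathbb Q\in\mathbb{B}^{\rho_\alpha}_{\varepsilon_N}(\widehat{\mathbb P}_N)}\mathbb{E}^{\mathbb Q}[h(x,\xi)],\qquad N\in\mathbb{N}.$$ (i) If $h(x,\xi)$ is upper semicontinuous in $\xi$ and there exists $L\ge0$ with $|h(x,\xi)|\le L(1+\|\xi\|)$ for all $x\in\mathbb X$ and $\xi\in\Xi$, then $\mathbb P^\infty$-almost surely $\widehat J_N\downarrow J^\star$ as $N\to\infty$, where $J^\star=\inf_{x\in\mathbb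 X}\mathbb{E}^{\mathbb P}[h(x,\xi)]$. (ii) If the assumptions of (i) hold, $\mathbb X$ is closed, and $h(x,\xi)$ is lower semicontinuous in $x$ for every $\xi\in\Xi$, then any accumulation point of $\{\widehat x_N\}_{N\in\mathbb{N}}$ is $\mathbb P^\infty$-almost surely an optimal solution of $\inf_{x\in\mathbb X}\mathbb{E}^{\mathbb P}[h(x,\xi)]$.
   Context: $\widehat\xi_1,\widehat\xi_2,\dots$ are independent draws from $\mathbb P$, governed by the infinite product measure $\mathbb P^\infty$, and $\widehat{\mathbb P}_N=\frac1N\sum_{i=1}^N\delta_{\widehat\xi_i}$. $\mathcal M(\Xi)$ is the set of probability distributions supported on $\Xi$; $d_{\rho}(\mathbb P_1,\mathbb P_2)=\inf_\Pi\rho^\Pi(\|\xi_1-\xi_2\|)$, infimum over joint distributions $\Pi$ of $(\xi_1,\xi_2)$ with marginals $\mathbb P_1,\mathbb P_2$; $\mathbb{B}^{\rho}_{\varepsilon}(\widehat{\mathbb P}_N)=\{\mathbb Q\in\mathcal M(\Xi): d_\rho(\widehat{\mathbb P}_N,\mathbb Q)\le\varepsilon\}$. The notation $\widehat J_N\downarrow J^\star$ means convergence to $J^\star$ from above (with $\widehat J_N\ge J^\star$ for all large $N$), not monotonicity in $N$. ${\rm VaR}_u(X)=\inf\{x:F(x)\ge u\}$ for $X\sim F$. A distortion function is an increasing $g:[0,1]\to[0,1]$ with $g(0)=0$, $g(1)=1$; $g'$ denotes its left-derivative. *)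

theory Defs
  imports "HOL-Probability.Probability"
begin

definition is_norm :: "('a::real_vector \<Rightarrow> real) \<Rightarrow> bool" where
  "is_norm nrm \<longleftrightarrow>
     (\<forall>x. nrm x = 0 \<longleftrightarrow> x = 0) \<and>
     (\<forall>c x. nrm (c *\<^sub>R x) = \<bar>c\<bar> * nrm x) \<and>
     (\<forall>x y. nrm (x + y) \<le> nrm x + nrm y)"

definition usc_on :: "'a::topological_space set \<Rightarrow> ('a \<Rightarrow> real) \<Rightarrow> bool" where
  "usc_on S f \<longleftrightarrow> (\<forall>x\<in>S. \<forall>y>f x. \<forall>\<^sub>F z in at x within S. f z < y)"

definition lsc_on :: "'a::topological_space set \<Rightarrow> ('a \<Rightarrow> real) \<Rightarrow> bool" where
  "lsc_on S f \<longleftrightarrow> (\<forall>x\<in>S. \<forall>y<f x. \<forall>\<^sub>F z in at x within S. y < f z)"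

text \<open>The infimum is taken in \<^typ>\<open>ereal\<close>, so a level that is never reached
  gives \<open>\<infinity>\<close>, and \<open>u \<le> 0\<close> gives \<open>-\<infinity>\<close>.\<close>

definition VaR :: "'a measure \<Rightarrow> ('a \<Rightarrow> real) \<Rightarrow> real \<Rightarrow> ereal" where
  "VaR M X u = (INF x\<in>{x. u \<le> cdf (distr M borel X) x}. ereal x)"

text \<open>Only the values on \<open>[0,1]\<close> matter; "increasing" is meant in the weak sense.\<close>

definition distortion :: "(real \<Rightarrow> real) \<Rightarrow> bool" where
  "distortion g \<longleftrightarrow> g ` {0..1} \<subseteq> {0..1} \<and> mono_on {0..1} g \<and> g 0 = 0 \<and> g 1 = 1"

text \<open>The Lebesgue--Stieltjes measure \<open>dg\<close>: \<open>g\<close> is extended by \<open>0\<close> to the left and by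
  \<open>1\<close> to the right of \<open>[0,1]\<close>. For a convex distortion this extension is nondecreasing
  and right-continuous, as \<^const>\<open>interval_measure\<close> requires.\<close>

definition distortion_measure :: "(real \<Rightarrow> real) \<Rightarrow> real measure" where
  "distortion_measure g = interval_measure (\<lambda>u. g (max 0 (min 1 u)))"

text \<open>\<open>\<integral>\<^sub>0\<^sup>1 VaR\<^sub>u(X) dg(u)\<close> as positive minus negative part
  (\<^const>\<open>e2ennreal\<close> truncates at \<open>0\<close>). For \<open>X \<ge> 0\<close> the negative part vanishes;
  when both parts are infinite, the value is \<open>\<infinity>\<close>.\<close>

definition distortion_integral :: "'a measure \<Rightarrow> ('a \<Rightarrow> real) \<Rightarrow> (real \<Rightarrow> real) \<Rightarrow> ereal" where
  "distortion_integral M X g =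
     enn2ereal (\<integral>\<^sup>+u\<in>{0..1}. e2ennreal (VaR M X u) \<partial>distortion_measure g) -
     enn2ereal (\<integral>\<^sup>+u\<in>{0..1}. e2ennreal (- VaR M X u) \<partial>distortion_measure g)"

definition risk :: "(real \<Rightarrow> real) set \<Rightarrow> 'a measure \<Rightarrow> ('a \<Rightarrow> real) \<Rightarrow> ereal" where
  "risk H M X = (SUP g\<in>H. distortion_integral M X g)"

text \<open>Distributions supported on \<open>\<Xi>\<close> are probability measures on the Borel
  \<open>\<sigma>\<close>-algebra of the subspace \<open>\<Xi>\<close>; thus \<open>\<Xi>\<close> need not be a Borel set.\<close>

definition dists_on :: "'a::topological_space set \<Rightarrow> 'a measure set" where
  "dists_on \<Xi> = space (prob_algebra (restrict_space borel \<Xi>))"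

definition couplings :: "'a measure \<Rightarrow> 'b measure \<Rightarrow> ('a \<times> 'b) measure set" where
  "couplings P Q =
     {R \<in> space (prob_algebra (P \<Otimes>\<^sub>M Q)). distr R P fst = P \<and> distr R Q snd = Q}"

definition transport_dist ::
  "('a::real_vector \<Rightarrow> real) \<Rightarrow> (real \<Rightarrow> real) set \<Rightarrow> 'a measure \<Rightarrow> 'a measure \<Rightarrow> ereal" where
  "transport_dist nrm H P Q =
     (INF R\<in>couplings P Q. risk H R (\<lambda>(\<xi>\<^sub>1, \<xi>\<^sub>2). nrm (\<xi>\<^sub>1 - \<xi>\<^sub>2)))"

definition transport_ball ::
  "('a::{real_vector, topological_space} \<Rightarrow> real) \<Rightarrow> (real \<Rightarrow> real) set \<Rightarrow> 'a set \<Rightarrow>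
    real \<Rightarrow> 'a measure \<Rightarrow> 'a measure set" where
  "transport_ball nrm H \<Xi> \<epsilon> P = {Q \<in> dists_on \<Xi>. transport_dist nrm H P Q \<le> ereal \<epsilon>}"

text \<open>The sample points are numbered from \<open>0\<close>.\<close>

definition empirical :: "'a::topological_space set \<Rightarrow> nat \<Rightarrow> (nat \<Rightarrow> 'a) \<Rightarrow> 'a measure" where
  "empirical \<Xi> N \<omega> = distr (uniform_count_measure {..<N}) (restrict_space borel \<Xi>) \<omega>"

lemma measure_empirical:
  assumes "N > 0" "\<And>i. i < N \<Longrightarrow> \<omega> i \<in> \<Xi>" "A \<in> sets (restrict_space borel \<Xi>)"
  shows "measure (empirical \<Xi> N \<omega>) A = (\<Sum>i<N. indicator A (\<omega> i)) / real N"
proof -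
  have "\<omega> \<in> measurable (uniform_count_measure {..<N}) (restrict_space borel \<Xi>)"
    using assms(2) by (auto simp: measurable_def space_restrict_space space_uniform_count_measure
        sets_uniform_count_measure)
  hence "measure (empirical \<Xi> N \<omega>) A =
      measure (uniform_count_measure {..<N}) (\<omega> -` A \<inter> {..<N})"
    unfolding empirical_def using assms(3)
    by (subst measure_distr) (auto simp: space_uniform_count_measure)
  also have "\<dots> = real (card (\<omega> -` A \<inter> {..<N})) / real N"
    using assms(1) by (subst measure_uniform_count_measure) auto
  also have "\<omega> -` A \<inter> {..<N} = {..<N} \<inter> {i. \<omega> i \<in> A}"
    by auto
  also have "real (card \<dots>) = (\<Sum>i<N. indicator A (\<omega> i))"
    by (simp add: indicator_def of_bool_def sum.If_cases)
  finally show ?thesis .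
qed

definition radius :: "nat \<Rightarrow> (nat \<Rightarrow> real) \<Rightarrow> nat \<Rightarrow> real" where
  "radius m k N = (k N / real N) powr (1 / real (max m 2))"

text \<open>Expectations are Bochner integrals embedded in \<^typ>\<open>ereal\<close>. If \<open>h x\<close> is Borel with
  linear growth and \<open>P\<close> has a finite first moment, as an empirical measure does, then
  \<open>h x\<close> is integrable under every measure in the ball.\<close>

definition worst_case ::
  "('a::{real_vector, topological_space} \<Rightarrow> real) \<Rightarrow> (real \<Rightarrow> real) set \<Rightarrow> 'a set \<Rightarrow>
    real \<Rightarrow> 'a measure \<Rightarrow> ('b \<Rightarrow> 'a \<Rightarrow> real) \<Rightarrow> 'b \<Rightarrow> ereal" where
  "worst_case nrm H \<Xi> \<epsilon> P h x =
     (SUP Q\<in>transport_ball nrm H \<Xi> \<epsilon> P. ereal (\<integral>\<xi>. h x \<xi> \<partial>Q))"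

definition optimal_value :: "('b \<Rightarrow> ereal) \<Rightarrow> 'b set \<Rightarrow> ereal" where
  "optimal_value f X = (INF x\<in>X. f x)"

definition accumulation_point :: "(nat \<Rightarrow> 'a::topological_space) \<Rightarrow> 'a \<Rightarrow> bool" where
  "accumulation_point X x \<longleftrightarrow> (\<exists>r. strict_mono r \<and> (X \<circ> r) \<longlonglongrightarrow> x)"

definition converges_from_above :: "(nat \<Rightarrow> ereal) \<Rightarrow> ereal \<Rightarrow> bool" where
  "converges_from_above J l \<longleftrightarrow> J \<longlonglongrightarrow> l \<and> (\<forall>\<^sub>F N in sequentially. l \<le> J N)"

end

theory Submission
  imports Defs
begin

text \<open>Since \<open>u \<ge> g u \<ge> 1 - c (1 - u)\<close> for every distortion \<open>g\<close> in \<open>H\<close>, the risk of a nonnegative variable lies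
  between its mean and \<open>c\<close> times its mean. Hence \<open>P\<close> belongs to the ball as soon as the Wasserstein distance of
  order one between the empirical measure and \<open>P\<close> is at most a constant times the radius, and every member of
  the ball is Wasserstein close to \<open>P\<close>. The former gives the bound from below; the latter gives the limit,
  approximating \<open>h x\<close> from above by its Lipschitz sup-convolutions. Part (ii) then follows from Fatou's lemma.

  The radius only exceeds \<open>(ln N / N) powr (1 / max m 2)\<close> by a factor that may diverge arbitrarily slowly, so in
  dimension two a dyadic coupling, which loses a factor \<open>sqrt (ln N)\<close>, does not suffice. Instead we quantise the
  sample to a lattice of mesh \<open>1/n\<close> and write a Lipschitz function \<open>f\<close> as
  \<open>f s = \<langle>grad G\<^sub>s, grad f\<rangle> + \<langle>p\<^sub>T s, f\<rangle>\<close>, where \<open>p\<^sub>t s\<close> is the law at time \<open>t\<close> of a random walk started at \<open>s\<close>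
  and \<open>G\<^sub>s\<close> is the sum of \<open>p\<^sub>t s\<close> over \<open>t < T\<close>, with \<open>T = n\<^sup>2\<close>. As \<open>grad f\<close> is bounded, the supremum
  over \<open>f\<close> of the deviation of the empirical mean is bounded by sums of absolute values of centred
  means of independent variables, whose total variance is controlled by the energy of \<open>G\<^sub>s\<close>, that is by
  \<open>G\<^sub>s s\<close>, which is of order \<open>ln n\<close> in dimension two. Cutting space into shells makes this work
  without compact support. A bounded-difference inequality with exponential moments concentrates the
  supremum around its mean, and Kantorovich duality on the finite lattice turns it into a coupling.\<close>

section \<open>Convex distortions\<close>

text \<open>Scales. The lattice costs \<open>1/n\<close>. By time \<open>T = n^2\<close> the walk
  has spread over about \<open>n^m\<close> sites: the energy of \<open>p_T s\<close> is at most
  \<open>n^-m\<close>, so its term stays within the order of the gradient term although it is paired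
  with values of \<open>f\<close> of order \<open>n\<close> instead of slopes of order one. The
  rescaled mean discrepancy is then of order \<open>sqrt (n^(max m 2 - 2) * ln n / N)\<close>, and
  balancing this with \<open>1/n\<close> gives the mesh and the rate
  \<open>(ln N / N) powr (1 / max m 2)\<close>. Fluctuations need probabilities summable in
  \<open>N\<close> for Borel-Cantelli; exponential concentration allows them at the scale
  \<open>sqrt (ln N / N)\<close>, which is no larger than the rate. As \<open>ln N / k_N\<close>
  tends to 0, the rate is negligible against the radius, so constants are eventually absorbed.
  Unbounded data. Sample \<open>N\<close> is truncated at norm \<open>N\<close>. Moments make the
  excursions beyond it summable, make the shell probabilities decay faster than the boxes grow, and
  replace bounded differences by an oscillation bound with exponential moments.\<close>

lemma convex_distortion_le_id:
  assumes "distortion g" "convex_on {0..1} g" "u \<in> {0..1}"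
  shows "g u \<le> u"
proof -
  have "g ((1 - u) *\<^sub>R 0 + u *\<^sub>R 1) \<le> (1 - u) * g 0 + u * g 1"
    using assms(2,3) by (intro convex_onD) auto
  thus ?thesis using assms(1) by (simp add: distortion_def)
qed

text \<open>Chord slopes of a convex function increase, so each is at most the slope of a chord
  ending at 1, and these increase to the left derivative there.\<close>

lemma convex_distortion_lipschitz:
  assumes g: "distortion g" "convex_on {0..1} g"
    and D: "(g has_real_derivative D) (at_left 1)" "D \<le> c"
    and uv: "0 \<le> u" "u \<le> v" "v \<le> 1"
  shows "g v - g u \<le> c * (v - u)"
proof -
  have slope1: "(g 1 - g u) / (1 - u) \<le> c" if u: "0 \<le> u" "u < 1" for u
  proof -
    have "((\<lambda>y. (g y - g 1) / (y - 1)) \<longlongrightarrow> D) (at_left 1)"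
      using D(1) by (simp add: has_field_derivative_iff)
    moreover have "eventually (\<lambda>y. (g 1 - g u) / (1 - u) \<le> (g y - g 1) / (y - 1)) (at_left 1)"
      using eventually_at_left_real[OF u(2)]
    proof eventually_elim
      case (elim y)
      have "(g u - g 1) / (u - 1) \<le> (g y - g 1) / (y - 1)"
        using convex_on_slope_le(2)[OF g(2), of u 1 y] elim u by auto
      thus ?case by (metis minus_diff_eq minus_divide_divide)
    qed
    ultimately have "(g 1 - g u) / (1 - u) \<le> D"
      by (intro tendsto_lowerbound[of _ D "at_left 1"]) auto
    thus ?thesis using D(2) by simp
  qed
  show ?thesis
  proof (cases "u = v \<or> v = 1")
    case True
    thus ?thesis using slope1[of u] uv by (cases "u = v") (auto simp: divide_simps)
  next
    case False
    hence uv': "u < v" "v < 1" using uv by auto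
    have "(g v - g u) / (v - u) \<le> (g 1 - g v) / (1 - v)"
      using convex_on_slope_le[OF g(2), of u 1 v] uv uv'
      by (smt (verit) atLeastAtMost_iff minus_diff_eq minus_divide_divide)
    also have "\<dots> \<le> c" using uv uv' by (intro slope1) auto
    finally show ?thesis using uv' by (simp add: divide_simps)
  qed
qed

text \<open>These are the facts that make \<open>interval_measure\<close> give half-open intervals
  their expected mass. Convexity would allow a jump at 1; the left derivative there excludes
  it.\<close>

lemma convex_distortion_cont_mono:
  assumes g: "distortion g" "convex_on {0..1} g"
    and D: "(g has_real_derivative D) (at_left 1)"
  defines "G \<equiv> \<lambda>u. g (max 0 (min 1 u))"
  shows "mono G" "continuous (at a within A) G"
proof -
  show mono: "mono G" using g(1) by (auto simp: G_def distortion_def mono_on_def intro!: monoI)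
  have lip: "\<bar>G v - G u\<bar> \<le> \<bar>D\<bar> * \<bar>v - u\<bar>" for u v
  proof -
    have *: "G v - G u \<le> \<bar>D\<bar> * \<bar>v - u\<bar>" if "u \<le> v" for u v
    proof -
      have "G v - G u \<le> \<bar>D\<bar> * (max 0 (min 1 v) - max 0 (min 1 u))" unfolding G_def
        using that by (intro convex_distortion_lipschitz[OF g D]) auto
      also have "\<dots> \<le> \<bar>D\<bar> * \<bar>v - u\<bar>" by (intro mult_left_mono) auto
      finally show ?thesis .
    qed
    show ?thesis using *[of u v] *[of v u] monoD[OF mono, of u v] monoD[OF mono, of v u]
      by (cases "u \<le> v") (auto simp: abs_minus_commute)
  qed
  have "\<bar>D\<bar>-lipschitz_on UNIV G"
    by (rule lipschitz_onI) (auto simp: dist_real_def lip)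
  hence "continuous_on UNIV G" by (rule lipschitz_on_continuous_on)
  thus "continuous (at a within A) G"
    by (metis UNIV_I continuous_on_eq_continuous_within continuous_within_subset subset_UNIV)
qed

text \<open>The quantile is the generalised inverse of the cdf, so the set of \<open>t\<close> with
  \<open>F t < u\<close> is, up to its endpoint, the half-line below it. Writing the positive part
  of the quantile as a length prepares the exchange of the integrals over \<open>u\<close> and
  \<open>t\<close>.\<close>

lemma VaR_layer_cake:
  fixes X :: "'a \<Rightarrow> real"
  assumes "prob_space M" "X \<in> borel_measurable M"
  shows "e2ennreal (VaR M X u) = (\<integral>\<^sup>+t\<in>{0..}. indicator {t. cdf (distr M borel X) t < u} t \<partial>lborel)"
proof -
  define F where "F = cdf (distr M borel X)"
  interpret M: prob_space M by fact
  interpret D: real_distribution "distr M borel X"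
    using assms(2) by (intro M.real_distribution_distr) auto
  have mono: "mono F" unfolding F_def by (intro monoI D.cdf_nondecreasing)
  have [measurable]: "{t. F t < u} \<in> sets borel"
    using borel_measurable_mono[OF mono] by measurable
  define v where "v = VaR M X u"
  have v: "v = (INF x\<in>{x. u \<le> F x}. ereal x)" by (simp add: v_def VaR_def F_def)
  have 1: "F t < u" if "ereal t < v" for t
  proof (rule ccontr)
    assume "\<not> F t < u"
    hence "v \<le> ereal t" unfolding v by (intro INF_lower) auto
    thus False using that by simp
  qed
  have 2: "ereal t \<le> v" if "F t < u" for t
    unfolding v
  proof (rule INF_greatest, clarsimp)
    fix x assume "u \<le> F x"
    thus "t \<le> x" using that monoD[OF mono, of x t] by (cases "t \<le> x") auto
  qed
  have "(\<integral>\<^sup>+t\<in>{0..}. indicator {t. F t < u} t \<partial>lborel) = emeasure lborel ({0..} \<inter> {t. F t < u})"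
    by (simp add: nn_integral_indicator[symmetric] indicator_inter_arith mult.commute del: nn_integral_indicator)
  also have "\<dots> = e2ennreal v"
  proof (cases v)
    case PInf
    hence "{0..} \<inter> {t. F t < u} = {0..}" using 1 by auto
    moreover have "emeasure lborel {0::real..} = \<infinity>"
    proof (rule ccontr)
      assume "emeasure lborel {0::real..} \<noteq> \<infinity>"
      then obtain r where r: "emeasure lborel {0::real..} = ennreal r" "r \<ge> 0"
        by (cases "emeasure lborel {0::real..}") auto
      have "emeasure lborel {0..r + 1} \<le> emeasure lborel {0::real..}" by (intro emeasure_mono) auto
      thus False using r by simp
    qed
    ultimately show ?thesis using PInf by simp
  next
    case MInf
    hence "{t. F t < u} = {}" using 2 by force
    thus ?thesis using MInf by (simp add: e2ennreal_neg)
  next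
    case (real r)
    have "emeasure lborel ({0..} \<inter> {t. F t < u}) \<le> emeasure lborel {0..r}"
      using 2 real by (intro emeasure_mono) auto
    moreover have "emeasure lborel {0..<r} \<le> emeasure lborel ({0..} \<inter> {t. F t < u})"
      using 1 real by (intro emeasure_mono) auto
    ultimately have "emeasure lborel ({0..} \<inter> {t. F t < u}) = ennreal r"
      by (cases "r \<ge> 0") (auto simp: ennreal_neg intro: antisym)
    thus ?thesis using real by simp
  qed
  finally show ?thesis by (simp add: F_def v_def)
qed

text \<open>Tonelli for the region under the graph of \<open>X\<close>.\<close>

lemma nn_integral_cdf_tail:
  fixes X :: "'a \<Rightarrow> real"
  assumes "prob_space M" and [measurable]: "X \<in> borel_measurable M" and "\<And>x. x \<in> space M \<Longrightarrow> X x \<ge> 0"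
  shows "(\<integral>\<^sup>+x. ennreal (X x) \<partial>M) = (\<integral>\<^sup>+t\<in>{0..}. ennreal (1 - cdf (distr M borel X) t) \<partial>lborel)"
proof -
  interpret M: prob_space M by fact
  interpret P: pair_sigma_finite M lborel ..
  have "(\<integral>\<^sup>+x. ennreal (X x) \<partial>M) = (\<integral>\<^sup>+x. (\<integral>\<^sup>+t. indicator {0..<X x} t \<partial>lborel) \<partial>M)"
    using assms(3) by (intro nn_integral_cong) simp
  also have "\<dots> = (\<integral>\<^sup>+x. (\<integral>\<^sup>+t. indicator {0..} t * indicator {z\<in>space (M \<Otimes>\<^sub>M lborel). snd z < X (fst z)} (x, t) \<partial>lborel) \<partial>M)"
    by (intro nn_integral_cong) (auto simp: indicator_def space_pair_measure)
  also have "\<dots> = (\<integral>\<^sup>+t. (\<integral>\<^sup>+x. indicator {0..} t * indicator {z\<in>space (M \<Otimes>\<^sub>M lborel). snd z < X (fst z)} (x, t) \<partial>M) \<partial>lborel)"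
    by (rule P.Fubini'[symmetric]) (auto simp: split_beta')
  also have "\<dots> = (\<integral>\<^sup>+t\<in>{0..}. ennreal (1 - cdf (distr M borel X) t) \<partial>lborel)"
  proof (rule nn_integral_cong)
    fix t :: real
    have "(\<integral>\<^sup>+x. indicator {0..} t * indicator {z\<in>space (M \<Otimes>\<^sub>M lborel). snd z < X (fst z)} (x, t) \<partial>M)
      = indicator {0..} t * (\<integral>\<^sup>+x. indicator {x\<in>space M. t < X x} x \<partial>M)"
      by (subst nn_integral_cmult[symmetric]) (auto intro!: nn_integral_cong simp: indicator_def space_pair_measure)
    also have "(\<integral>\<^sup>+x. indicator {x\<in>space M. t < X x} x \<partial>M) = ennreal (1 - cdf (distr M borel X) t)"
    proof -
      have "cdf (distr M borel X) t = measure M {x\<in>space M. X x \<le> t}"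
        by (simp add: cdf_def measure_distr vimage_def Int_def conj_commute)
      moreover have "measure M (space M - {x\<in>space M. X x \<le> t}) = 1 - measure M {x\<in>space M. X x \<le> t}"
        by (rule M.prob_compl) simp
      moreover have "space M - {x\<in>space M. X x \<le> t} = {x\<in>space M. t < X x}" by auto
      ultimately show ?thesis by (simp add: M.emeasure_eq_measure)
    qed
    finally show "(\<integral>\<^sup>+x. indicator {0..} t * indicator {z\<in>space (M \<Otimes>\<^sub>M lborel). snd z < X (fst z)} (x, t) \<partial>M)
      = ennreal (1 - cdf (distr M borel X) t) * indicator {0..} t" by (simp add: mult.commute)
  qed
  finally show ?thesis .
qed

text \<open>After Tonelli, for fixed \<open>t\<close> the levels \<open>u\<close> between
  \<open>F t\<close> and 1 carry \<open>dg\<close>-mass \<open>1 - g (F t)\<close>. Distorting thus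
  only changes the tail \<open>1 - F t\<close> into \<open>1 - g (F t)\<close>, which can be
  compared pointwise with the tail formula of the mean.\<close>

lemma distortion_integral_eq:
  fixes X :: "'a \<Rightarrow> real"
  assumes "prob_space M" and [measurable]: "X \<in> borel_measurable M" and pos: "\<And>x. x \<in> space M \<Longrightarrow> X x \<ge> 0"
    and g: "distortion g" "convex_on {0..1} g" "(g has_real_derivative D) (at_left 1)"
  shows "distortion_integral M X g = enn2ereal (\<integral>\<^sup>+t\<in>{0..}. ennreal (1 - g (cdf (distr M borel X) t)) \<partial>lborel)"
proof -
  define F where "F = cdf (distr M borel X)"
  define G where "G = (\<lambda>u. g (max 0 (min 1 u)))"
  interpret M: prob_space M by fact
  interpret D: real_distribution "distr M borel X"
    using assms(2) by (intro M.real_distribution_distr) auto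
  have mono: "mono F" unfolding F_def by (intro monoI D.cdf_nondecreasing)
  have [measurable]: "F \<in> borel_measurable borel" by (rule borel_measurable_mono[OF mono])
  have G: "mono G" "\<And>a A. continuous (at a within A) G"
    unfolding G_def by (rule convex_distortion_cont_mono[OF g])+
  interpret S: sigma_finite_measure "distortion_measure g"
    unfolding distortion_measure_def G_def[symmetric]
    by (rule sigma_finite_interval_measure) (use G in \<open>auto dest: monoD\<close>)
  interpret P: pair_sigma_finite "distortion_measure g" lborel ..
  have sets[measurable_cong]: "sets (distortion_measure g) = sets borel"
    by (simp add: distortion_measure_def)
  have F01: "F t \<in> {0..1}" for t unfolding F_def
    using D.cdf_nonneg D.cdf_bounded_prob by auto
  have Ioc: "emeasure (distortion_measure g) {a<..b} = ennreal (G b - G a)" if "a \<le> b" for a b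
    unfolding distortion_measure_def G_def[symmetric] using that
    by (intro emeasure_interval_measure_Ioc) (use G in \<open>auto dest: monoD\<close>)
  have "(\<integral>\<^sup>+u\<in>{0..1}. e2ennreal (VaR M X u) \<partial>distortion_measure g)
     = (\<integral>\<^sup>+u. (\<integral>\<^sup>+t. indicator {z. fst z \<in> {0..1} \<and> snd z \<in> {0..} \<and> F (snd z) < fst z} (u, t) \<partial>lborel) \<partial>distortion_measure g)"
    by (subst VaR_layer_cake[OF assms(1,2)])
       (auto intro!: nn_integral_cong simp: F_def indicator_def nn_integral_multc[symmetric])
  also have "\<dots> = (\<integral>\<^sup>+t. (\<integral>\<^sup>+u. indicator {z. fst z \<in> {0..1} \<and> snd z \<in> {0..} \<and> F (snd z) < fst z} (u, t) \<partial>distortion_measure g) \<partial>lborel)"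
    by (rule P.Fubini'[symmetric]) (auto simp: split_beta')
  also have "\<dots> = (\<integral>\<^sup>+t\<in>{0..}. ennreal (1 - g (F t)) \<partial>lborel)"
  proof (rule nn_integral_cong)
    fix t :: real
    have "(\<integral>\<^sup>+u. indicator {z. fst z \<in> {0..1} \<and> snd z \<in> {0..} \<and> F (snd z) < fst z} (u, t) \<partial>distortion_measure g)
      = (\<integral>\<^sup>+u. indicator {0..} t * indicator {F t<..1} u \<partial>distortion_measure g)"
      using F01[of t] by (intro nn_integral_cong) (auto simp: indicator_def)
    also have "\<dots> = indicator {0..} t * emeasure (distortion_measure g) {F t<..1}"
      by (simp add: nn_integral_cmult)
    also have "emeasure (distortion_measure g) {F t<..1} = ennreal (1 - g (F t))"
      using F01[of t] g(1) by (subst Ioc) (auto simp: G_def distortion_def)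
    finally show "(\<integral>\<^sup>+u. indicator {z. fst z \<in> {0..1} \<and> snd z \<in> {0..} \<and> F (snd z) < fst z} (u, t) \<partial>distortion_measure g)
       = ennreal (1 - g (F t)) * indicator {0..} t" by (simp add: mult.commute)
  qed
  finally have 1: "(\<integral>\<^sup>+u\<in>{0..1}. e2ennreal (VaR M X u) \<partial>distortion_measure g) = (\<integral>\<^sup>+t\<in>{0..}. ennreal (1 - g (F t)) \<partial>lborel)" .
  have Fneg: "F x = 0" if "x < 0" for x
  proof -
    have "X -` {..x} \<inter> space M = {}" using pos that by force
    thus ?thesis by (simp add: F_def cdf_def measure_distr)
  qed
  have VaR0: "e2ennreal (- VaR M X u) = 0" if "u > 0" for u
  proof -
    have "VaR M X u \<ge> 0" unfolding VaR_def F_def[symmetric]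
      proof (rule INF_greatest)
      fix x assume "x \<in> {x. u \<le> F x}"
      thus "0 \<le> ereal x" using Fneg[of x] that by (cases "x < 0") auto
    qed
    thus ?thesis by (simp add: e2ennreal_neg)
  qed
  \<comment> \<open>At \<open>u = 0\<close> the quantile is minus infinity, so the negative part
    does not vanish there; but the clamped distortion is constant on this interval, which is
    therefore null.\<close>
  have "emeasure (distortion_measure g) {-1<..0} = 0"
    by (subst Ioc) (auto simp: G_def)
  hence "AE u in distortion_measure g. u \<notin> {-1<..0}"
    by (intro AE_not_in) (auto simp: null_sets_def)
  hence "(\<integral>\<^sup>+u\<in>{0..1}. e2ennreal (- VaR M X u) \<partial>distortion_measure g) = (\<integral>\<^sup>+u. 0 \<partial>distortion_measure g)"
    by (intro nn_integral_cong_AE) (auto elim!: eventually_mono simp: indicator_def VaR0)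
  thus ?thesis unfolding distortion_integral_def 1 by (simp add: F_def zero_ennreal.rep_eq)
qed

lemma nn_integral_le_distortion_integral:
  fixes X :: "'a \<Rightarrow> real"
  assumes "prob_space M" "X \<in> borel_measurable M" "\<And>x. x \<in> space M \<Longrightarrow> X x \<ge> 0"
    and g: "distortion g" "convex_on {0..1} g" "(g has_real_derivative D) (at_left 1)"
  shows "enn2ereal (\<integral>\<^sup>+x. ennreal (X x) \<partial>M) \<le> distortion_integral M X g"
proof -
  interpret M: prob_space M by fact
  interpret D: real_distribution "distr M borel X"
    using assms(2) by (intro M.real_distribution_distr) auto
  have 1: "g (cdf (distr M borel X) t) \<le> cdf (distr M borel X) t" for t
    using D.cdf_nonneg D.cdf_bounded_prob by (intro convex_distortion_le_id[OF g(1,2)]) auto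
  have "(\<integral>\<^sup>+x. ennreal (X x) \<partial>M) \<le> (\<integral>\<^sup>+t\<in>{0..}. ennreal (1 - g (cdf (distr M borel X) t)) \<partial>lborel)"
    using 1 by (subst nn_integral_cdf_tail[OF assms(1-3)])
      (auto intro!: nn_integral_mono mult_right_mono ennreal_leI)
  thus ?thesis
    by (simp add: distortion_integral_eq[OF assms(1-3) g] less_eq_ennreal.rep_eq)
qed

lemma distortion_integral_le_nn_integral:
  fixes X :: "'a \<Rightarrow> real"
  assumes "prob_space M" "X \<in> borel_measurable M" "\<And>x. x \<in> space M \<Longrightarrow> X x \<ge> 0"
    and g: "distortion g" "convex_on {0..1} g" "(g has_real_derivative D) (at_left 1)" and c: "D \<le> c" "c \<ge> 0"
  shows "distortion_integral M X g \<le> enn2ereal (ennreal c * (\<integral>\<^sup>+x. ennreal (X x) \<partial>M))"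
proof -
  interpret M: prob_space M by fact
  interpret D: real_distribution "distr M borel X"
    using assms(2) by (intro M.real_distribution_distr) auto
  have [measurable]: "cdf (distr M borel X) \<in> borel_measurable borel"
    by (intro borel_measurable_mono monoI D.cdf_nondecreasing)
  have 1: "1 - g (cdf (distr M borel X) t) \<le> c * (1 - cdf (distr M borel X) t)" for t
    using convex_distortion_lipschitz[OF g c(1), of "cdf (distr M borel X) t" 1] g(1)
      D.cdf_nonneg D.cdf_bounded_prob by (auto simp: distortion_def)
  have "(\<integral>\<^sup>+t\<in>{0..}. ennreal (1 - g (cdf (distr M borel X) t)) \<partial>lborel)
    \<le> (\<integral>\<^sup>+t. ennreal c * (ennreal (1 - cdf (distr M borel X) t) * indicator {0..} t) \<partial>lborel)"
    using 1 c D.cdf_bounded_prob by (auto intro!: nn_integral_mono ennreal_leI simp: indicator_def ennreal_mult'[symmetric])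
  also have "\<dots> = ennreal c * (\<integral>\<^sup>+t\<in>{0..}. ennreal (1 - cdf (distr M borel X) t) \<partial>lborel)"
    by (rule nn_integral_cmult) measurable
  also have "(\<integral>\<^sup>+t\<in>{0..}. ennreal (1 - cdf (distr M borel X) t) \<partial>lborel) = (\<integral>\<^sup>+x. ennreal (X x) \<partial>M)"
    by (rule nn_integral_cdf_tail[OF assms(1-3), symmetric])
  finally show ?thesis
    by (simp add: distortion_integral_eq[OF assms(1-3) g] less_eq_ennreal.rep_eq)
qed

section \<open>Kantorovich duality on finite sets\<close>

text \<open>Plans are functions on an arbitrary type. Forcing them to vanish off \<open>S\<close>
  makes the set a product of compact intervals, compact by Tychonoff.\<close>

lemma compact_fun_box:
  fixes S :: "'b set"
  shows "compact {\<pi> :: 'b \<Rightarrow> real. (\<forall>e. 0 \<le> \<pi> e \<and> \<pi> e \<le> of_bool (e \<in> S))}"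
proof -
  let ?C = "\<lambda>e. {0..of_bool (e \<in> S)} :: real set"
  have "compactin (product_topology (\<lambda>_. euclidean) UNIV) (PiE UNIV ?C)"
    by (subst compactin_PiE) (auto simp: compactin_euclidean_iff)
  moreover have "PiE UNIV ?C = {\<pi> :: 'b \<Rightarrow> real. (\<forall>e. 0 \<le> \<pi> e \<and> \<pi> e \<le> of_bool (e \<in> S))}"
    by (auto simp: PiE_def Pi_def)
  ultimately show ?thesis
    by (simp add: euclidean_product_topology compactin_euclidean_iff)
qed

lemma nonneg_derivative_at_0:
  fixes a b :: real
  assumes "\<And>\<theta>. 0 < \<theta> \<Longrightarrow> \<theta> \<le> 1 \<Longrightarrow> 0 \<le> \<theta> * a + \<theta>\<^sup>2 * b"
  shows "0 \<le> a"
proof (rule ccontr)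
  assume "\<not> 0 \<le> a"
  \<comment> \<open>Small enough that \<open>\<theta> * \<bar>b\<bar>\<close> is at most
    \<open>- a / 2\<close>, so that the linear term decides the sign.\<close>
  define \<theta> where "\<theta> = min 1 (- a / (2 * (\<bar>b\<bar> + 1)))"
  have \<theta>: "0 < \<theta>" "\<theta> \<le> 1" using \<open>\<not> 0 \<le> a\<close> by (auto simp: \<theta>_def intro!: divide_neg_pos)
  have "\<theta> \<le> - a / (2 * (\<bar>b\<bar> + 1))" by (simp add: \<theta>_def)
  hence "\<theta> * (2 * (\<bar>b\<bar> + 1)) \<le> - a" by (subst (asm) pos_le_divide_eq) auto
  moreover have "\<theta> * b \<le> \<theta> * \<bar>b\<bar>" by (rule mult_left_mono) (use \<theta> in auto)
  moreover have "\<theta> * (2 * (\<bar>b\<bar> + 1)) = 2 * (\<theta> * \<bar>b\<bar>) + 2 * \<theta>" by (simp add: algebra_simps)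
  ultimately have "a + \<theta> * b < 0" using \<theta> \<open>\<not> 0 \<le> a\<close> by linarith
  hence "\<theta> * (a + \<theta> * b) < 0" using \<theta> by (simp add: mult_pos_neg)
  thus False using assms[OF \<theta>] by (simp add: algebra_simps power2_eq_square)
qed

text \<open>Minimise the violation of the second marginal and of the cost bound over the transport plans
  with first marginal \<open>\<mu>\<close>. At a minimiser with positive violation, the first-order condition
  evaluated at the plan sending each point to the cheapest target for the cost
  \<open>r y + l * d x y\<close> contradicts the dual bound.\<close>

lemma finite_kantorovich:
  fixes d :: "'a \<Rightarrow> 'a \<Rightarrow> real"
  assumes S: "finite S" "S \<noteq> {}"
    and \<mu>: "\<And>x. x \<in> S \<Longrightarrow> \<mu> x \<ge> 0" "sum \<mu> S = 1"
    and \<nu>: "\<And>x. x \<in> S \<Longrightarrow> \<nu> x \<ge> 0" "sum \<nu> S = 1"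
    and d: "\<And>x. d x x = 0" "\<And>x y. d x y \<ge> 0" "\<And>x y z. d x z \<le> d x y + d y z"
           "\<And>x y. d x y = d y x"
    and dual: "\<And>g. (\<And>x y. g x - g y \<le> d x y) \<Longrightarrow> (\<Sum>x\<in>S. (\<mu> x - \<nu> x) * g x) \<le> t"
  shows "\<exists>\<pi>. (\<forall>x\<in>S. \<forall>y\<in>S. \<pi> x y \<ge> 0) \<and> (\<forall>x\<in>S. (\<Sum>y\<in>S. \<pi> x y) = \<mu> x) \<and>
     (\<forall>y\<in>S. (\<Sum>x\<in>S. \<pi> x y) = \<nu> y) \<and> (\<Sum>x\<in>S. \<Sum>y\<in>S. \<pi> x y * d x y) \<le> t"
proof -
  have t: "t \<ge> 0" using dual[of "\<lambda>_. 0"] d(2) by simp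
  define K where "K = {\<pi> :: 'a \<times> 'a \<Rightarrow> real. (\<forall>e. 0 \<le> \<pi> e \<and> \<pi> e \<le> of_bool (e \<in> S \<times> S)) 
     \<and> (\<forall>x\<in>S. (\<Sum>y\<in>S. \<pi> (x, y)) = \<mu> x)}"
  define V where "V = (\<lambda>(\<pi>::'a \<times> 'a \<Rightarrow> real) y. (\<Sum>x\<in>S. \<pi> (x, y)))"
  define c where "c = (\<lambda>(\<pi>::'a \<times> 'a \<Rightarrow> real). (\<Sum>x\<in>S. \<Sum>y\<in>S. \<pi> (x, y) * d x y))"
  \<comment> \<open>Squaring makes the residuals \<open>r\<close> and \<open>l\<close> at the
    minimiser half the gradient of \<open>Q\<close>; they become the dual variables below.\<close>
  define Q where "Q = (\<lambda>\<pi>. (\<Sum>y\<in>S. (V \<pi> y - \<nu> y)\<^sup>2) + (max 0 (c \<pi> - t))\<^sup>2)"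
  have co: "continuous_on A (\<lambda>\<pi> :: 'a \<times> 'a \<Rightarrow> real. \<pi> e)" for e A
    by (rule continuous_on_product_then_coordinatewise) (rule continuous_on_id)
  have Kc: "compact K"
  proof -
    have "closed {\<pi> :: 'a \<times> 'a \<Rightarrow> real. \<forall>x\<in>S. (\<Sum>y\<in>S. \<pi> (x, y)) = \<mu> x}"
      unfolding Ball_def
      by (intro closed_Collect_all closed_Collect_imp closed_Collect_eq continuous_on_sum co continuous_on_const) simp
    from compact_Int_closed[OF compact_fun_box[of "S \<times> S"] this] show ?thesis
      by (simp add: K_def Collect_conj_eq)
  qed
  have plan: "(\<lambda>(x, y). \<mu> x * of_bool (x \<in> S \<and> y = T x)) \<in> K" if T: "T ` S \<subseteq> S" for T
  proof -
    have "\<mu> x \<le> 1" if "x \<in> S" for x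
      using member_le_sum[of x S \<mu>] that \<mu> S by auto
    moreover have "(\<Sum>y\<in>S. \<mu> x * of_bool (x \<in> S \<and> y = T x)) = \<mu> x" if "x \<in> S" for x
    proof -
      have "(\<Sum>y\<in>S. \<mu> x * of_bool (x \<in> S \<and> y = T x)) = (\<Sum>y\<in>S. if y = T x then \<mu> x else 0)"
        using that by (intro sum.cong) auto
      thus ?thesis using S T that by auto
    qed
    ultimately show ?thesis using T \<mu>(1) S by (auto simp: K_def of_bool_def image_subset_iff)
  qed
  have Kne: "K \<noteq> {}" using plan[of id] by auto
  have cQ: "continuous_on K Q" unfolding Q_def V_def c_def
    by (intro continuous_intros co)
  obtain \<pi> where \<pi>: "\<pi> \<in> K" "\<And>\<pi>'. \<pi>' \<in> K \<Longrightarrow> Q \<pi> \<le> Q \<pi>'"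
    using continuous_attains_inf[OF Kc Kne cQ] by auto
  define r where "r = (\<lambda>y. V \<pi> y - \<nu> y)"
  define l where "l = max 0 (c \<pi> - t)"
  have l0: "l \<ge> 0" by (simp add: l_def)
  have first: "0 \<le> (\<Sum>y\<in>S. r y * (V \<pi>' y - V \<pi> y)) + l * (c \<pi>' - c \<pi>)" if \<pi>': "\<pi>' \<in> K" for \<pi>'
  proof -
    let ?A = "(\<Sum>y\<in>S. 2 * r y * (V \<pi>' y - V \<pi> y)) + 2 * l * (c \<pi>' - c \<pi>)"
    let ?B = "(\<Sum>y\<in>S. (V \<pi>' y - V \<pi> y)\<^sup>2) + (c \<pi>' - c \<pi>)\<^sup>2"
    have "0 \<le> \<theta> * ?A + \<theta>\<^sup>2 * ?B" if \<theta>: "0 < \<theta>" "\<theta> \<le> 1" for \<theta>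
    proof -
      let ?p = "\<lambda>e. (1 - \<theta>) * \<pi> e + \<theta> * \<pi>' e"
      have "?p \<in> K"
      proof -
        have le: "p e \<le> of_bool (e \<in> S \<times> S)" if "p \<in> K" for p e using that unfolding K_def by blast
        have "?p e \<le> of_bool (e \<in> S \<times> S)" for e
        proof -
          have "?p e \<le> (1 - \<theta>) * of_bool (e \<in> S \<times> S) + \<theta> * of_bool (e \<in> S \<times> S)"
            using \<theta> le[OF \<pi>(1)] le[OF \<pi>'] by (intro add_mono mult_left_mono) auto
          thus ?thesis by (simp add: algebra_simps)
        qed
        moreover have "?p e \<ge> 0" for e
        proof -
          have "\<pi> e \<ge> 0" "\<pi>' e \<ge> 0" using \<pi>(1) \<pi>' unfolding K_def by blast+
          thus ?thesis using \<theta> by auto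
        qed
        moreover have "(\<Sum>y\<in>S. ?p (x, y)) = \<mu> x" if "x \<in> S" for x
        proof -
          have "(\<Sum>y\<in>S. \<pi> (x, y)) = \<mu> x" "(\<Sum>y\<in>S. \<pi>' (x, y)) = \<mu> x"
            using that \<pi>(1) \<pi>' by (auto simp: K_def)
          thus ?thesis by (simp add: sum.distrib sum_distrib_left[symmetric]) (simp add: algebra_simps)
        qed
        ultimately show ?thesis unfolding K_def by blast
      qed
      have V: "V ?p y - \<nu> y = r y + \<theta> * (V \<pi>' y - V \<pi> y)" for y
        by (simp add: V_def r_def sum.distrib sum_distrib_left[symmetric] sum_subtractf algebra_simps)
      have c: "c ?p = c \<pi> + \<theta> * (c \<pi>' - c \<pi>)"
        by (simp add: c_def sum.distrib sum_distrib_left sum_subtractf algebra_simps)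
      have "Q \<pi> \<le> Q ?p" using \<pi>(2)[OF \<open>?p \<in> K\<close>] .
      also have "Q ?p \<le> (\<Sum>y\<in>S. (r y + \<theta> * (V \<pi>' y - V \<pi> y))\<^sup>2) + (l + \<theta> * (c \<pi>' - c \<pi>))\<^sup>2"
      proof -
        \<comment> \<open>The positive part is not smooth. This majorant agrees with it at
          \<open>\<theta> = 0\<close> and has a quadratic square, so nothing has to be
          differentiated.\<close>
        have "max 0 (c ?p - t) \<le> \<bar>l + \<theta> * (c \<pi>' - c \<pi>)\<bar>"
          unfolding c l_def by (auto simp: max_def abs_if)
        hence "(max 0 (c ?p - t))\<^sup>2 \<le> (l + \<theta> * (c \<pi>' - c \<pi>))\<^sup>2"
          by (metis abs_le_square_iff abs_of_nonneg max.cobounded1)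
        thus ?thesis by (simp add: Q_def V)
      qed
      also have "\<dots> = Q \<pi> + \<theta> * ?A + \<theta>\<^sup>2 * ?B"
      proof -
        have sq: "(a + \<theta> * b)\<^sup>2 = a\<^sup>2 + \<theta> * (2 * a * b) + \<theta>\<^sup>2 * b\<^sup>2" for a b :: real
          by (simp add: power2_eq_square algebra_simps)
        have Q: "Q \<pi> = (\<Sum>y\<in>S. (r y)\<^sup>2) + l\<^sup>2" by (simp add: Q_def r_def l_def)
        show ?thesis unfolding sq Q sum.distrib sum_distrib_left[symmetric]
          by (simp add: algebra_simps)
      qed
      finally show ?thesis by simp
    qed
    from nonneg_derivative_at_0[OF this] have "0 \<le> ?A" by blast
    also have "?A = 2 * ((\<Sum>y\<in>S. r y * (V \<pi>' y - V \<pi> y)) + l * (c \<pi>' - c \<pi>))"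
      by (simp add: sum_distrib_left algebra_simps)
    finally show ?thesis by simp
  qed
  \<comment> \<open>The Kantorovich potential: the cost transform of \<open>r\<close> for the cost
    \<open>l * d\<close>. As a minimum of translates it inherits the Lipschitz constant
    \<open>l\<close>, so \<open>g / l\<close> is admissible in \<open>dual\<close>.\<close>
  define g where "g = (\<lambda>x. Min ((\<lambda>y. r y + l * d x y) ` S))"
  have g_ex: "\<exists>y\<in>S. g x = r y + l * d x y" for x
  proof -
    have "g x \<in> (\<lambda>y. r y + l * d x y) ` S" unfolding g_def by (rule Min_in) (use S in auto)
    thus ?thesis by auto
  qed
  then obtain T where T: "\<And>x. T x \<in> S" "\<And>x. g x = r (T x) + l * d x (T x)" by metis
  have g_le: "g x \<le> r y + l * d x y" if "y \<in> S" for x y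
    unfolding g_def using S that by (intro Min_le) auto
  have g_lip: "g x - g y \<le> l * d x y" for x y
  proof -
    have "g x \<le> r (T y) + l * d x (T y)" by (rule g_le) (rule T)
    also have "\<dots> \<le> r (T y) + l * (d x y + d y (T y))" using d(3) l0 by (intro add_left_mono mult_left_mono) auto
    finally show ?thesis by (simp add: T(2)[of y] algebra_simps)
  qed
  have g_r: "g x \<le> r x" if "x \<in> S" for x using g_le[of x x] that d(1) by simp
  have dual': "(\<Sum>x\<in>S. (\<mu> x - \<nu> x) * g x) \<le> l * t"
  \<comment> \<open>Without a positive \<open>l\<close> no rescaling is possible, but then
    \<open>g\<close> is constant and its pairing with two measures of equal mass is zero.\<close>
  proof (cases "l = 0")
    case True
    obtain s where "s \<in> S" using S by auto
    have "g x = g s" for x using g_lip[of x s] g_lip[of s x] True by simp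
    hence "(\<Sum>x\<in>S. (\<mu> x - \<nu> x) * g x) = (\<Sum>x\<in>S. (\<mu> x - \<nu> x) * g s)"
      by (intro sum.cong refl arg_cong2[where f=times])
    also have "\<dots> = 0" by (simp only: sum_distrib_right[symmetric] sum_subtractf \<mu> \<nu>) simp
    finally show ?thesis using True by simp
  next
    case False
    have "(\<Sum>x\<in>S. (\<mu> x - \<nu> x) * (g x / l)) \<le> t"
    proof (rule dual)
      show "g x / l - g y / l \<le> d x y" for x y
        using g_lip[of x y] False l0 by (simp add: divide_simps algebra_simps)
    qed
    thus ?thesis using False l0 by (simp add: sum_divide_distrib[symmetric] divide_simps mult.commute)
  qed
  define p where "p = (\<lambda>(x, y). \<mu> x * of_bool (x \<in> S \<and> y = T x))"
  have pK: "p \<in> K" unfolding p_def by (rule plan) (use T in auto)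
  have sumT: "(\<Sum>y\<in>S. p (x, y) * f y) = \<mu> x * f (T x)" if "x \<in> S" for x f
  proof -
    have "(\<Sum>y\<in>S. p (x, y) * f y) = (\<Sum>y\<in>S. if y = T x then \<mu> x * f (T x) else 0)"
      using that by (intro sum.cong) (auto simp: p_def)
    thus ?thesis using S T by simp
  qed
  have "(\<Sum>y\<in>S. r y * V p y) = (\<Sum>x\<in>S. \<Sum>y\<in>S. p (x, y) * r y)"
    unfolding V_def sum_distrib_left by (subst sum.swap) (simp add: mult.commute)
  hence 1: "(\<Sum>y\<in>S. r y * V p y) = (\<Sum>x\<in>S. \<mu> x * r (T x))" by (simp add: sumT)
  have 2: "c p = (\<Sum>x\<in>S. \<mu> x * d x (T x))" by (simp add: c_def sumT)
  have "(\<Sum>y\<in>S. r y * V p y) + l * c p = (\<Sum>x\<in>S. \<mu> x * g x)"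
    unfolding 1 2 T(2) by (simp add: sum_distrib_left sum.distrib algebra_simps)
  moreover have "(\<Sum>y\<in>S. r y * V \<pi> y) = (\<Sum>y\<in>S. r y * \<nu> y) + (\<Sum>y\<in>S. (r y)\<^sup>2)"
    unfolding sum.distrib[symmetric] by (intro sum.cong) (auto simp: r_def power2_eq_square algebra_simps)
  moreover have "l * c \<pi> = l * t + l\<^sup>2" by (auto simp: l_def max_def power2_eq_square algebra_simps)
  moreover have "(\<Sum>y\<in>S. g y * \<nu> y) \<le> (\<Sum>y\<in>S. r y * \<nu> y)"
    by (intro sum_mono mult_right_mono g_r \<nu>) auto
  \<comment> \<open>At the cheapest-target plan \<open>p\<close> the linearised objective is at most
    the sum of \<open>r y * \<nu> y\<close> plus \<open>l * t\<close>. This falls short of its value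
    at the minimiser by exactly the squared residuals, so these vanish.\<close>
  ultimately have "(\<Sum>y\<in>S. (r y)\<^sup>2) + l\<^sup>2 \<le> 0"
    using first[OF pK] dual' by (simp add: algebra_simps sum_subtractf)
  moreover have "(\<Sum>y\<in>S. (r y)\<^sup>2) \<ge> 0" by (intro sum_nonneg) auto
  ultimately have "l\<^sup>2 \<le> 0" "(\<Sum>y\<in>S. (r y)\<^sup>2) = 0" by (smt (verit) zero_le_power2)+
  hence "l = 0" "\<And>y. y \<in> S \<Longrightarrow> r y = 0" using S by (auto simp: sum_nonneg_eq_0_iff)
  hence "c \<pi> \<le> t" "\<And>y. y \<in> S \<Longrightarrow> V \<pi> y = \<nu> y" by (auto simp: l_def r_def max_def split: if_splits)
  thus ?thesis using \<pi>(1) by (intro exI[of _ "curry \<pi>"]) (auto simp: K_def V_def c_def)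
qed

section \<open>Couplings from quantised couplings\<close>

lemma nn_integral_finite_range:
  fixes \<phi> :: "'s \<Rightarrow> real"
  assumes "finite S" and [measurable]: "q \<in> measurable M (count_space UNIV)" and "\<And>x. x \<in> space M \<Longrightarrow> q x \<in> S"
  shows "(\<integral>\<^sup>+x. ennreal (\<phi> (q x)) \<partial>M) = (\<Sum>s\<in>S. ennreal (\<phi> s) * emeasure M {x\<in>space M. q x = s})"
proof -
  have "(\<integral>\<^sup>+x. ennreal (\<phi> (q x)) \<partial>M) = (\<integral>\<^sup>+x. (\<Sum>s\<in>S. ennreal (\<phi> s) * indicator {x\<in>space M. q x = s} x) \<partial>M)"
  proof (rule nn_integral_cong)
    fix x assume x: "x \<in> space M"
    have "(\<Sum>s\<in>S. ennreal (\<phi> s) * indicator {x\<in>space M. q x = s} x) = (\<Sum>s\<in>S. if s = q x then ennreal (\<phi> s) else 0)"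
      using x by (intro sum.cong) auto
    thus "ennreal (\<phi> (q x)) = (\<Sum>s\<in>S. ennreal (\<phi> s) * indicator {x\<in>space M. q x = s} x)"
      using assms x by simp
  qed
  also have "\<dots> = (\<Sum>s\<in>S. ennreal (\<phi> s) * emeasure M {x\<in>space M. q x = s})"
    by (subst nn_integral_sum) (auto simp: nn_integral_cmult)
  finally show ?thesis .
qed

lemma couplings_nn_integral_fst:
  assumes "R \<in> couplings P Q" "f \<in> borel_measurable P"
  shows "(\<integral>\<^sup>+z. f (fst z) \<partial>R) = (\<integral>\<^sup>+x. f x \<partial>P)"
proof -
  have R: "sets R = sets (P \<Otimes>\<^sub>M Q)" "distr R P fst = P"
    using assms(1) by (auto simp: couplings_def space_prob_algebra)
  have "fst \<in> measurable R P" using measurable_fst[of P Q] R(1) by (simp cong: measurable_cong_sets)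
  hence "(\<integral>\<^sup>+x. f x \<partial>distr R P fst) = (\<integral>\<^sup>+z. f (fst z) \<partial>R)"
    using assms(2) by (intro nn_integral_distr) auto
  thus ?thesis by (simp add: R)
qed

lemma couplings_nn_integral_snd:
  assumes "R \<in> couplings P Q" "f \<in> borel_measurable Q"
  shows "(\<integral>\<^sup>+z. f (snd z) \<partial>R) = (\<integral>\<^sup>+x. f x \<partial>Q)"
proof -
  have R: "sets R = sets (P \<Otimes>\<^sub>M Q)" "distr R Q snd = Q"
    using assms(1) by (auto simp: couplings_def space_prob_algebra)
  have "snd \<in> measurable R Q" using measurable_snd[of P Q] R(1) by (simp cong: measurable_cong_sets)
  hence "(\<integral>\<^sup>+x. f x \<partial>distr R Q snd) = (\<integral>\<^sup>+z. f (snd z) \<partial>R)"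
    using assms(2) by (intro nn_integral_distr) auto
  thus ?thesis by (simp add: R)
qed

text \<open>Inside each pair of cells the product measure is kept, reweighted by the plan over the
  product of the cell masses. The row and column sums of the plan then restore both marginals, and a
  cost depending on the cells integrates to a finite sum.\<close>

lemma coupling_of_quantisation:
  fixes M1 :: "'a measure" and M2 :: "'b measure" and \<pi> :: "'s \<Rightarrow> 's \<Rightarrow> real"
  assumes M1: "prob_space M1" and M2: "prob_space M2" and S: "finite S"
    and q1[measurable]: "q1 \<in> measurable M1 (count_space UNIV)" and q1S: "\<And>x. x \<in> space M1 \<Longrightarrow> q1 x \<in> S"
    and q2[measurable]: "q2 \<in> measurable M2 (count_space UNIV)" and q2S: "\<And>x. x \<in> space M2 \<Longrightarrow> q2 x \<in> S"
    and \<pi>: "\<And>s t. s \<in> S \<Longrightarrow> t \<in> S \<Longrightarrow> \<pi> s t \<ge> 0"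
    and row: "\<And>s. s \<in> S \<Longrightarrow> (\<Sum>t\<in>S. \<pi> s t) = measure M1 {x\<in>space M1. q1 x = s}"
    and col: "\<And>t. t \<in> S \<Longrightarrow> (\<Sum>s\<in>S. \<pi> s t) = measure M2 {x\<in>space M2. q2 x = t}"
  shows "\<exists>R\<in>couplings M1 M2. \<forall>w. (\<forall>s\<in>S. \<forall>t\<in>S. w s t \<ge> 0) \<longrightarrow>
     (\<integral>\<^sup>+z. ennreal (w (q1 (fst z)) (q2 (snd z))) \<partial>R) = ennreal (\<Sum>s\<in>S. \<Sum>t\<in>S. \<pi> s t * w s t)"
proof -
  interpret M1: prob_space M1 by fact
  interpret M2: prob_space M2 by fact
  interpret P: pair_prob_space M1 M2 ..
  define a where "a s = measure M1 {x\<in>space M1. q1 x = s}" for s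
  define b where "b t = measure M2 {x\<in>space M2. q2 x = t}" for t
  have ab: "a s \<ge> 0" "b s \<ge> 0" for s by (simp_all add: a_def b_def)
  have za: "\<pi> s t = 0" if "s \<in> S" "t \<in> S" "a s = 0" for s t
    using row[OF that(1)] that sum_nonneg_eq_0_iff[of S "\<pi> s"] S \<pi> by (auto simp: a_def)
  have zb: "\<pi> s t = 0" if "s \<in> S" "t \<in> S" "b t = 0" for s t
    using col[OF that(2)] that sum_nonneg_eq_0_iff[of S "\<lambda>s. \<pi> s t"] S \<pi> by (auto simp: b_def)
  \<comment> \<open>Division by zero yields 0 here; this is the right value, since by
    \<open>za\<close> and \<open>zb\<close> the plan vanishes on null cells.\<close>
  define r where "r s t = \<pi> s t / (a s * b t)" for s t
  have r0: "r s t \<ge> 0" if "s \<in> S" "t \<in> S" for s t using \<pi> that ab by (simp add: r_def)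
  have int1: "(\<integral>\<^sup>+x. ennreal (\<phi> (q1 x)) \<partial>M1) = ennreal (\<Sum>s\<in>S. \<phi> s * a s)" if "\<And>s. s \<in> S \<Longrightarrow> \<phi> s \<ge> 0" for \<phi>
    using that ab by (subst nn_integral_finite_range[OF S q1 q1S])
      (auto simp: M1.emeasure_eq_measure a_def[symmetric] ennreal_mult[symmetric] sum_ennreal)
  have int2: "(\<integral>\<^sup>+x. ennreal (\<phi> (q2 x)) \<partial>M2) = ennreal (\<Sum>s\<in>S. \<phi> s * b s)" if "\<And>s. s \<in> S \<Longrightarrow> \<phi> s \<ge> 0" for \<phi>
    using that ab by (subst nn_integral_finite_range[OF S q2 q2S])
      (auto simp: M2.emeasure_eq_measure b_def[symmetric] ennreal_mult[symmetric] sum_ennreal)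
  define R where "R = density (M1 \<Otimes>\<^sub>M M2) (\<lambda>z. ennreal (r (q1 (fst z)) (q2 (snd z))))"
  \<comment> \<open>The pair of cells takes finitely many values, so any weight on it is a finite
    combination of indicators of rectangles.\<close>
  have mr[measurable]: "(\<lambda>z. ennreal (w (q1 (fst z)) (q2 (snd z)))) \<in> borel_measurable (M1 \<Otimes>\<^sub>M M2)" for w
  proof -
    have "(\<lambda>z. \<Sum>s\<in>S. \<Sum>t\<in>S. ennreal (w s t) * indicator {x\<in>space M1. q1 x = s} (fst z) * indicator {x\<in>space M2. q2 x = t} (snd z)) 
       \<in> borel_measurable (M1 \<Otimes>\<^sub>M M2)" by measurable
    also have "?this \<longleftrightarrow> ?thesis"
    proof (rule measurable_cong)
      fix z assume "z \<in> space (M1 \<Otimes>\<^sub>M M2)"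
      hence z: "fst z \<in> space M1" "snd z \<in> space M2" by (auto simp: space_pair_measure)
      have "(\<Sum>s\<in>S. \<Sum>t\<in>S. ennreal (w s t) * indicator {x\<in>space M1. q1 x = s} (fst z) * indicator {x\<in>space M2. q2 x = t} (snd z))
        = (\<Sum>s\<in>S. \<Sum>t\<in>S. if t = q2 (snd z) then (if s = q1 (fst z) then ennreal (w s t) else 0) else 0)"
        using z by (intro sum.cong) (auto simp: indicator_def)
      also have "\<dots> = ennreal (w (q1 (fst z)) (q2 (snd z)))"
        using S z q1S q2S by simp
      finally show "(\<Sum>s\<in>S. \<Sum>t\<in>S. ennreal (w s t) * indicator {x\<in>space M1. q1 x = s} (fst z) * indicator {x\<in>space M2. q2 x = t} (snd z))
        = ennreal (w (q1 (fst z)) (q2 (snd z)))" .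
    qed
    finally show ?thesis .
  qed
  have Ia: "(\<integral>\<^sup>+y. ennreal (r s (q2 y)) \<partial>M2) = indicator {s. a s \<noteq> 0} s" if s: "s \<in> S" for s
  proof -
    have "(\<Sum>t\<in>S. r s t * b t) = (\<Sum>t\<in>S. \<pi> s t / a s)"
      using zb[OF s] by (intro sum.cong) (auto simp: r_def)
    also have "\<dots> = indicator {s. a s \<noteq> 0} s"
      using row[OF s] by (simp add: sum_divide_distrib[symmetric] a_def[symmetric] indicator_def)
    finally show ?thesis using r0 s by (subst int2) (auto simp: indicator_def)
  qed
  have Ib: "(\<integral>\<^sup>+x. ennreal (r (q1 x) t) \<partial>M1) = indicator {t. b t \<noteq> 0} t" if t: "t \<in> S" for t
  proof -
    have "(\<Sum>s\<in>S. r s t * a s) = (\<Sum>s\<in>S. \<pi> s t / b t)"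
      using za[OF _ t] by (intro sum.cong) (auto simp: r_def)
    also have "\<dots> = indicator {t. b t \<noteq> 0} t"
      using col[OF t] by (simp add: sum_divide_distrib[symmetric] b_def[symmetric] indicator_def)
    finally show ?thesis using r0 t by (subst int1) (auto simp: indicator_def)
  qed
  have AEa: "AE x in M1. a (q1 x) \<noteq> 0"
  proof -
    have "AE x in M1. \<forall>s\<in>S. a s = 0 \<longrightarrow> q1 x \<noteq> s"
    proof (intro AE_finite_allI S AE_impI)
      fix s assume "a s = 0"
      thus "AE x in M1. q1 x \<noteq> s"
        by (intro AE_I[where N="{x\<in>space M1. q1 x = s}"]) (auto simp: M1.emeasure_eq_measure a_def)
    qed
    thus ?thesis using q1S by (auto elim!: AE_mp)
  qed
  have AEb: "AE x in M2. b (q2 x) \<noteq> 0"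
  proof -
    have "AE x in M2. \<forall>s\<in>S. b s = 0 \<longrightarrow> q2 x \<noteq> s"
    proof (intro AE_finite_allI S AE_impI)
      fix s assume "b s = 0"
      thus "AE x in M2. q2 x \<noteq> s"
        by (intro AE_I[where N="{x\<in>space M2. q2 x = s}"]) (auto simp: M2.emeasure_eq_measure b_def)
    qed
    thus ?thesis using q2S by (auto elim!: AE_mp)
  qed
  have setsR[simp, measurable_cong]: "sets R = sets (M1 \<Otimes>\<^sub>M M2)" by (simp add: R_def)
  have [measurable]: "fst \<in> measurable R M1" "snd \<in> measurable R M2"
    using measurable_fst measurable_snd by measurable
  have d1: "distr R M1 fst = M1"
  proof (rule measure_eqI)
    fix A assume "A \<in> sets (distr R M1 fst)"
    hence A[measurable]: "A \<in> sets M1" by simp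
    have "emeasure (distr R M1 fst) A = (\<integral>\<^sup>+z. indicator A (fst z) \<partial>R)"
      using A by (simp add: nn_integral_indicator[symmetric] nn_integral_distr del: nn_integral_indicator)
    also have "\<dots> = (\<integral>\<^sup>+z. ennreal (r (q1 (fst z)) (q2 (snd z))) * indicator A (fst z) \<partial>(M1 \<Otimes>\<^sub>M M2))"
      unfolding R_def by (rule nn_integral_density) auto
    also have "\<dots> = (\<integral>\<^sup>+x. (\<integral>\<^sup>+y. ennreal (r (q1 x) (q2 y)) * indicator A x \<partial>M2) \<partial>M1)"
      by (subst M2.nn_integral_fst[symmetric]) auto
    also have "\<dots> = (\<integral>\<^sup>+x. indicator A x \<partial>M1)"
    proof (rule nn_integral_cong_AE)
      show "AE x in M1. (\<integral>\<^sup>+y. ennreal (r (q1 x) (q2 y)) * indicator A x \<partial>M2) = indicator A x"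
        using AEa AE_space
      proof eventually_elim
        case (elim x)
        thus ?case using Ia[OF q1S[of x]] by (cases "x \<in> A") auto
      qed
    qed
    finally show "emeasure (distr R M1 fst) A = emeasure M1 A" by simp
  qed simp
  have d2: "distr R M2 snd = M2"
  proof (rule measure_eqI)
    fix A assume "A \<in> sets (distr R M2 snd)"
    hence A[measurable]: "A \<in> sets M2" by simp
    have "emeasure (distr R M2 snd) A = (\<integral>\<^sup>+z. indicator A (snd z) \<partial>R)"
      using A by (simp add: nn_integral_indicator[symmetric] nn_integral_distr del: nn_integral_indicator)
    also have "\<dots> = (\<integral>\<^sup>+z. ennreal (r (q1 (fst z)) (q2 (snd z))) * indicator A (snd z) \<partial>(M1 \<Otimes>\<^sub>M M2))"
      unfolding R_def by (rule nn_integral_density) auto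
    also have "\<dots> = (\<integral>\<^sup>+y. (\<integral>\<^sup>+x. ennreal (r (q1 x) (q2 y)) * indicator A y \<partial>M1) \<partial>M2)"
      by (subst P.nn_integral_snd[symmetric]) auto
    also have "\<dots> = (\<integral>\<^sup>+x. indicator A x \<partial>M2)"
    proof (rule nn_integral_cong_AE)
      show "AE y in M2. (\<integral>\<^sup>+x. ennreal (r (q1 x) (q2 y)) * indicator A y \<partial>M1) = indicator A y"
        using AEb AE_space
      proof eventually_elim
        case (elim x)
        thus ?case using Ib[OF q2S[of x]] by (cases "x \<in> A") auto
      qed
    qed
    finally show "emeasure (distr R M2 snd) A = emeasure M2 A" by simp
  qed simp
  have "prob_space R"
  proof (rule prob_spaceI)
    have "emeasure (distr R M1 fst) (space M1) = emeasure R (space R)"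
      by (subst emeasure_distr) (auto simp: sets_eq_imp_space_eq[OF setsR] space_pair_measure intro!: arg_cong2[where f=emeasure])
    thus "emeasure R (space R) = 1" by (simp add: d1 M1.emeasure_space_1)
  qed
  hence "R \<in> couplings M1 M2" using d1 d2 by (simp add: couplings_def space_prob_algebra)
  moreover have "(\<integral>\<^sup>+z. ennreal (w (q1 (fst z)) (q2 (snd z))) \<partial>R) = ennreal (\<Sum>s\<in>S. \<Sum>t\<in>S. \<pi> s t * w s t)"
    if w: "\<forall>s\<in>S. \<forall>t\<in>S. w s t \<ge> 0" for w
  proof -
    have "(\<integral>\<^sup>+z. ennreal (w (q1 (fst z)) (q2 (snd z))) \<partial>R) = 
      (\<integral>\<^sup>+z. ennreal (r (q1 (fst z)) (q2 (snd z))) * ennreal (w (q1 (fst z)) (q2 (snd z))) \<partial>(M1 \<Otimes>\<^sub>M M2))"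
      unfolding R_def by (rule nn_integral_density) auto
    also have "\<dots> = (\<integral>\<^sup>+x. (\<integral>\<^sup>+y. ennreal (r (q1 x) (q2 y)) * ennreal (w (q1 x) (q2 y)) \<partial>M2) \<partial>M1)"
      by (subst M2.nn_integral_fst[symmetric]) auto
    also have "\<dots> = (\<integral>\<^sup>+x. ennreal (\<Sum>t\<in>S. r (q1 x) t * w (q1 x) t * b t) \<partial>M1)"
    proof (rule nn_integral_cong)
      fix x assume x: "x \<in> space M1"
      have "(\<integral>\<^sup>+y. ennreal (r (q1 x) (q2 y)) * ennreal (w (q1 x) (q2 y)) \<partial>M2) = (\<integral>\<^sup>+y. ennreal (r (q1 x) (q2 y) * w (q1 x) (q2 y)) \<partial>M2)"
        using w r0 q1S[OF x] q2S by (intro nn_integral_cong) (simp add: ennreal_mult)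
      also have "\<dots> = ennreal (\<Sum>t\<in>S. r (q1 x) t * w (q1 x) t * b t)"
        using w r0 q1S[OF x] by (intro int2) auto
      finally show "(\<integral>\<^sup>+y. ennreal (r (q1 x) (q2 y)) * ennreal (w (q1 x) (q2 y)) \<partial>M2) = \<dots>" .
    qed
    also have "\<dots> = ennreal (\<Sum>s\<in>S. (\<Sum>t\<in>S. r s t * w s t * b t) * a s)"
      using w r0 ab by (intro int1) (auto intro!: sum_nonneg)
    also have "(\<Sum>s\<in>S. (\<Sum>t\<in>S. r s t * w s t * b t) * a s) = (\<Sum>s\<in>S. \<Sum>t\<in>S. \<pi> s t * w s t)"
    proof (intro sum.cong refl)
      fix s assume s: "s \<in> S"
      show "(\<Sum>t\<in>S. r s t * w s t * b t) * a s = (\<Sum>t\<in>S. \<pi> s t * w s t)"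
        unfolding sum_distrib_right using za[OF s] zb[OF s] by (intro sum.cong) (auto simp: r_def)
    qed
    finally show ?thesis .
  qed
  ultimately show ?thesis by blast
qed

section \<open>Exponential concentration for product measures\<close>

lemma abs_le_imp_power2_le: "\<bar>a :: real\<bar> \<le> b \<Longrightarrow> a\<^sup>2 \<le> b\<^sup>2"
  using power_mono[of "\<bar>a\<bar>" b 2] by simp

text \<open>Second-order Taylor expansion. Keeping \<open>exp \<bar>v\<bar>\<close> in the remainder
  makes it usable for unbounded variables with exponential moments.\<close>

lemma exp_le_quadratic: "exp v \<le> 1 + v + v\<^sup>2 * exp \<bar>v :: real\<bar>"
proof -
  obtain t where t: "\<bar>t\<bar> \<le> \<bar>v\<bar>" "exp v = (\<Sum>m<2. (v ^ m) / fact m) + (exp t / fact 2) * v ^ 2"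
    using Maclaurin_exp_le[of v 2] by blast
  have "exp t / 2 \<le> exp \<bar>v\<bar>"
    using t(1) by (smt (verit) exp_gt_zero exp_le_cancel_iff field_sum_of_halves)
  hence "exp t / 2 * v\<^sup>2 \<le> exp \<bar>v\<bar> * v\<^sup>2" by (intro mult_right_mono) auto
  thus ?thesis using t(2) by (simp add: numeral_2_eq_2 mult.commute)
qed

text \<open>Averaging the oscillation bound over \<open>y\<close> shows that \<open>\<phi>\<close>
  differs from its mean by at most \<open>\<beta> x + B\<close>. The linear Taylor term integrates
  to zero and the quadratic one to at most \<open>K * s^2\<close>. The bound \<open>C\<close>
  secures integrability; the estimate sees \<open>\<phi>\<close> through \<open>\<beta>\<close>
  only, so it is uniform in the truncation.\<close>

lemma (in prob_space) mgf_bound: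
  fixes \<phi> \<beta> :: "'a \<Rightarrow> real"
  assumes [measurable]: "\<phi> \<in> borel_measurable M" and bdd: "\<And>x. x \<in> space M \<Longrightarrow> \<bar>\<phi> x\<bar> \<le> C"
    and \<beta>: "integrable M \<beta>"
    and osc: "\<And>x y. x \<in> space M \<Longrightarrow> y \<in> space M \<Longrightarrow> \<bar>\<phi> x - \<phi> y\<bar> \<le> \<beta> x + \<beta> y"
    and B: "B = (\<integral>x. \<beta> x \<partial>M)"
    and K: "integrable M (\<lambda>x. (\<beta> x + B)\<^sup>2 * exp (s0 * (\<beta> x + B)))"
       "K = (\<integral>x. (\<beta> x + B)\<^sup>2 * exp (s0 * (\<beta> x + B)) \<partial>M)"
    and s: "0 \<le> s" "s \<le> s0"
  shows "(\<integral>x. exp (s * \<phi> x) \<partial>M) \<le> exp (s * (\<integral>x. \<phi> x \<partial>M) + K * s\<^sup>2)"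
proof -
  define m where "m = (\<integral>x. \<phi> x \<partial>M)"
  have int: "integrable M \<phi>"
    by (rule integrable_const_bound[of _ C]) (use bdd in auto)
  have dev: "\<bar>\<phi> x - m\<bar> \<le> \<beta> x + B" if x: "x \<in> space M" for x
  proof -
    have "\<phi> x - m = (\<integral>y. \<phi> x - \<phi> y \<partial>M)" unfolding m_def
      using int by (simp add: prob_space)
    also have "\<bar>\<dots>\<bar> \<le> (\<integral>y. \<bar>\<phi> x - \<phi> y\<bar> \<partial>M)" by (rule integral_abs_bound)
    also have "\<dots> \<le> (\<integral>y. \<beta> x + \<beta> y \<partial>M)"
      using int \<beta> osc x by (intro integral_mono) auto
    also have "\<dots> = \<beta> x + B" using \<beta> by (simp add: B prob_space)
    finally show ?thesis .
  qed
  have "(\<integral>x. exp (s * (\<phi> x - m)) \<partial>M) \<le> (\<integral>x. 1 + s * (\<phi> x - m) + s\<^sup>2 * ((\<beta> x + B)\<^sup>2 * exp (s0 * (\<beta> x + B))) \<partial>M)"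
  proof (rule integral_mono)
    show "integrable M (\<lambda>x. exp (s * (\<phi> x - m)))"
    proof (rule integrable_const_bound[of _ "exp (s * (C + \<bar>m\<bar>))"])
      have "\<phi> x - m \<le> C + \<bar>m\<bar>" if "x \<in> space M" for x using bdd[OF that] by auto
      thus "AE x in M. norm (exp (s * (\<phi> x - m))) \<le> exp (s * (C + \<bar>m\<bar>))"
        using s by (auto intro!: mult_left_mono)
    qed measurable
    show "integrable M (\<lambda>x. 1 + s * (\<phi> x - m) + s\<^sup>2 * ((\<beta> x + B)\<^sup>2 * exp (s0 * (\<beta> x + B))))"
      using int K by auto
    fix x assume x: "x \<in> space M"
    let ?v = "s * (\<phi> x - m)"
    have "\<bar>?v\<bar> \<le> s0 * (\<beta> x + B)" using dev[OF x] s by (auto simp: abs_mult intro!: mult_mono)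
    hence "exp \<bar>?v\<bar> \<le> exp (s0 * (\<beta> x + B))" by simp
    moreover have "(\<phi> x - m)\<^sup>2 \<le> (\<beta> x + B)\<^sup>2"
      by (rule abs_le_imp_power2_le[OF dev[OF x]])
    hence "?v\<^sup>2 \<le> s\<^sup>2 * (\<beta> x + B)\<^sup>2"
      by (simp add: power_mult_distrib mult_left_mono)
    ultimately have "?v\<^sup>2 * exp \<bar>?v\<bar> \<le> (s\<^sup>2 * (\<beta> x + B)\<^sup>2) * exp (s0 * (\<beta> x + B))"
      by (intro mult_mono) auto
    thus "exp ?v \<le> 1 + ?v + s\<^sup>2 * ((\<beta> x + B)\<^sup>2 * exp (s0 * (\<beta> x + B)))"
      using exp_le_quadratic[of ?v] by (simp add: mult.assoc)
  qed
  also have "\<dots> = 1 + s\<^sup>2 * K"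
    using int K by (simp add: prob_space m_def)
  also have "\<dots> \<le> exp (s\<^sup>2 * K)" by simp
  finally have "(\<integral>x. exp (s * (\<phi> x - m)) \<partial>M) \<le> exp (s\<^sup>2 * K)" .
  hence "exp (s * m) * (\<integral>x. exp (s * (\<phi> x - m)) \<partial>M) \<le> exp (s * m) * exp (s\<^sup>2 * K)"
    by (intro mult_left_mono) auto
  also have "exp (s * m) * (\<integral>x. exp (s * (\<phi> x - m)) \<partial>M) = (\<integral>x. exp (s * m) * exp (s * (\<phi> x - m)) \<partial>M)"
    by simp
  also have "(\<lambda>x. exp (s * m) * exp (s * (\<phi> x - m))) = (\<lambda>x. exp (s * \<phi> x))"
    by (simp add: exp_add[symmetric] algebra_simps)
  finally show ?thesis by (simp add: m_def exp_add mult.commute)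
qed

text \<open>A McDiarmid argument with oscillations that depend on the exchanged values. Integrating
  out the last coordinate costs a factor \<open>exp (K * s^2)\<close> by \<open>mgf_bound\<close>
  and leaves a function of the remaining coordinates with the same oscillation bound.\<close>

lemma (in prob_space) product_mgf_bound:
  fixes F :: "(nat \<Rightarrow> 'a) \<Rightarrow> real" and \<beta> :: "'a \<Rightarrow> real"
  assumes \<beta>: "integrable M \<beta>"
    and B: "B = (\<integral>x. \<beta> x \<partial>M)"
    and K: "integrable M (\<lambda>x. (\<beta> x + B)\<^sup>2 * exp (s0 * (\<beta> x + B)))"
       "K = (\<integral>x. (\<beta> x + B)\<^sup>2 * exp (s0 * (\<beta> x + B)) \<partial>M)"
    and s: "0 \<le> s" "s \<le> s0"
    and F: "F \<in> borel_measurable (PiM {..<N} (\<lambda>_. M))" "\<And>x. x \<in> space (PiM {..<N} (\<lambda>_. M)) \<Longrightarrow> \<bar>F x\<bar> \<le> C"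
    and osc: "\<And>x i u v. x \<in> space (PiM {..<N} (\<lambda>_. M)) \<Longrightarrow> i < N \<Longrightarrow> u \<in> space M \<Longrightarrow> v \<in> space M \<Longrightarrow>
        \<bar>F (x(i := u)) - F (x(i := v))\<bar> \<le> \<beta> u + \<beta> v"
  shows "(\<integral>x. exp (s * F x) \<partial>PiM {..<N} (\<lambda>_. M)) \<le> exp (s * (\<integral>x. F x \<partial>PiM {..<N} (\<lambda>_. M)) + real N * (K * s\<^sup>2))"
  using F osc
proof (induction N arbitrary: F)
  case 0
  interpret product_prob_space "\<lambda>_. M" "{}::nat set" ..
  show ?case by (simp add: PiM_empty lebesgue_integral_count_space_finite)
next
  case (Suc N)
  note [measurable] = Suc.prems(1)
  interpret PP: product_prob_space "\<lambda>_. M" "{..<N}" ..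
  interpret PS: product_prob_space "\<lambda>_. M" "{..<Suc N}" ..
  have ins: "{..<Suc N} = insert N {..<N}" by auto
  have upd: "x(N := y) \<in> space (PiM {..<Suc N} (\<lambda>_. M))" if "x \<in> space (PiM {..<N} (\<lambda>_. M))" "y \<in> space M" for x y
    using that unfolding ins by (auto simp: space_PiM PiE_def extensional_def)
  have [measurable]: "(\<lambda>(x, y). x(N := y)) \<in> measurable (PiM {..<N} (\<lambda>_. M) \<Otimes>\<^sub>M M) (PiM {..<Suc N} (\<lambda>_. M))"
    unfolding ins by (rule measurable_add_dim)
  have [measurable]: "(\<lambda>(x, y). F (x(N := y))) \<in> borel_measurable (PiM {..<N} (\<lambda>_. M) \<Otimes>\<^sub>M M)"
    using measurable_compose[OF \<open>(\<lambda>(x, y). x(N := y)) \<in> _\<close> Suc.prems(1)] by (simp add: split_beta')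
  have Fy[measurable]: "(\<lambda>y. F (x(N := y))) \<in> borel_measurable M" if "x \<in> space (PiM {..<N} (\<lambda>_. M))" for x
    using measurable_compose[OF measurable_Pair1'[OF that] \<open>(\<lambda>(x, y). F (x(N := y))) \<in> _\<close>] by simp
  define G where "G = (\<lambda>x. \<integral>y. F (x(N := y)) \<partial>M)"
  have Gm[measurable]: "G \<in> borel_measurable (PiM {..<N} (\<lambda>_. M))"
    unfolding G_def by measurable
  have Fint: "integrable M (\<lambda>y. F (x(N := y)))" if "x \<in> space (PiM {..<N} (\<lambda>_. M))" for x
    using Suc.prems(2) upd that Fy[OF that] by (intro integrable_const_bound[of _ C]) auto
  have Gb: "\<bar>G x\<bar> \<le> C" if x: "x \<in> space (PiM {..<N} (\<lambda>_. M))" for x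
  proof -
    have "\<bar>G x\<bar> \<le> (\<integral>y. \<bar>F (x(N := y))\<bar> \<partial>M)" unfolding G_def by (rule integral_abs_bound)
    also have "\<dots> \<le> (\<integral>y. C \<partial>M)"
      using Fint[OF x] Suc.prems(2) upd x by (intro integral_mono) auto
    finally show ?thesis by (simp add: prob_space)
  qed
  have IH: "(\<integral>x. exp (s * G x) \<partial>PiM {..<N} (\<lambda>_. M)) \<le> exp (s * (\<integral>x. G x \<partial>PiM {..<N} (\<lambda>_. M)) + real N * (K * s\<^sup>2))"
  proof (rule Suc.IH[OF Gm Gb])
    fix x i u v assume *: "x \<in> space (PiM {..<N} (\<lambda>_. M))" "i < N" "u \<in> space M" "v \<in> space M"
    have sp: "x(i := w) \<in> space (PiM {..<N} (\<lambda>_. M))" if "w \<in> space M" for w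
      using * that by (auto simp: space_PiM PiE_def extensional_def Pi_def)
    have "\<bar>G (x(i := u)) - G (x(i := v))\<bar> = \<bar>\<integral>y. F (x(i := u, N := y)) - F (x(i := v, N := y)) \<partial>M\<bar>"
      unfolding G_def using * sp Fint by simp
    also have "\<dots> \<le> (\<integral>y. \<bar>F (x(i := u, N := y)) - F (x(i := v, N := y))\<bar> \<partial>M)" by (rule integral_abs_bound)
    also have "\<dots> \<le> (\<integral>y. \<beta> u + \<beta> v \<partial>M)"
    proof (rule integral_mono)
      fix y assume y: "y \<in> space M"
      show "\<bar>F (x(i := u, N := y)) - F (x(i := v, N := y))\<bar> \<le> \<beta> u + \<beta> v"
      proof -
        have "i \<noteq> N" using * by simp
        thus ?thesis using Suc.prems(3)[OF upd[OF *(1) y], of i u v] *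
          by (simp only: fun_upd_twist[OF \<open>i \<noteq> N\<close>] less_SucI)
      qed
    qed (use * sp Fint in auto)
    finally show "\<bar>G (x(i := u)) - G (x(i := v))\<bar> \<le> \<beta> u + \<beta> v" by (simp add: prob_space)
  qed
  have expb: "exp (s * z) \<le> exp (s * C)" if "\<bar>z\<bar> \<le> C" for z
    using s that by (auto intro!: mult_left_mono)
  have "(\<integral>x. exp (s * F x) \<partial>PiM {..<Suc N} (\<lambda>_. M)) = 
     (\<integral>x. (\<integral>y. exp (s * F (x(N := y))) \<partial>M) \<partial>PiM {..<N} (\<lambda>_. M))"
    unfolding ins
  proof (rule PP.product_integral_insert)
    show "integrable (PiM (insert N {..<N}) (\<lambda>_. M)) (\<lambda>x. exp (s * F x))"
      using Suc.prems(2) expb unfolding ins[symmetric]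
      by (intro PS.integrable_const_bound[of _ "exp (s * C)"]) auto
  qed auto
  also have "\<dots> \<le> (\<integral>x. exp (K * s\<^sup>2) * exp (s * G x) \<partial>PiM {..<N} (\<lambda>_. M))"
  proof (rule integral_mono)
    show "integrable (PiM {..<N} (\<lambda>_. M)) (\<lambda>x. exp (K * s\<^sup>2) * exp (s * G x))"
      using Gb expb by (intro integrable_mult_right PP.integrable_const_bound[of _ "exp (s * C)"]) auto
    show "integrable (PiM {..<N} (\<lambda>_. M)) (\<lambda>x. \<integral>y. exp (s * F (x(N := y))) \<partial>M)"
    proof (rule PP.integrable_const_bound[of _ "exp (s * C)"])
      have "norm (\<integral>y. exp (s * F (x(N := y))) \<partial>M) \<le> exp (s * C)" if x: "x \<in> space (PiM {..<N} (\<lambda>_. M))" for x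
      proof -
        have "(\<integral>y. exp (s * F (x(N := y))) \<partial>M) \<le> (\<integral>y. exp (s * C) \<partial>M)"
          using Suc.prems(2) upd x expb Fy[OF x]
          by (intro integral_mono integrable_const_bound[of _ "exp (s * C)"] AE_I2) (auto simp del: exp_le_cancel_iff)
        moreover have "(\<integral>y. exp (s * F (x(N := y))) \<partial>M) \<ge> 0" by simp
        ultimately show ?thesis by (simp add: prob_space)
      qed
      thus "AE x in PiM {..<N} (\<lambda>_. M). norm (\<integral>y. exp (s * F (x(N := y))) \<partial>M) \<le> exp (s * C)" by auto
    qed measurable
    fix x assume x: "x \<in> space (PiM {..<N} (\<lambda>_. M))"
    have "(\<integral>y. exp (s * F (x(N := y))) \<partial>M) \<le> exp (s * (\<integral>y. F (x(N := y)) \<partial>M) + K * s\<^sup>2)"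
    proof (rule mgf_bound[where C=C, OF Fy[OF x] _ \<beta> _ B K s])
      fix u v assume uv: "u \<in> space M" "v \<in> space M"
      show "\<bar>F (x(N := u)) - F (x(N := v))\<bar> \<le> \<beta> u + \<beta> v"
        using Suc.prems(3)[OF upd[OF x uv(1)], of N u v] uv by (simp only: fun_upd_upd lessI)
    qed (use Suc.prems(2) upd x in auto)
    thus "(\<integral>y. exp (s * F (x(N := y))) \<partial>M) \<le> exp (K * s\<^sup>2) * exp (s * G x)"
      by (simp add: G_def exp_add mult.commute)
  qed
  also have "\<dots> = exp (K * s\<^sup>2) * (\<integral>x. exp (s * G x) \<partial>PiM {..<N} (\<lambda>_. M))" by simp
  also have "\<dots> \<le> exp (K * s\<^sup>2) * exp (s * (\<integral>x. G x \<partial>PiM {..<N} (\<lambda>_. M)) + real N * (K * s\<^sup>2))"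
    by (intro mult_left_mono IH) auto
  also have "(\<integral>x. G x \<partial>PiM {..<N} (\<lambda>_. M)) = (\<integral>x. F x \<partial>PiM {..<Suc N} (\<lambda>_. M))"
    unfolding ins G_def
    by (rule PP.product_integral_insert[symmetric])
       (use Suc.prems(2) in \<open>auto simp flip: ins intro!: PS.integrable_const_bound[of _ C]\<close>)
  finally show ?case by (simp add: exp_add[symmetric] algebra_simps)
qed

lemma (in prob_space) product_variance:
  fixes g :: "'a \<Rightarrow> real"
  assumes [measurable]: "g \<in> borel_measurable M" and bdd: "\<And>x. x \<in> space M \<Longrightarrow> \<bar>g x\<bar> \<le> C"
    and 0: "(\<integral>x. g x \<partial>M) = 0"
  shows "(\<integral>x. (\<Sum>i<N. g (x i))\<^sup>2 \<partial>PiM {..<N} (\<lambda>_. M)) = real N * (\<integral>x. (g x)\<^sup>2 \<partial>M)"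
proof (induction N)
  case 0
  show ?case by simp
next
  case (Suc N)
  interpret PP: product_prob_space "\<lambda>_. M" "{..<N}" ..
  interpret PS: product_prob_space "\<lambda>_. M" "{..<Suc N}" ..
  have ins: "{..<Suc N} = insert N {..<N}" by auto
  have sumb: "\<bar>\<Sum>i<n. g (x i)\<bar> \<le> real n * C" if "\<And>i. i < n \<Longrightarrow> x i \<in> space M" for x n
  proof -
    have "\<bar>\<Sum>i<n. g (x i)\<bar> \<le> (\<Sum>i<n. \<bar>g (x i)\<bar>)" by (rule sum_abs)
    also have "\<dots> \<le> (\<Sum>i<n. C)" using that bdd by (intro sum_mono) auto
    finally show ?thesis by simp
  qed
  have sumb2: "(\<Sum>i<n. g (x i))\<^sup>2 \<le> (real n * C)\<^sup>2" if "\<And>i. i < n \<Longrightarrow> x i \<in> space M" for x n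
    by (rule abs_le_imp_power2_le[OF sumb[OF that]])
  have g2: "integrable M (\<lambda>x. (g x)\<^sup>2)"
  proof (rule integrable_const_bound[of _ "C\<^sup>2"])
    have "(g x)\<^sup>2 \<le> C\<^sup>2" if "x \<in> space M" for x
      by (rule abs_le_imp_power2_le[OF bdd[OF that]])
    thus "AE x in M. norm ((g x)\<^sup>2) \<le> C\<^sup>2" by auto
  qed measurable
  have g1: "integrable M g" by (rule integrable_const_bound[of _ C]) (use bdd in auto)
  have "(\<integral>x. (\<Sum>i<Suc N. g (x i))\<^sup>2 \<partial>PiM {..<Suc N} (\<lambda>_. M)) =
    (\<integral>x. (\<integral>y. (\<Sum>i<Suc N. g ((x(N := y)) i))\<^sup>2 \<partial>M) \<partial>PiM {..<N} (\<lambda>_. M))"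
    unfolding ins
  proof (rule PP.product_integral_insert)
    show "integrable (PiM (insert N {..<N}) (\<lambda>_. M)) (\<lambda>x. (\<Sum>i\<in>insert N {..<N}. g (x i))\<^sup>2)"
      unfolding ins[symmetric]
    proof (rule PS.integrable_const_bound[of _ "(real (Suc N) * C)\<^sup>2"])
      show "AE x in PiM {..<Suc N} (\<lambda>_. M). norm ((\<Sum>i<Suc N. g (x i))\<^sup>2) \<le> (real (Suc N) * C)\<^sup>2"
        using sumb2[of "Suc N"] by (intro AE_I2) (auto simp: space_PiM simp del: sum.lessThan_Suc of_nat_Suc)
      show "(\<lambda>x. (\<Sum>i<Suc N. g (x i))\<^sup>2) \<in> borel_measurable (PiM {..<Suc N} (\<lambda>_. M))"
        by (intro borel_measurable_power borel_measurable_sum) measurable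
    qed
  qed auto
  also have "\<dots> = (\<integral>x. (\<Sum>i<N. g (x i))\<^sup>2 + (\<integral>y. (g y)\<^sup>2 \<partial>M) \<partial>PiM {..<N} (\<lambda>_. M))"
  proof (rule Bochner_Integration.integral_cong[OF refl])
    fix x
    have "(\<lambda>y. (\<Sum>i<Suc N. g ((x(N := y)) i))\<^sup>2) = (\<lambda>y. (\<Sum>i<N. g (x i))\<^sup>2 + 2 * (\<Sum>i<N. g (x i)) * g y + (g y)\<^sup>2)"
      by (auto simp: fun_eq_iff power2_sum)
    thus "(\<integral>y. (\<Sum>i<Suc N. g ((x(N := y)) i))\<^sup>2 \<partial>M) = (\<Sum>i<N. g (x i))\<^sup>2 + (\<integral>y. (g y)\<^sup>2 \<partial>M)"
      using g1 g2 by (simp add: 0 prob_space)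
  qed
  also have "\<dots> = real (Suc N) * (\<integral>y. (g y)\<^sup>2 \<partial>M)"
  proof -
    have "integrable (PiM {..<N} (\<lambda>_. M)) (\<lambda>x. (\<Sum>i<N. g (x i))\<^sup>2)"
    proof (rule PP.integrable_const_bound[of _ "(real N * C)\<^sup>2"])
      show "AE x in PiM {..<N} (\<lambda>_. M). norm ((\<Sum>i<N. g (x i))\<^sup>2) \<le> (real N * C)\<^sup>2"
        using sumb2[of N] by (intro AE_I2) (auto simp: space_PiM)
    qed measurable
    thus ?thesis using Suc by (simp add: PP.P.prob_space algebra_simps)
  qed
  finally show ?case .
qed

text \<open>The square of the mean absolute value is at most the mean square, which is a variance.
  It is bounded by the raw second moment because that quantity, summed over lattice sites, becomes
  an energy.\<close>

lemma (in prob_space) product_mean_deviation: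
  fixes \<phi> :: "'a \<Rightarrow> real"
  assumes [measurable]: "\<phi> \<in> borel_measurable M" and bdd: "\<And>x. x \<in> space M \<Longrightarrow> \<bar>\<phi> x\<bar> \<le> C" and N: "N > 0"
  shows "(\<integral>x. \<bar>(\<Sum>i<N. \<phi> (x i)) / real N - (\<integral>x. \<phi> x \<partial>M)\<bar> \<partial>PiM {..<N} (\<lambda>_. M)) 
     \<le> sqrt ((\<integral>x. (\<phi> x)\<^sup>2 \<partial>M) / real N)"
proof -
  interpret PP: product_prob_space "\<lambda>_. M" "{..<N}" ..
  define m where "m = (\<integral>x. \<phi> x \<partial>M)"
  define g where "g = (\<lambda>x. \<phi> x - m)"
  have [measurable]: "g \<in> borel_measurable M" unfolding g_def by measurable
  have gb: "\<bar>g x\<bar> \<le> C + \<bar>m\<bar>" if "x \<in> space M" for x using bdd[OF that] by (auto simp: g_def)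
  have int: "integrable M \<phi>" by (rule integrable_const_bound[of _ C]) (use bdd in auto)
  have int2: "integrable M (\<lambda>x. (\<phi> x)\<^sup>2)"
  proof (rule integrable_const_bound[of _ "C\<^sup>2"])
    have "(\<phi> x)\<^sup>2 \<le> C\<^sup>2" if "x \<in> space M" for x
      by (rule abs_le_imp_power2_le[OF bdd[OF that]])
    thus "AE x in M. norm ((\<phi> x)\<^sup>2) \<le> C\<^sup>2" by auto
  qed measurable
  have g0: "(\<integral>x. g x \<partial>M) = 0" using int by (simp add: g_def m_def prob_space)
  have g2: "(\<integral>x. (g x)\<^sup>2 \<partial>M) \<le> (\<integral>x. (\<phi> x)\<^sup>2 \<partial>M)"
    using variance_eq[OF int int2] by (simp add: g_def m_def)
  define W where "W = (\<lambda>x. (\<Sum>i<N. \<phi> (x i)) / real N - m)"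
  have W: "W x = (\<Sum>i<N. g (x i)) / real N" for x
    using N by (simp add: W_def g_def sum_subtractf diff_divide_distrib)
  have Wm[measurable]: "W \<in> borel_measurable (PiM {..<N} (\<lambda>_. M))" unfolding W_def by measurable
  have Wb: "\<bar>W x\<bar> \<le> C + \<bar>m\<bar>" if "x \<in> space (PiM {..<N} (\<lambda>_. M))" for x
  proof -
    have "\<bar>\<Sum>i<N. g (x i)\<bar> \<le> (\<Sum>i<N. \<bar>g (x i)\<bar>)" by (rule sum_abs)
    also have "\<dots> \<le> (\<Sum>i<N. C + \<bar>m\<bar>)" using that gb by (intro sum_mono) (auto simp: space_PiM)
    finally show ?thesis using N by (simp add: W divide_simps mult.commute)
  qed
  have Wi: "integrable (PiM {..<N} (\<lambda>_. M)) (\<lambda>x. \<bar>W x\<bar>)"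
    using Wb by (intro PP.integrable_const_bound[of _ "C + \<bar>m\<bar>"]) auto
  have Wi2: "integrable (PiM {..<N} (\<lambda>_. M)) (\<lambda>x. \<bar>W x\<bar>\<^sup>2)"
  proof (rule PP.integrable_const_bound[of _ "(C + \<bar>m\<bar>)\<^sup>2"])
    have "(W x)\<^sup>2 \<le> (C + \<bar>m\<bar>)\<^sup>2" if "x \<in> space (PiM {..<N} (\<lambda>_. M))" for x
      by (rule abs_le_imp_power2_le[OF Wb[OF that]])
    thus "AE x in PiM {..<N} (\<lambda>_. M). norm (\<bar>W x\<bar>\<^sup>2) \<le> (C + \<bar>m\<bar>)\<^sup>2" by auto
  qed measurable
  have "(\<integral>x. \<bar>W x\<bar> \<partial>PiM {..<N} (\<lambda>_. M))\<^sup>2 \<le> (\<integral>x. \<bar>W x\<bar>\<^sup>2 \<partial>PiM {..<N} (\<lambda>_. M))"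
    using PP.variance_eq[OF Wi Wi2] PP.variance_positive[of "\<lambda>x. \<bar>W x\<bar>"] by simp
  also have "\<dots> = (\<integral>x. (\<Sum>i<N. g (x i))\<^sup>2 \<partial>PiM {..<N} (\<lambda>_. M)) / (real N)\<^sup>2"
    by (simp add: W power_divide)
  also have "\<dots> = (\<integral>x. (g x)\<^sup>2 \<partial>M) / real N"
    using N by (subst product_variance[OF _ gb g0]) (auto simp: power2_eq_square)
  also have "\<dots> \<le> (\<integral>x. (\<phi> x)\<^sup>2 \<partial>M) / real N" using g2 N by (intro divide_right_mono) auto
  finally have "(\<integral>x. \<bar>W x\<bar> \<partial>PiM {..<N} (\<lambda>_. M)) \<le> sqrt ((\<integral>x. (\<phi> x)\<^sup>2 \<partial>M) / real N)"
    by (rule real_le_rsqrt)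
  thus ?thesis by (simp add: W_def m_def)
qed

section \<open>The diagonal random walk on the integer lattice\<close>

definition finsupp :: "('a \<Rightarrow> real) \<Rightarrow> bool" where
  "finsupp f \<longleftrightarrow> finite {x. f x \<noteq> 0}"

text \<open>Summing over the whole lattice makes translation invariance a mere reindexing; finite
  support of one argument settles convergence.\<close>

definition ip :: "('a \<Rightarrow> real) \<Rightarrow> ('a \<Rightarrow> real) \<Rightarrow> real" where
  "ip u f = (\<Sum>\<^sub>\<infinity>x. u x * f x)"

lemma finsupp_summable: "finsupp f \<Longrightarrow> f summable_on UNIV"
  unfolding finsupp_def
  by (subst summable_on_cong_neutral[where T="{x. f x \<noteq> 0}" and g=f]) auto

lemma finsupp_mult1: "finsupp f \<Longrightarrow> finsupp (\<lambda>x. f x * g x)"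
  unfolding finsupp_def by (rule finite_subset[where B="{x. f x \<noteq> 0}"]) auto

lemma finsupp_mult2: "finsupp g \<Longrightarrow> finsupp (\<lambda>x. f x * g x)"
  unfolding finsupp_def by (rule finite_subset[where B="{x. g x \<noteq> 0}"]) auto

lemma finsupp_add: "finsupp f \<Longrightarrow> finsupp g \<Longrightarrow> finsupp (\<lambda>x. f x + g x)"
  unfolding finsupp_def by (rule finite_subset[where B="{x. f x \<noteq> 0} \<union> {x. g x \<noteq> 0}"]) auto

lemma finsupp_diff: "finsupp f \<Longrightarrow> finsupp g \<Longrightarrow> finsupp (\<lambda>x. f x - g x)"
  unfolding finsupp_def by (rule finite_subset[where B="{x. f x \<noteq> 0} \<union> {x. g x \<noteq> 0}"]) auto

lemma finsupp_zero: "finsupp (\<lambda>x. 0)"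
  by (simp add: finsupp_def)

lemma finsupp_sum: "(\<And>i. i \<in> I \<Longrightarrow> finsupp (f i)) \<Longrightarrow> finsupp (\<lambda>x. \<Sum>i\<in>I. f i x)"
  by (induction I rule: infinite_finite_induct) (auto intro!: finsupp_add finsupp_zero)

lemma finsupp_shift:
  fixes f :: "'a::group_add \<Rightarrow> real"
  assumes "finsupp f" shows "finsupp (\<lambda>x. f (x + e))"
proof -
  have "{x. f (x + e) \<noteq> 0} \<subseteq> (\<lambda>y. y - e) ` {x. f x \<noteq> 0}"
    by (auto intro!: image_eqI[where x="_ + e"])
  thus ?thesis using assms unfolding finsupp_def by (meson finite_surj)
qed

lemma finsupp_divide: "finsupp f \<Longrightarrow> finsupp (\<lambda>x. f x / c)"
  unfolding finsupp_def by (rule finite_subset[where B="{x. f x \<noteq> 0}"]) auto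

lemma ip_commute: "ip u f = ip f u"
  by (simp add: ip_def mult.commute)

lemma ip_add_right: "finsupp f \<Longrightarrow> finsupp g \<Longrightarrow> ip u (\<lambda>x. f x + g x) = ip u f + ip u g"
  unfolding ip_def distrib_left
  by (intro infsum_add finsupp_summable finsupp_mult2)

lemma ip_diff_right: "finsupp f \<Longrightarrow> finsupp g \<Longrightarrow> ip u (\<lambda>x. f x - g x) = ip u f - ip u g"
  using ip_add_right[of "\<lambda>x. f x - g x" g u] finsupp_diff[of f g] by simp

lemma ip_diff_left: "finsupp f \<Longrightarrow> finsupp g \<Longrightarrow> ip (\<lambda>x. f x - g x) u = ip f u - ip g u"
  using ip_diff_right[of f g u] by (simp add: ip_commute)

lemma ip_zero_right: "ip u (\<lambda>_. 0) = 0"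
  by (simp add: ip_def)

lemma ip_sum_right: "finite I \<Longrightarrow> (\<And>i. i \<in> I \<Longrightarrow> finsupp (f i)) \<Longrightarrow>
   ip u (\<lambda>x. \<Sum>i\<in>I. f i x) = (\<Sum>i\<in>I. ip u (f i))"
  by (induction I rule: finite_induct) (auto simp: ip_add_right finsupp_sum ip_zero_right)

lemma ip_divide_right: "ip u (\<lambda>x. f x / c) = ip u f / c"
  using infsum_cmult_right'[of "1 / c" "\<lambda>x. u x * f x" UNIV] by (simp add: ip_def)

lemma ip_shift:
  fixes u :: "'a::ab_group_add \<Rightarrow> real"
  shows "ip (\<lambda>x. u (x + e)) f = ip u (\<lambda>x. f (x - e))"
proof -
  have "bij_betw (\<lambda>x. x - e) UNIV UNIV"
    by (rule bij_betw_byWitness[where f'="\<lambda>x. x + e"]) auto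
  from infsum_reindex_bij_betw[OF this, of "\<lambda>x. u (x + e) * f x"]
  show ?thesis by (simp add: ip_def)
qed

lemma ip_finite:
  assumes "finite B" "\<And>x. x \<notin> B \<Longrightarrow> u x * f x = 0"
  shows "ip u f = (\<Sum>x\<in>B. u x * f x)"
proof -
  have "ip u f = infsum (\<lambda>x. u x * f x) B"
    unfolding ip_def by (rule infsum_cong_neutral) (use assms in auto)
  thus ?thesis using assms(1) by simp
qed

lemma sum_le_ip:
  assumes "finite B" "finsupp f"
  shows "(\<Sum>x\<in>B. (f x)\<^sup>2) \<le> ip f f"
  unfolding ip_def power2_eq_square
  by (intro finite_sum_le_infsum finsupp_summable finsupp_mult1 assms) auto

definition kdelta :: "'a \<Rightarrow> 'a \<Rightarrow> real" where
  "kdelta s x = of_bool (x = s)"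

lemma finsupp_kdelta [simp]: "finsupp (kdelta s)"
  by (simp add: finsupp_def kdelta_def)

lemma ip_kdelta: "ip (kdelta s) f = f s"
  by (subst ip_finite[where B="{s}"]) (auto simp: kdelta_def)

lemma ip_nonneg: "(\<And>x. u x \<ge> 0) \<Longrightarrow> (\<And>x. f x \<ge> 0) \<Longrightarrow> ip u f \<ge> 0"
  unfolding ip_def by (intro infsum_nonneg) auto

text \<open>All coordinates move at once. The law of the walk is therefore a product of
  one-dimensional laws, and return probabilities are powers of central binomial ones.\<close>

definition steps :: "(int ^ 'm) set" where
  "steps = {e. \<forall>i. e $ i \<in> {-1, 1}}"

definition avg :: "(int ^ 'm \<Rightarrow> real) \<Rightarrow> int ^ 'm \<Rightarrow> real" where
  "avg f x = (\<Sum>e\<in>steps. f (x + e)) / 2 ^ CARD('m)"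

definition grad :: "'a::plus \<Rightarrow> ('a \<Rightarrow> real) \<Rightarrow> 'a \<Rightarrow> real" where
  "grad e f x = f x - f (x + e)"

lemma sum_prod_steps:
  fixes g :: "'m::finite \<Rightarrow> int \<Rightarrow> real"
  shows "(\<Sum>e\<in>steps. \<Prod>i\<in>UNIV. g i (e $ i)) = (\<Prod>i\<in>UNIV. g i (-1) + g i 1)"
proof -
  have bij: "bij_betw vec_lambda (PiE (UNIV :: 'm set) (\<lambda>_. {-1, 1::int})) steps"
    by (rule bij_betw_byWitness[where f'=vec_nth]) (auto simp: steps_def PiE_def Pi_def)
  have "(\<Prod>i\<in>UNIV. g i (-1) + g i 1) = (\<Prod>i\<in>(UNIV::'m set). \<Sum>k\<in>{-1,1}. g i k)"
    by simp
  also have "\<dots> = (\<Sum>f\<in>PiE (UNIV :: 'm set) (\<lambda>_. {-1, 1::int}). \<Prod>i\<in>UNIV. g i (f i))"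
    by (rule prod_sum_PiE) auto
  also have "\<dots> = (\<Sum>e\<in>steps. \<Prod>i\<in>UNIV. g i (e $ i))"
    using sum.reindex_bij_betw[OF bij, of "\<lambda>e. \<Prod>i\<in>UNIV. g i (e $ i)"] by simp
  finally show ?thesis by simp
qed

lemma finite_steps [simp]: "finite (steps :: (int ^ 'm) set)"
proof -
  have "steps \<subseteq> vec_lambda ` (PiE (UNIV :: 'm set) (\<lambda>_. {-1, 1::int}))"
    by (auto simp: steps_def intro!: image_eqI[where x="vec_nth _"])
  thus ?thesis by (rule finite_subset) (auto intro!: finite_PiE)
qed

lemma card_steps: "card (steps :: (int ^ 'm) set) = 2 ^ CARD('m)"
proof -
  have "real (card (steps :: (int ^ 'm) set)) = 2 ^ CARD('m)"
    using sum_prod_steps[of "\<lambda>(_::'m) _. 1"] by simp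
  thus ?thesis by (metis of_nat_eq_iff of_nat_numeral of_nat_power)
qed

lemma sum_steps_uminus:
  fixes g :: "int ^ 'm \<Rightarrow> real"
  shows "(\<Sum>e\<in>steps. g (- e)) = (\<Sum>e\<in>steps. g e)"
proof -
  have "bij_betw uminus (steps :: (int ^ 'm) set) steps"
    by (rule bij_betw_byWitness[where f'=uminus])
       (auto simp: steps_def) 
  from sum.reindex_bij_betw[OF this, of g] show ?thesis .
qed

lemma finsupp_avg [simp]: "finsupp f \<Longrightarrow> finsupp (avg f)"
  unfolding avg_def by (intro finsupp_divide finsupp_sum finsupp_shift)

lemma finsupp_avg_pow [simp]: "finsupp f \<Longrightarrow> finsupp ((avg ^^ t) f)"
  by (induction t) auto

lemma finsupp_grad [simp]: "finsupp f \<Longrightarrow> finsupp (grad (e::'a::group_add) f)"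
  unfolding grad_def by (intro finsupp_diff finsupp_shift)

lemma ip_avg:
  fixes u :: "int ^ 'm \<Rightarrow> real"
  assumes "finsupp u" "finsupp f"
  shows "ip u (avg f) = (\<Sum>e\<in>steps. ip u (\<lambda>x. f (x + e))) / 2 ^ CARD('m)"
  unfolding avg_def
  by (subst ip_divide_right, subst ip_sum_right) (auto intro!: finsupp_shift assms)

lemma ip_avg_sym:
  fixes u :: "int ^ 'm \<Rightarrow> real"
  assumes "finsupp u" "finsupp f"
  shows "ip (avg u) f = ip u (avg f)"
proof -
  have "ip (avg u) f = ip f (avg u)" by (rule ip_commute)
  also have "\<dots> = (\<Sum>e\<in>steps. ip f (\<lambda>x. u (x + e))) / 2 ^ CARD('m)"
    by (rule ip_avg[OF assms(2,1)])
  also have "(\<Sum>e\<in>steps. ip f (\<lambda>x. u (x + e))) = (\<Sum>e\<in>steps. ip u (\<lambda>x. f (x - e)))"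
    by (simp add: ip_commute[of f] ip_shift)
  also have "\<dots> = (\<Sum>e\<in>steps. ip u (\<lambda>x. f (x + e)))"
    using sum_steps_uminus[of "\<lambda>e. ip u (\<lambda>x. f (x - e))"] by simp
  finally show ?thesis by (simp add: ip_avg[OF assms])
qed

lemma ip_avg_pow_sym:
  assumes "finsupp u" "finsupp f"
  shows "ip ((avg ^^ t) u) f = ip u ((avg ^^ t) f)"
proof -
  from assms(1) show ?thesis
  proof (induction t arbitrary: u)
    case (Suc t)
    have "ip ((avg ^^ Suc t) u) f = ip ((avg ^^ t) (avg u)) f" by (simp add: funpow_swap1)
    also have "\<dots> = ip (avg u) ((avg ^^ t) f)" using Suc by simp
    also have "\<dots> = ip u (avg ((avg ^^ t) f))" using Suc.prems assms(2) by (intro ip_avg_sym) auto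
    finally show ?case by simp
  qed simp
qed

text \<open>Summation by parts for the Dirichlet form. Each step \<open>e\<close> yields two
  diagonal terms and the shifts by \<open>e\<close> and \<open>- e\<close>; as the steps are
  symmetric, this gives twice the number of steps times \<open>I - avg\<close>.\<close>

lemma ip_grad:
  fixes u :: "int ^ 'm \<Rightarrow> real"
  assumes u: "finsupp u" and f: "finsupp f"
  shows "(\<Sum>e\<in>steps. ip (grad e u) (grad e f)) = 2 * 2 ^ CARD('m) * ip u (\<lambda>x. f x - avg f x)"
proof -
  have "ip (grad e u) (grad e f) = 2 * ip u f - ip u (\<lambda>x. f (x + e)) - ip u (\<lambda>x. f (x + (- e)))" for e
  proof -
    have "ip (grad e u) (grad e f) = ip u f - ip u (\<lambda>x. f (x + e))
        - (ip (\<lambda>x. u (x + e)) f - ip (\<lambda>x. u (x + e)) (\<lambda>x. f (x + e)))"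
      unfolding grad_def by (simp add: ip_diff_left ip_diff_right finsupp_shift finsupp_diff u f)
    moreover have "ip (\<lambda>x. u (x + e)) f = ip u (\<lambda>x. f (x + (- e)))"
      by (simp add: ip_shift)
    moreover have "ip (\<lambda>x. u (x + e)) (\<lambda>x. f (x + e)) = ip u f"
      by (simp add: ip_shift)
    ultimately show ?thesis by simp
  qed
  hence "(\<Sum>e\<in>steps. ip (grad e u) (grad e f)) = 
     (\<Sum>e\<in>(steps :: (int ^ 'm) set). 2 * ip u f) - (\<Sum>e\<in>steps. ip u (\<lambda>x. f (x + e))) -
     (\<Sum>e\<in>steps. ip u (\<lambda>x. f (x + (- e))))"
    by (simp add: sum_subtractf)
  also have "(\<Sum>e\<in>steps. ip u (\<lambda>x. f (x + (- e)))) = (\<Sum>e\<in>steps. ip u (\<lambda>x. f (x + e)))"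
    by (rule sum_steps_uminus)
  also have "(\<Sum>e\<in>steps. ip u (\<lambda>x. f (x + e))) = 2 ^ CARD('m) * ip u (avg f)"
    by (simp add: ip_avg u f)
  finally show ?thesis
    by (simp add: ip_diff_right u f card_steps algebra_simps)
qed

definition green :: "nat \<Rightarrow> int ^ 'm \<Rightarrow> int ^ 'm \<Rightarrow> real" where
  "green T s x = (\<Sum>t<T. (avg ^^ t) (kdelta s) x)"

lemma finsupp_green [simp]: "finsupp (green T s)"
  unfolding green_def by (intro finsupp_sum) simp

lemma avg_sum: "avg (\<lambda>x. \<Sum>t\<in>I. f t x) = (\<lambda>x. \<Sum>t\<in>I. avg (f t) x)"
  by (auto simp: avg_def fun_eq_iff sum_divide_distrib[symmetric] intro: sum.swap)

text \<open>\<open>I - avg\<close> applied to a truncated Neumann series telescopes. Truncation is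
  essential, since the walk is recurrent in dimensions one and two and the full series diverges at
  \<open>s\<close>.\<close>

lemma green_avg: "green T s x - avg (green T s) x = kdelta s x - (avg ^^ T) (kdelta s) x"
proof -
  have "avg (green T s) x = (\<Sum>t<T. (avg ^^ Suc t) (kdelta s) x)"
    unfolding green_def by (simp add: avg_sum)
  hence "green T s x - avg (green T s) x = (\<Sum>t<T. (avg ^^ t) (kdelta s) x - (avg ^^ Suc t) (kdelta s) x)"
    unfolding green_def by (simp add: sum_subtractf)
  also have "\<dots> = kdelta s x - (avg ^^ T) (kdelta s) x"
    by (subst sum_lessThan_telescope') simp
  finally show ?thesis .
qed

lemma green_representation:
  fixes f :: "int ^ 'm \<Rightarrow> real"
  assumes f: "finsupp f"
  shows "f s = (\<Sum>e\<in>steps. ip (grad e (green T s)) (grad e f)) / (2 * 2 ^ CARD('m)) 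
    + ip ((avg ^^ T) (kdelta s)) f"
proof -
  have "(\<Sum>e\<in>steps. ip (grad e (green T s)) (grad e f)) / (2 * 2 ^ CARD('m))
      = (\<Sum>e\<in>steps. ip (grad e f) (grad e (green T s))) / (2 * 2 ^ CARD('m))"
    by (simp add: ip_commute)
  also have "\<dots> = ip f (\<lambda>x. green T s x - avg (green T s) x)"
    by (subst ip_grad) (auto simp: f)
  also have "\<dots> = f s - ip ((avg ^^ T) (kdelta s)) f"
    by (simp add: green_avg ip_diff_right) (simp add: ip_commute[of f] ip_kdelta)
  finally show ?thesis by simp
qed

lemma avg_pow_nonneg: "(\<And>x. f x \<ge> 0) \<Longrightarrow> (avg ^^ t) f x \<ge> 0"
  by (induction t arbitrary: x) (auto simp: avg_def intro!: sum_nonneg divide_nonneg_pos)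

text \<open>By summation by parts the energy is the pairing of the Green function with
  \<open>kdelta s - p_T s\<close>, and the part subtracted is nonnegative. No derivative of the
  kernel has to be estimated.\<close>

lemma green_energy:
  fixes s :: "int ^ 'm"
  shows "(\<Sum>e\<in>steps. ip (grad e (green T s)) (grad e (green T s))) 
     \<le> 2 * 2 ^ CARD('m) * green T s s"
proof -
  have "(\<Sum>e\<in>steps. ip (grad e (green T s)) (grad e (green T s)))
      = 2 * 2 ^ CARD('m) * ip (green T s) (\<lambda>x. kdelta s x - (avg ^^ T) (kdelta s) x)"
    by (subst ip_grad) (auto simp: green_avg)
  also have "ip (green T s) (\<lambda>x. kdelta s x - (avg ^^ T) (kdelta s) x) 
      = green T s s - ip (green T s) ((avg ^^ T) (kdelta s))"
    by (simp add: ip_diff_right) (simp add: ip_commute[of _ "kdelta s"] ip_kdelta)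
  also have "\<dots> \<le> green T s s"
  proof -
    have "ip (green T s) ((avg ^^ T) (kdelta s)) \<ge> 0"
      by (intro ip_nonneg avg_pow_nonneg)
         (auto simp: green_def kdelta_def intro!: sum_nonneg avg_pow_nonneg)
    thus ?thesis by simp
  qed
  finally show ?thesis by simp
qed

text \<open>Chapman-Kolmogorov for a symmetric kernel.\<close>

lemma avg_pow_energy:
  "ip ((avg ^^ T) (kdelta s)) ((avg ^^ T) (kdelta s)) = (avg ^^ (2 * T)) (kdelta s) s"
  by (simp add: ip_avg_pow_sym ip_kdelta funpow_add[symmetric] mult_2)
     (metis funpow_add comp_apply)

section \<open>Return probabilities of the simple random walk on the integers\<close>

fun bwalk :: "nat \<Rightarrow> int \<Rightarrow> real" where
  "bwalk 0 k = of_bool (k = 0)"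
| "bwalk (Suc t) k = (bwalk t (k - 1) + bwalk t (k + 1)) / 2"

lemma avg_pow_kdelta:
  fixes s x :: "int ^ 'm"
  shows "(avg ^^ t) (kdelta s) x = (\<Prod>i\<in>UNIV. bwalk t (x $ i - s $ i))"
proof (induction t arbitrary: x)
  case 0
  show ?case by (auto simp: kdelta_def vec_eq_iff)
next
  case (Suc t)
  have "(avg ^^ Suc t) (kdelta s) x = (\<Sum>e\<in>steps. \<Prod>i\<in>UNIV. bwalk t (x $ i + e $ i - s $ i)) / 2 ^ CARD('m)"
    by (simp add: avg_def[of "(avg ^^ t) (kdelta s)"] Suc)
  also have "(\<Sum>e\<in>steps. \<Prod>i\<in>UNIV. bwalk t (x $ i + e $ i - s $ i)) = 
     (\<Prod>i\<in>UNIV. bwalk t (x $ i + -1 - s $ i) + bwalk t (x $ i + 1 - s $ i))"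
    by (rule sum_prod_steps)
  also have "\<dots> / 2 ^ CARD('m) = (\<Prod>i\<in>UNIV. bwalk (Suc t) (x $ i - s $ i))"
    by (simp add: prod_dividef algebra_simps)
  finally show ?case .
qed

lemma bwalk_outside: "\<bar>k\<bar> > int t \<Longrightarrow> bwalk t k = 0"
  by (induction t arbitrary: k) auto

lemma bwalk_odd: "odd (k + int t) \<Longrightarrow> bwalk t k = 0"
  by (induction t arbitrary: k) auto

text \<open>Here \<open>j\<close> counts the upward steps; the induction is Pascal's rule.\<close>

lemma bwalk_choose: "bwalk t (2 * int j - int t) = (t choose j) / 2 ^ t"
proof (induction t arbitrary: j)
  case 0 show ?case by (cases j) auto
next
  case (Suc t)
  have 2: "bwalk t (2 * int j - int (Suc t) + 1) = (t choose j) / 2 ^ t"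
    using Suc[of j] by (simp add: algebra_simps)
  show ?case
  proof (cases j)
    case 0
    have "bwalk t (2 * int j - int (Suc t) - 1) = 0"
      using 0 by (intro bwalk_outside) auto
    thus ?thesis using 0 2 by simp
  next
    case (Suc i)
    have "bwalk t (2 * int j - int (Suc t) - 1) = (t choose i) / 2 ^ t"
      using Suc.IH[of i] Suc by (simp add: algebra_simps)
    thus ?thesis using 2 Suc by (simp add: field_simps)
  qed
qed

lemma bwalk_even_Suc: "bwalk (2 * Suc n) 0 = bwalk (2 * n) 0 * ((2 * n + 1) / (2 * n + 2))"
proof -
  have 1: "bwalk (2 * n) 0 = ((2 * n) choose n) / 2 ^ (2 * n)" for n
    using bwalk_choose[of "2 * n" n] by simp
  have 2: "real ((2 * k) choose k) = fact (2 * k) / (fact k * fact k)" for k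
    by (simp add: binomial_fact)
  \<comment> \<open>The letters \<open>a\<close>, \<open>b\<close>, \<open>p\<close> stand for
    \<open>fact (2 * n)\<close>, \<open>fact n\<close> and \<open>2 ^ (2 * n)\<close>; the identity
    is the quotient of consecutive central binomial coefficients divided by 4.\<close>
  have 3: "a * (2 * k + 1) * (2 * k + 2) / ((k + 1) * b) / ((k + 1) * b) / (4 * p) 
     = a / (b * b) / p * ((2 * k + 1) / (2 * k + 2))" if "k \<ge> 0" "b > 0" "p > 0" for a b k p :: real
    using that by (simp add: divide_simps) (simp add: algebra_simps)
  show ?thesis unfolding 1 2
    using 3[of "real n" "fact n" "2 ^ (2 * n)" "fact (2 * n)"] by (simp add: algebra_simps)
qed

text \<open>The bound reproduces itself because \<open>(2 * n + 1) * (2 * n + 3)\<close> is at most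
  \<open>(2 * n + 2)^2\<close>; this replaces Stirling's formula.\<close>

lemma bwalk_sq_le: "(bwalk (2 * n) 0)\<^sup>2 \<le> 1 / (2 * n + 1)"
proof (induction n)
  case 0 show ?case by simp
next
  case (Suc n)
  have "(bwalk (2 * Suc n) 0)\<^sup>2 = (bwalk (2 * n) 0)\<^sup>2 * ((2 * n + 1) / (2 * n + 2))\<^sup>2"
    by (simp add: bwalk_even_Suc power_mult_distrib power_divide add.commute del: mult_Suc_right)
  also have "\<dots> \<le> 1 / (2 * n + 1) * ((2 * n + 1) / (2 * n + 2))\<^sup>2"
    using Suc by (intro mult_right_mono) (auto simp: add.commute)
  also have "\<dots> \<le> 1 / (2 * Suc n + 1)"
    by (simp add: divide_simps power2_eq_square) (simp add: algebra_simps)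
  finally show ?case by simp
qed

section \<open>Lipschitz functions on the lattice\<close>

text \<open>In this norm the diagonal steps have length at most one, so a function with Lipschitz
  constant 1 has all its \<open>grad e\<close> bounded by 1.\<close>

definition supnorm :: "int ^ 'm \<Rightarrow> real" where
  "supnorm z = Max (range (\<lambda>i. \<bar>real_of_int (z $ i)\<bar>))"

lemma supnorm_le_iff: "supnorm z \<le> b \<longleftrightarrow> (\<forall>i. \<bar>real_of_int (z $ i)\<bar> \<le> b)"
  unfolding supnorm_def by (subst Max_le_iff) auto

lemma component_le_supnorm: "\<bar>real_of_int (z $ i)\<bar> \<le> supnorm z"
  using supnorm_le_iff[of z "supnorm z"] by simp

lemma supnorm_ge_0 [simp]: "supnorm z \<ge> 0"
  using component_le_supnorm[of z undefined] by (smt (verit))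

lemma supnorm_0 [simp]: "supnorm 0 = 0"
  by (intro antisym supnorm_ge_0) (simp add: supnorm_le_iff)

lemma supnorm_triangle: "supnorm (x + y) \<le> supnorm x + supnorm y"
  unfolding supnorm_le_iff
proof
  fix i show "\<bar>real_of_int ((x + y) $ i)\<bar> \<le> supnorm x + supnorm y"
    using component_le_supnorm[of x i] component_le_supnorm[of y i] by simp
qed

lemma supnorm_minus: "supnorm (- x) = supnorm x"
  by (simp add: supnorm_def)

lemma supnorm_steps: "e \<in> steps \<Longrightarrow> supnorm e \<le> 1"
  by (auto simp: supnorm_le_iff steps_def) (smt (verit) insertE of_int_1 of_int_minus singletonD)

lemma supnorm_box_subset:
  fixes k :: nat
  shows "{z :: int ^ 'm. supnorm z \<le> real k} \<subseteq> vec_lambda ` (PiE UNIV (\<lambda>_. {- int k..int k}))"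
proof
  fix z :: "int ^ 'm" assume "z \<in> {z. supnorm z \<le> real k}"
  hence "\<bar>real_of_int (z $ i)\<bar> \<le> real k" for i by (simp add: supnorm_le_iff)
  hence "z $ i \<in> {- int k..int k}" for i by (smt (verit) atLeastAtMost_iff of_int_le_iff of_int_of_nat_eq of_int_minus)
  thus "z \<in> vec_lambda ` (PiE UNIV (\<lambda>_. {- int k..int k}))"
    by (intro image_eqI[where x="vec_nth z"]) auto
qed

lemma finite_supnorm_box: "finite {z :: int ^ 'm. supnorm z \<le> real k}"
  by (rule finite_subset[OF supnorm_box_subset]) (auto intro!: finite_PiE)

lemma card_supnorm_box: "card {z :: int ^ 'm. supnorm z \<le> real k} \<le> (2 * k + 1) ^ CARD('m)"
proof -
  have "card {z :: int ^ 'm. supnorm z \<le> real k} \<le> card (vec_lambda ` (PiE (UNIV :: 'm set) (\<lambda>_. {- int k..int k})))"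
    by (intro card_mono supnorm_box_subset) (auto intro!: finite_PiE)
  also have "\<dots> \<le> card (PiE (UNIV :: 'm set) (\<lambda>_. {- int k..int k}))"
    by (intro card_image_le finite_PiE) auto
  also have "\<dots> = (2 * k + 1) ^ CARD('m)" by (simp add: card_PiE nat_add_distrib nat_mult_distrib)
  finally show ?thesis .
qed

text \<open>Fixing the value at 0 does not affect pairings with differences of probability measures
  and bounds \<open>f x\<close> by \<open>supnorm x\<close>, which keeps the supremum over the class
  finite.\<close>

definition lip0 :: "(int ^ 'm \<Rightarrow> real) set" where
  "lip0 = {f. f 0 = 0 \<and> (\<forall>x y. f x - f y \<le> supnorm (x - y))}"

lemma lip0_abs: "f \<in> lip0 \<Longrightarrow> \<bar>f x - f y\<bar> \<le> supnorm (x - y)"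
  using supnorm_minus[of "x - y"] unfolding lip0_def abs_le_iff by (metis (lifting) mem_Collect_eq minus_diff_eq)

lemma lip0_bound: "f \<in> lip0 \<Longrightarrow> \<bar>f x\<bar> \<le> supnorm x"
  using lip0_abs[of f x 0] by (simp add: lip0_def)

text \<open>Truncating by the tent \<open>max 0 (D - supnorm x)\<close> makes \<open>f\<close> finitely supported without changing it
  where \<open>supnorm x \<le> D / 2\<close>.\<close>

definition tent :: "real \<Rightarrow> (int ^ 'm \<Rightarrow> real) \<Rightarrow> int ^ 'm \<Rightarrow> real" where
  "tent D f x = max (- max 0 (D - supnorm x)) (min (max 0 (D - supnorm x)) (f x))"

lemma tent_eq: "f \<in> lip0 \<Longrightarrow> supnorm x \<le> D / 2 \<Longrightarrow> tent D f x = f x"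
  using lip0_bound[of f x] by (auto simp: tent_def)

lemma tent_outside: "D \<le> supnorm x \<Longrightarrow> tent D f x = 0"
  by (simp add: tent_def)

lemma tent_bound: "D \<ge> 0 \<Longrightarrow> \<bar>tent D f x\<bar> \<le> D"
  using supnorm_ge_0[of x] unfolding tent_def by (smt (verit))

text \<open>The truncation is the median of three functions, each of which varies by at most 1 along
  a step.\<close>

lemma tent_step:
  assumes f: "f \<in> lip0" and e: "e \<in> steps"
  shows "\<bar>tent D f x - tent D f (x + e)\<bar> \<le> 1"
proof -
  have 1: "\<bar>f x - f (x + e)\<bar> \<le> 1"
    using lip0_abs[OF f, of x "x + e"] supnorm_steps[OF e] supnorm_minus[of e] by simp
  have 2: "\<bar>supnorm x - supnorm (x + e)\<bar> \<le> 1"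
    using supnorm_triangle[of x e] supnorm_triangle[of "x + e" "- e"] supnorm_steps[OF e] supnorm_minus[of e] by simp
  show ?thesis using 1 2 unfolding tent_def by (smt (verit))
qed

lemma tent_representation:
  fixes f :: "int ^ 'm \<Rightarrow> real" and B :: "(int ^ 'm) set"
  assumes f: "f \<in> lip0" and B: "finite B" "\<And>x. supnorm x \<le> D + 1 \<Longrightarrow> x \<in> B"
  shows "tent D f s = (\<Sum>e\<in>steps. \<Sum>x\<in>B. grad e (green T s) x * grad e (tent D f) x) / (2 * 2 ^ CARD('m)) 
    + (\<Sum>x\<in>B. (avg ^^ T) (kdelta s) x * tent D f x)"
proof -
  have out: "tent D f x = 0" if "x \<notin> B" for x
    using B(2)[of x] that by (intro tent_outside) (auto intro: ccontr)
  \<comment> \<open>The box exceeds the support by one unit because \<open>grad e\<close> also looks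
    at the neighbour \<open>x + e\<close>.\<close>
  have outg: "grad e (tent D f) x = 0" if "x \<notin> B" "e \<in> steps" for x e
  proof -
    have "supnorm x > D + 1" using B(2)[of x] that by force
    moreover have "supnorm x \<le> supnorm (x + e) + supnorm e" 
      using supnorm_triangle[of "x + e" "- e"] by (simp add: supnorm_minus)
    ultimately have "supnorm (x + e) \<ge> D" using supnorm_steps[OF that(2)] by simp
    thus ?thesis using out[OF that(1)] by (simp add: grad_def tent_outside)
  qed
  have fs: "finsupp (tent D f)" unfolding finsupp_def
    by (rule finite_subset[OF _ B(1)]) (use out in auto)
  show ?thesis
    by (subst green_representation[OF fs, of s T]) (simp add: ip_finite[OF B(1)] outg out)
qed

text \<open>In the original scale, where lattice points are divided by \<open>n\<close>, these are
  shells of width one.\<close>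

definition shell :: "nat \<Rightarrow> nat \<Rightarrow> (int ^ 'm) set" where
  "shell n j = {s. real j * real n \<le> supnorm s \<and> supnorm s < real (j + 1) * real n}"

text \<open>On shell \<open>j\<close> a tent of height \<open>D = 2 * (j + 1) * n\<close> leaves
  \<open>f\<close> unchanged; it lives where \<open>supnorm x < D\<close>, and its differences reach
  one unit further.\<close>

definition lbox :: "nat \<Rightarrow> nat \<Rightarrow> (int ^ 'm) set" where
  "lbox n j = {x. supnorm x \<le> real (2 * (j + 1) * n + 1)}"

lemma finite_lbox [simp]: "finite (lbox n j :: (int ^ 'm) set)"
  unfolding lbox_def by (rule finite_supnorm_box)

text \<open>On each shell \<open>f\<close> is replaced by a tent of comparable size and then
  represented through the walk. Since gradients are at most 1 and values at most \<open>D\<close>,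
  taking absolute values site by site removes \<open>f\<close>; the right-hand side bounds all of
  \<open>lip0\<close> at once.\<close>

lemma lip0_pairing_le:
  fixes f :: "int ^ 'm \<Rightarrow> real" and \<sigma> :: "int ^ 'm \<Rightarrow> real"
  assumes f: "f \<in> lip0" and S: "finite S" "\<And>s. s \<in> S \<Longrightarrow> supnorm s < real J * real n" and n: "n > 0"
  shows "(\<Sum>s\<in>S. \<sigma> s * f s) \<le> (\<Sum>j<J.
     (\<Sum>e\<in>steps. \<Sum>x\<in>lbox n j. \<bar>\<Sum>s\<in>S. \<sigma> s * (indicator (shell n j) s * grad e (green T s) x)\<bar>) / (2 * 2 ^ CARD('m))
     + 2 * real (j + 1) * real n * (\<Sum>x\<in>lbox n j. \<bar>\<Sum>s\<in>S. \<sigma> s * (indicator (shell n j) s * (avg ^^ T) (kdelta s) x)\<bar>))"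
proof -
  define D where "D j = 2 * real (j + 1) * real n" for j
  have part: "(\<Sum>j<J. indicator (shell n j) s * tent (D j) f s) = f s" if s: "s \<in> S" for s
  proof -
    define k where "k = nat \<lfloor>supnorm s / n\<rfloor>"
    have k1: "real k * real n \<le> supnorm s" "supnorm s < (real k + 1) * real n"
    proof -
      have "real k = of_int \<lfloor>supnorm s / n\<rfloor>" unfolding k_def by (simp add: of_nat_nat)
      hence "real k \<le> supnorm s / n" "supnorm s / n < real k + 1" by linarith+
      thus "real k * real n \<le> supnorm s" "supnorm s < (real k + 1) * real n"
        using n by (auto simp: field_simps)
    qed
    have ind: "indicator (shell n j) s = (if j = k then 1 else 0 :: real)" for j
    proof -
      have "j = k" if "real j * real n \<le> supnorm s" "supnorm s < real (j + 1) * real n"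
      proof -
        have "real j * real n < (real k + 1) * real n" "real k * real n < (real j + 1) * real n"
          using that(1) k1(2) apply linarith
          using that(2) k1(1) unfolding of_nat_add of_nat_1 by linarith
        hence "real j < real k + 1" "real k < real j + 1" using n by (simp_all only: mult_less_cancel_right_pos of_nat_0_less_iff)
        thus ?thesis by linarith
      qed
      moreover have "s \<in> shell n k" using k1 by (simp add: shell_def add.commute)
      ultimately show ?thesis by (cases "j = k") (auto simp: indicator_def shell_def)
    qed
    have "real k * real n < real J * real n" using k1 S(2)[OF s] by linarith
    hence "k < J" using n by simp
    have "(\<Sum>j<J. indicator (shell n j) s * tent (D j) f s) = (\<Sum>j<J. if j = k then tent (D k) f s else 0)"
      by (intro sum.cong) (auto simp: ind)
    also have "\<dots> = tent (D k) f s" using \<open>k < J\<close> by simp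
    also have "\<dots> = f s" by (rule tent_eq[OF f]) (use k1 in \<open>simp add: D_def algebra_simps\<close>)
    finally show ?thesis .
  qed
  have "(\<Sum>s\<in>S. \<sigma> s * f s) = (\<Sum>s\<in>S. \<Sum>j<J. \<sigma> s * (indicator (shell n j) s * tent (D j) f s))"
  proof (intro sum.cong refl)
    fix s assume s: "s \<in> S"
    show "\<sigma> s * f s = (\<Sum>j<J. \<sigma> s * (indicator (shell n j) s * tent (D j) f s))"
      by (subst part[OF s, symmetric]) (rule sum_distrib_left)
  qed
  also have "\<dots> = (\<Sum>j<J. \<Sum>s\<in>S. \<sigma> s * (indicator (shell n j) s * tent (D j) f s))" by (rule sum.swap)
  also have "\<dots> \<le> (\<Sum>j<J.
     (\<Sum>e\<in>steps. \<Sum>x\<in>lbox n j. \<bar>\<Sum>s\<in>S. \<sigma> s * (indicator (shell n j) s * grad e (green T s) x)\<bar>) / (2 * 2 ^ CARD('m))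
     + D j * (\<Sum>x\<in>lbox n j. \<bar>\<Sum>s\<in>S. \<sigma> s * (indicator (shell n j) s * (avg ^^ T) (kdelta s) x)\<bar>))"
  proof (rule sum_mono)
    fix j
    let ?c = "\<lambda>s. \<sigma> s * indicator (shell n j) s"
    have B: "x \<in> lbox n j" if "supnorm x \<le> D j + 1" for x :: "int ^ 'm"
      using that by (simp add: lbox_def D_def algebra_simps)
    have "(\<Sum>s\<in>S. \<sigma> s * (indicator (shell n j) s * tent (D j) f s))
      = (\<Sum>s\<in>S. ?c s * ((\<Sum>e\<in>steps. \<Sum>x\<in>lbox n j. grad e (green T s) x * grad e (tent (D j) f) x) / (2 * 2 ^ CARD('m)) 
          + (\<Sum>x\<in>lbox n j. (avg ^^ T) (kdelta s) x * tent (D j) f x)))"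
      by (intro sum.cong refl)
        (simp only: mult.assoc tent_representation[OF f finite_lbox[of n j] B, where T=T, symmetric])
    also have "\<dots> = (\<Sum>e\<in>steps. \<Sum>x\<in>lbox n j. (\<Sum>s\<in>S. ?c s * grad e (green T s) x) * grad e (tent (D j) f) x) / (2 * 2 ^ CARD('m))
       + (\<Sum>x\<in>lbox n j. (\<Sum>s\<in>S. ?c s * (avg ^^ T) (kdelta s) x) * tent (D j) f x)"
    proof -
      have "(\<Sum>s\<in>S. ?c s * ((\<Sum>e\<in>steps. \<Sum>x\<in>lbox n j. grad e (green T s) x * grad e (tent (D j) f) x) / (2 * 2 ^ CARD('m))))
        = (\<Sum>s\<in>S. \<Sum>e\<in>steps. \<Sum>x\<in>lbox n j. ?c s * grad e (green T s) x * grad e (tent (D j) f) x) / (2 * 2 ^ CARD('m))"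
        by (simp add: sum_divide_distrib[symmetric] sum_distrib_left mult.assoc)
      also have "(\<Sum>s\<in>S. \<Sum>e\<in>steps. \<Sum>x\<in>lbox n j. ?c s * grad e (green T s) x * grad e (tent (D j) f) x)
        = (\<Sum>e\<in>steps. \<Sum>x\<in>lbox n j. \<Sum>s\<in>S. ?c s * grad e (green T s) x * grad e (tent (D j) f) x)"
        by (subst sum.swap) (intro sum.cong refl sum.swap)
      also have "\<dots> = (\<Sum>e\<in>steps. \<Sum>x\<in>lbox n j. (\<Sum>s\<in>S. ?c s * grad e (green T s) x) * grad e (tent (D j) f) x)"
        by (simp only: sum_distrib_right)
      finally have 1: "(\<Sum>s\<in>S. ?c s * ((\<Sum>e\<in>steps. \<Sum>x\<in>lbox n j. grad e (green T s) x * grad e (tent (D j) f) x) / (2 * 2 ^ CARD('m))))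
        = (\<Sum>e\<in>steps. \<Sum>x\<in>lbox n j. (\<Sum>s\<in>S. ?c s * grad e (green T s) x) * grad e (tent (D j) f) x) / (2 * 2 ^ CARD('m))" .
      have 2: "(\<Sum>s\<in>S. ?c s * (\<Sum>x\<in>lbox n j. (avg ^^ T) (kdelta s) x * tent (D j) f x))
        = (\<Sum>x\<in>lbox n j. (\<Sum>s\<in>S. ?c s * (avg ^^ T) (kdelta s) x) * tent (D j) f x)"
        unfolding sum_distrib_left sum_distrib_right by (subst sum.swap) (simp only: mult.assoc)
      show ?thesis by (simp only: distrib_left sum.distrib 1 2)
    qed
    also have "\<dots> \<le> (\<Sum>e\<in>steps. \<Sum>x\<in>lbox n j. \<bar>\<Sum>s\<in>S. ?c s * grad e (green T s) x\<bar>) / (2 * 2 ^ CARD('m))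
       + (\<Sum>x\<in>lbox n j. \<bar>\<Sum>s\<in>S. ?c s * (avg ^^ T) (kdelta s) x\<bar> * D j)"
    proof (intro add_mono divide_right_mono sum_mono)
      fix e x assume e: "e \<in> (steps :: (int ^ 'm) set)"
      have "(\<Sum>s\<in>S. ?c s * grad e (green T s) x) * grad e (tent (D j) f) x
        \<le> \<bar>\<Sum>s\<in>S. ?c s * grad e (green T s) x\<bar> * \<bar>grad e (tent (D j) f) x\<bar>"
        by (simp only: abs_mult[symmetric] abs_ge_self)
      also have "\<dots> \<le> \<bar>\<Sum>s\<in>S. ?c s * grad e (green T s) x\<bar> * 1"
        using tent_step[OF f e] by (intro mult_left_mono) (auto simp: grad_def)
      finally show "(\<Sum>s\<in>S. ?c s * grad e (green T s) x) * grad e (tent (D j) f) x \<le> \<bar>\<Sum>s\<in>S. ?c s * grad e (green T s) x\<bar>" by simp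
    next
      fix x
      have "(\<Sum>s\<in>S. ?c s * (avg ^^ T) (kdelta s) x) * tent (D j) f x
         \<le> \<bar>\<Sum>s\<in>S. ?c s * (avg ^^ T) (kdelta s) x\<bar> * \<bar>tent (D j) f x\<bar>"
        by (simp only: abs_mult[symmetric] abs_ge_self)
      also have "\<dots> \<le> \<bar>\<Sum>s\<in>S. ?c s * (avg ^^ T) (kdelta s) x\<bar> * D j"
        by (intro mult_left_mono tent_bound) (auto simp: D_def)
      finally show "(\<Sum>s\<in>S. ?c s * (avg ^^ T) (kdelta s) x) * tent (D j) f x \<le> \<bar>\<Sum>s\<in>S. ?c s * (avg ^^ T) (kdelta s) x\<bar> * D j" .
    qed auto
    finally show "(\<Sum>s\<in>S. \<sigma> s * (indicator (shell n j) s * tent (D j) f s)) \<le>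
       (\<Sum>e\<in>steps. \<Sum>x\<in>lbox n j. \<bar>\<Sum>s\<in>S. \<sigma> s * (indicator (shell n j) s * grad e (green T s) x)\<bar>) / (2 * 2 ^ CARD('m))
     + D j * (\<Sum>x\<in>lbox n j. \<bar>\<Sum>s\<in>S. \<sigma> s * (indicator (shell n j) s * (avg ^^ T) (kdelta s) x)\<bar>)"
      by (simp only: sum_distrib_right[symmetric] mult.assoc mult.commute[of "D j"])
  qed
  finally show ?thesis by (simp add: D_def)
qed

section \<open>Discrepancy of a quantised sample\<close>

lemma sum_sqrt_le:
  assumes "\<And>k. k \<in> I \<Longrightarrow> a k \<ge> 0"
  shows "(\<Sum>k\<in>I. sqrt (a k)) \<le> sqrt (real (card I) * (\<Sum>k\<in>I. a k))"
proof (rule real_le_rsqrt)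
  have "(\<Sum>k\<in>I. 1 * sqrt (a k))\<^sup>2 \<le> (\<Sum>k\<in>I. 1\<^sup>2) * (\<Sum>k\<in>I. (sqrt (a k))\<^sup>2)"
    by (rule Cauchy_Schwarz_ineq_sum)
  thus "(\<Sum>k\<in>I. sqrt (a k))\<^sup>2 \<le> real (card I) * (\<Sum>k\<in>I. a k)" using assms by simp
qed

text \<open>The bound on \<open>q\<close> makes the grid finite and leaves only the shells with
  \<open>j < J\<close>. In the application \<open>J\<close> grows with the sample size, so the rates
  below must be free of it.\<close>

locale quantised_sample = prob_space M for M :: "'a measure" +
  fixes q :: "'a \<Rightarrow> int ^ 'm" and n J N :: nat
  assumes q[measurable]: "q \<in> measurable M (count_space UNIV)"
    and q_bound: "\<And>x. x \<in> space M \<Longrightarrow> supnorm (q x) < real J * real n"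
    and n: "n > 0" and N: "N > 0"
begin

abbreviation PM where "PM \<equiv> PiM {..<N} (\<lambda>_. M)"

sublocale PM: product_prob_space "\<lambda>_. M" "{..<N}" ..

definition grid :: "(int ^ 'm) set" where
  "grid = {z. supnorm z < real J * real n}"

definition deviation :: "(int ^ 'm \<Rightarrow> real) \<Rightarrow> (nat \<Rightarrow> 'a) \<Rightarrow> real" where
  "deviation f \<omega> = (\<Sum>i<N. f (q (\<omega> i))) / real N - (\<integral>x. f (q x) \<partial>M)"

text \<open>By Kantorovich duality, the order-one Wasserstein distance in \<open>supnorm\<close>
  between the empirical and the true law of the quantised variable.\<close>

definition discrepancy :: "(nat \<Rightarrow> 'a) \<Rightarrow> real" where
  "discrepancy \<omega> = (SUP f\<in>lip0. deviation f \<omega>)"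

lemma q_grid: "x \<in> space M \<Longrightarrow> q x \<in> grid"
  using q_bound by (simp add: grid_def)

lemma finite_grid [simp]: "finite grid"
  unfolding grid_def by (rule finite_subset[OF _ finite_supnorm_box[of "J * n"]]) auto

lemma fq_measurable [measurable]: "(\<lambda>x. f (q x) :: real) \<in> borel_measurable M"
  by (rule measurable_compose[OF q]) simp

lemma fq_bound: "x \<in> space M \<Longrightarrow> \<bar>f (q x)\<bar> \<le> (\<Sum>s\<in>grid. \<bar>f s :: real\<bar>)"
  using member_le_sum[of "q x" grid "\<lambda>s. \<bar>f s\<bar>"] q_grid by auto

lemma fq_integrable [simp]: "integrable M (\<lambda>x. f (q x) :: real)"
  by (rule integrable_const_bound[of _ "\<Sum>s\<in>grid. \<bar>f s\<bar>"]) (auto intro!: AE_I2 fq_bound)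

lemma integral_fq: "(\<integral>x. f (q x) \<partial>M) = (\<Sum>s\<in>grid. prob {x\<in>space M. q x = s} * f s)"
proof -
  have "(\<integral>x. f (q x) \<partial>M) = (\<integral>x. (\<Sum>s\<in>grid. indicator {x\<in>space M. q x = s} x * f s) \<partial>M)"
  proof (rule Bochner_Integration.integral_cong[OF refl])
    fix x assume x: "x \<in> space M"
    have "(\<Sum>s\<in>grid. indicator {x\<in>space M. q x = s} x * f s) = (\<Sum>s\<in>grid. if s = q x then f (q x) else 0)"
      using x by (intro sum.cong) auto
    thus "f (q x) = (\<Sum>s\<in>grid. indicator {x\<in>space M. q x = s} x * f s)" using q_grid[OF x] by simp
  qed
  also have "\<dots> = (\<Sum>s\<in>grid. \<integral>x. indicator {x\<in>space M. q x = s} x * f s \<partial>M)"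
  proof (rule Bochner_Integration.integral_sum)
    fix s
    have "{x\<in>space M. q x = s} \<in> sets M" by measurable
    thus "integrable M (\<lambda>x. indicator {x\<in>space M. q x = s} x * f s)"
      by (intro integrable_mult_left integrable_real_indicator) (auto simp: emeasure_eq_measure)
  qed
  finally show ?thesis by simp
qed

definition weight :: "(nat \<Rightarrow> 'a) \<Rightarrow> int ^ 'm \<Rightarrow> real" where
  "weight \<omega> s = (\<Sum>i<N. of_bool (q (\<omega> i) = s)) / real N - prob {x\<in>space M. q x = s}"

lemma deviation_eq:
  assumes "\<And>i. i < N \<Longrightarrow> \<omega> i \<in> space M"
  shows "deviation f \<omega> = (\<Sum>s\<in>grid. weight \<omega> s * f s)"
proof -
  have "(\<Sum>s\<in>grid. (\<Sum>i<N. of_bool (q (\<omega> i) = s)) * f s) = (\<Sum>i<N. \<Sum>s\<in>grid. of_bool (q (\<omega> i) = s) * f s)"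
    unfolding sum_distrib_right by (rule sum.swap)
  also have "\<dots> = (\<Sum>i<N. f (q (\<omega> i)))"
  proof (intro sum.cong refl)
    fix i assume "i \<in> {..<N}"
    hence "q (\<omega> i) \<in> grid" using assms q_grid by auto
    moreover have "(\<Sum>s\<in>grid. of_bool (q (\<omega> i) = s) * f s) = (\<Sum>s\<in>grid. if s = q (\<omega> i) then f (q (\<omega> i)) else 0)"
      by (intro sum.cong) auto
    ultimately show "(\<Sum>s\<in>grid. of_bool (q (\<omega> i) = s) * f s) = f (q (\<omega> i))" by simp
  qed
  finally show ?thesis
    unfolding deviation_def weight_def integral_fq
    by (simp add: left_diff_distrib sum_subtractf sum_divide_distrib[symmetric] times_divide_eq_left)
qed

lemma lip0_bound_grid:
  assumes "f \<in> lip0" "x \<in> space M" shows "\<bar>f (q x)\<bar> \<le> real J * real n"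
  using lip0_bound[OF assms(1), of "q x"] q_bound[OF assms(2)] by simp

lemma deviation_bound:
  assumes \<omega>: "\<And>i. i < N \<Longrightarrow> \<omega> i \<in> space M" and f: "f \<in> lip0"
  shows "\<bar>deviation f \<omega>\<bar> \<le> 2 * (real J * real n)"
proof -
  have "\<bar>\<Sum>i<N. f (q (\<omega> i))\<bar> \<le> (\<Sum>i<N. \<bar>f (q (\<omega> i))\<bar>)" by (rule sum_abs)
  also have "\<dots> \<le> (\<Sum>i<N. real J * real n)" using \<omega> by (intro sum_mono lip0_bound_grid f) auto
  finally have 1: "\<bar>(\<Sum>i<N. f (q (\<omega> i))) / real N\<bar> \<le> real J * real n" using N by (simp add: divide_simps mult.commute)
  have "\<bar>\<integral>x. f (q x) \<partial>M\<bar> \<le> (\<integral>x. \<bar>f (q x)\<bar> \<partial>M)" by (rule integral_abs_bound)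
  also have "\<dots> \<le> (\<integral>x. real J * real n \<partial>M)"
    by (intro integral_mono lip0_bound_grid f) auto
  finally have "\<bar>\<integral>x. f (q x) \<partial>M\<bar> \<le> real J * real n" by (simp add: prob_space)
  thus ?thesis using 1 unfolding deviation_def by linarith
qed

lemma zero_lip0 [simp]: "(\<lambda>_. 0) \<in> (lip0 :: (int ^ 'm \<Rightarrow> real) set)"
  by (simp add: lip0_def)

lemma lip0_ne [simp]: "lip0 \<noteq> ({} :: (int ^ 'm \<Rightarrow> real) set)"
  using zero_lip0 by blast

lemma bdd_deviation:
  assumes "\<And>i. i < N \<Longrightarrow> \<omega> i \<in> space M"
  shows "bdd_above ((\<lambda>f. deviation f \<omega>) ` lip0)"
  using deviation_bound[OF assms] by (intro bdd_aboveI[of _ "2 * (real J * real n)"]) (auto simp: abs_le_iff)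

lemma deviation_le_discrepancy:
  assumes "\<And>i. i < N \<Longrightarrow> \<omega> i \<in> space M" "f \<in> lip0"
  shows "deviation f \<omega> \<le> discrepancy \<omega>"
  unfolding discrepancy_def by (rule cSUP_upper[OF assms(2) bdd_deviation[OF assms(1)]])

lemma discrepancy_nonneg:
  assumes "\<And>i. i < N \<Longrightarrow> \<omega> i \<in> space M"
  shows "discrepancy \<omega> \<ge> 0"
  using deviation_le_discrepancy[OF assms zero_lip0] by (simp add: deviation_def)

lemma discrepancy_bound:
  assumes "\<And>i. i < N \<Longrightarrow> \<omega> i \<in> space M"
  shows "\<bar>discrepancy \<omega>\<bar> \<le> 2 * (real J * real n)"
proof -
  have "discrepancy \<omega> \<le> 2 * (real J * real n)"
    unfolding discrepancy_def
    using deviation_bound[OF assms] by (intro cSUP_least) (auto simp: abs_le_iff)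
  thus ?thesis using discrepancy_nonneg[OF assms] by simp
qed

text \<open>The supremum runs over an uncountable family, but it depends on the sample only through
  the tuple of grid points, which has finitely many values.\<close>

lemma discrepancy_measurable [measurable]: "discrepancy \<in> borel_measurable PM"
proof -
  define h where "h = (\<lambda>\<omega>. \<lambda>i\<in>{..<N}. q (\<omega> i))"
  have "h \<in> measurable PM (count_space (PiE {..<N} (\<lambda>_. grid)))"
  proof (subst measurable_count_space_eq2)
    show "finite (PiE {..<N} (\<lambda>_. grid))" by (intro finite_PiE) auto
    have "h -` {a} \<inter> space PM \<in> sets PM" if a: "a \<in> PiE {..<N} (\<lambda>_. grid)" for a
    proof -
      have "h -` {a} \<inter> space PM = {\<omega>\<in>space PM. \<forall>i\<in>{..<N}. q (\<omega> i) = a i}"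
      proof -
        have "h \<omega> = a \<longleftrightarrow> (\<forall>i\<in>{..<N}. q (\<omega> i) = a i)" for \<omega>
        proof
          assume "h \<omega> = a"
          thus "\<forall>i\<in>{..<N}. q (\<omega> i) = a i" by (auto simp: h_def)
        next
          assume "\<forall>i\<in>{..<N}. q (\<omega> i) = a i"
          hence "h \<omega> = restrict a {..<N}" unfolding h_def by (intro restrict_ext) auto
          thus "h \<omega> = a" using PiE_restrict[OF a] by simp
        qed
        thus ?thesis by blast
      qed
      also have "\<dots> \<in> sets PM" by measurable
      finally show ?thesis .
    qed
    moreover have "h \<in> space PM \<rightarrow> PiE {..<N} (\<lambda>_. grid)"
    proof
      fix \<omega> assume "\<omega> \<in> space PM"
      hence "\<omega> i \<in> space M" if "i \<in> {..<N}" for i using that by (auto simp: space_PiM)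
      thus "h \<omega> \<in> PiE {..<N} (\<lambda>_. grid)"
        unfolding h_def restrict_PiE_iff using q_grid by blast
    qed
    ultimately show "h \<in> space PM \<rightarrow> PiE {..<N} (\<lambda>_. grid) \<and> (\<forall>a\<in>PiE {..<N} (\<lambda>_. grid). h -` {a} \<inter> space PM \<in> sets PM)"
      by blast
  qed
  hence "(\<lambda>\<omega>. (SUP f\<in>lip0. (\<Sum>i<N. f (h \<omega> i)) / real N - (\<integral>x. f (q x) \<partial>M))) \<in> borel_measurable PM"
    by (rule measurable_compose) simp
  also have "(\<lambda>\<omega>. (SUP f\<in>lip0. (\<Sum>i<N. f (h \<omega> i)) / real N - (\<integral>x. f (q x) \<partial>M))) = discrepancy"
    by (simp add: h_def discrepancy_def deviation_def fun_eq_iff)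
  finally show ?thesis .
qed

lemma discrepancy_integrable [simp]: "integrable PM discrepancy"
  by (rule PM.integrable_const_bound[of _ "2 * (real J * real n)"])
     (auto intro!: AE_I2 discrepancy_bound simp: space_PiM)

text \<open>Exchanging one observation moves every deviation by
  \<open>(f (q u) - f (q v)) / N\<close>. The bound depends on the observations, which is why the
  exponential estimate above carries a function \<open>\<beta>\<close> rather than a
  constant.\<close>

lemma discrepancy_osc:
  assumes x: "x \<in> space PM" and i: "i < N" and uv: "u \<in> space M" "v \<in> space M"
  shows "\<bar>discrepancy (x(i := u)) - discrepancy (x(i := v))\<bar> \<le> (supnorm (q u) + supnorm (q v)) / real N"
proof -
  have *: "discrepancy (x(i := u)) \<le> discrepancy (x(i := v)) + (supnorm (q u) + supnorm (q v)) / real N"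
    if uv: "u \<in> space M" "v \<in> space M" for u v
    unfolding discrepancy_def[of "x(i := u)"]
  proof (rule cSUP_least)
    fix f :: "int ^ 'm \<Rightarrow> real" assume f: "f \<in> lip0"
    have sm: "(\<Sum>k<N. f (q ((x(i := w)) k))) = f (q w) + (\<Sum>k\<in>{..<N} - {i}. f (q (x k)))" for w
      using i by (subst sum.remove[of _ i]) (auto intro!: sum.cong)
    have "deviation f (x(i := u)) = deviation f (x(i := v)) + (f (q u) - f (q v)) / real N"
      unfolding deviation_def sm by (simp add: add_divide_distrib diff_divide_distrib)
    moreover have "deviation f (x(i := v)) \<le> discrepancy (x(i := v))"
      using x uv by (intro deviation_le_discrepancy f) (auto simp: space_PiM)
    moreover have "(f (q u) - f (q v)) / real N \<le> (supnorm (q u) + supnorm (q v)) / real N"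
      using lip0_bound[OF f, of "q u"] lip0_bound[OF f, of "q v"] by (intro divide_right_mono) auto
    ultimately show "deviation f (x(i := u)) \<le> discrepancy (x(i := v)) + (supnorm (q u) + supnorm (q v)) / real N"
      by linarith
  qed simp
  show ?thesis using *[OF uv] *[OF uv(2,1)] by (simp add: abs_le_iff add.commute)
qed

lemma expectation_deviation:
  "(\<integral>\<omega>. \<bar>deviation g \<omega>\<bar> \<partial>PM) \<le> sqrt ((\<integral>x. (g (q x))\<^sup>2 \<partial>M) / real N)"
  unfolding deviation_def
  by (rule product_mean_deviation[OF fq_measurable fq_bound N])

lemma deviation_integrable: "integrable PM (\<lambda>\<omega>. \<bar>deviation g \<omega>\<bar>)"
proof (rule PM.integrable_const_bound)
  show "(\<lambda>\<omega>. \<bar>deviation g \<omega>\<bar>) \<in> borel_measurable PM" unfolding deviation_def by measurable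
  show "AE \<omega> in PM. norm \<bar>deviation g \<omega>\<bar> \<le> (\<Sum>i<N. \<Sum>s\<in>grid. \<bar>g s\<bar>) / real N + \<bar>\<integral>x. g (q x) \<partial>M\<bar>"
  proof (rule AE_I2)
    fix \<omega> assume \<omega>: "\<omega> \<in> space PM"
    have "\<bar>\<Sum>i<N. g (q (\<omega> i))\<bar> \<le> (\<Sum>i<N. \<bar>g (q (\<omega> i))\<bar>)" by (rule sum_abs)
    also have "\<dots> \<le> (\<Sum>i<N. \<Sum>s\<in>grid. \<bar>g s\<bar>)" using \<omega> by (intro sum_mono fq_bound) (auto simp: space_PiM)
    finally have "\<bar>\<Sum>i<N. g (q (\<omega> i))\<bar> / real N \<le> (\<Sum>i<N. \<Sum>s\<in>grid. \<bar>g s\<bar>) / real N"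
      by (intro divide_right_mono) auto
    hence "\<bar>(\<Sum>i<N. g (q (\<omega> i))) / real N\<bar> \<le> (\<Sum>i<N. \<Sum>s\<in>grid. \<bar>g s\<bar>) / real N"
      by (simp only: abs_divide abs_of_nat)
    thus "norm \<bar>deviation g \<omega>\<bar> \<le> (\<Sum>i<N. \<Sum>s\<in>grid. \<bar>g s\<bar>) / real N + \<bar>\<integral>x. g (q x) \<partial>M\<bar>"
      unfolding deviation_def by (simp only: real_norm_def)
  qed
qed

text \<open>In expectation every absolute value in \<open>lip0_pairing_le\<close> is at most the
  root of a second moment. Cauchy-Schwarz over the sites turns the sum of roots into the root of the
  box volume times the total energy, and the energy of a sample point counts only on its own
  shell.\<close>

lemma expectation_discrepancy_le:
  fixes T :: nat
  defines "g \<equiv> (\<Sum>t<T. bwalk t 0 ^ CARD('m))" and "h \<equiv> bwalk (2 * T) 0 ^ CARD('m)"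
  shows "(\<integral>\<omega>. discrepancy \<omega> \<partial>PM) \<le> (\<Sum>j<J. 
     sqrt (real (card (lbox n j :: (int ^ 'm) set)) * prob {x\<in>space M. q x \<in> shell n j} / real N) 
       * (sqrt g + 2 * real (j + 1) * real n * sqrt h))"
proof -
  define G where "G j e x s = indicator (shell n j) s * grad e (green T s) x" for j and e x s :: "int ^ 'm"
  define H where "H j x s = indicator (shell n j) s * (avg ^^ T) (kdelta s) x" for j and x s :: "int ^ 'm"
  define p where "p j = prob {x\<in>space M. q x \<in> shell n j}" for j
  define c where "c = (2::real) ^ CARD('m)"
  have c: "c > 0" by (simp add: c_def)
  have diag: "(avg ^^ t) (kdelta s) s = bwalk t 0 ^ CARD('m)" for t and s :: "int ^ 'm"
    by (simp add: avg_pow_kdelta)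
  have g0: "g \<ge> 0" "h \<ge> 0" unfolding g_def h_def diag[symmetric, of _ 0]
    by (auto intro!: sum_nonneg avg_pow_nonneg simp: kdelta_def)
  have green_diag: "green T s s = g" for s :: "int ^ 'm"
    by (simp add: green_def diag g_def)
  define \<Phi> where "\<Phi> \<omega> = (\<Sum>j<J. (\<Sum>e\<in>steps. \<Sum>x\<in>lbox n j. \<bar>deviation (G j e x) \<omega>\<bar>) / (2 * c)
     + 2 * real (j + 1) * real n * (\<Sum>x\<in>lbox n j. \<bar>deviation (H j x) \<omega>\<bar>))" for \<omega>
  have le\<Phi>: "discrepancy \<omega> \<le> \<Phi> \<omega>" if \<omega>: "\<omega> \<in> space PM" for \<omega>
  proof -
    have sp: "\<omega> i \<in> space M" if "i < N" for i using \<omega> that by (auto simp: space_PiM)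
    show ?thesis unfolding discrepancy_def
    proof (rule cSUP_least)
      fix f :: "int ^ 'm \<Rightarrow> real" assume f: "f \<in> lip0"
      have dev: "deviation f \<omega> = (\<Sum>s\<in>grid. weight \<omega> s * f s)" for f
        by (rule deviation_eq) (rule sp)
      have "deviation f \<omega> = (\<Sum>s\<in>grid. weight \<omega> s * f s)" by (rule dev)
      also have "\<dots> \<le> \<Phi> \<omega>"
        unfolding \<Phi>_def dev G_def H_def c_def
        by (rule lip0_pairing_le[OF f finite_grid _ n]) (simp add: grid_def)
      finally show "deviation f \<omega> \<le> \<Phi> \<omega>" .
    qed simp
  qed
  have \<Phi>int: "integrable PM \<Phi>"
    unfolding \<Phi>_def
    by (intro Bochner_Integration.integrable_sum Bochner_Integration.integrable_add integrable_divide_zero impI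
        integrable_mult_right deviation_integrable)
  have int_shell: "(\<integral>x. indicator (shell n j) (q x) * b \<partial>M) = p j * b" for j b
  proof -
    have "(\<integral>x. indicator (shell n j) (q x) * b \<partial>M) = (\<integral>x. indicator {x\<in>space M. q x \<in> shell n j} x * b \<partial>M)"
      by (intro Bochner_Integration.integral_cong) (auto simp: indicator_def)
    thus ?thesis by (simp add: p_def)
  qed
  \<comment> \<open>Once the sum over sites is inside the integral, it is part of the Dirichlet
    energy of the Green function started at the sample point.\<close>
  have G2: "(\<Sum>e\<in>steps. \<Sum>x\<in>lbox n j. \<integral>y. (G j e x (q y))\<^sup>2 \<partial>M) \<le> p j * (2 * c * g)" for j
  proof -
    have "(\<Sum>e\<in>steps. \<Sum>x\<in>lbox n j. \<integral>y. (G j e x (q y))\<^sup>2 \<partial>M) = (\<integral>y. (\<Sum>e\<in>steps. \<Sum>x\<in>lbox n j. (G j e x (q y))\<^sup>2) \<partial>M)"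
      by (subst Bochner_Integration.integral_sum) 
         (auto intro!: sum.cong Bochner_Integration.integrable_sum fq_integrable[of "\<lambda>s. (G _ _ _ s)\<^sup>2"] Bochner_Integration.integral_sum[symmetric])
    also have "\<dots> \<le> (\<integral>y. indicator (shell n j) (q y) * (2 * c * g) \<partial>M)"
    proof (rule integral_mono)
      show "integrable M (\<lambda>y. \<Sum>e\<in>steps. \<Sum>x\<in>lbox n j. (G j e x (q y))\<^sup>2)"
        by (intro Bochner_Integration.integrable_sum fq_integrable[of "\<lambda>s. (G _ _ _ s)\<^sup>2"])
      show "integrable M (\<lambda>y. indicator (shell n j) (q y) * (2 * c * g))"
        by (rule fq_integrable[of "\<lambda>s. indicator (shell n j) s * (2 * c * g)"])
      fix y
      let ?s = "q y"
      have "(\<Sum>e\<in>steps. \<Sum>x\<in>lbox n j. (G j e x ?s)\<^sup>2) = indicator (shell n j) ?s * (\<Sum>e\<in>steps. \<Sum>x\<in>lbox n j. (grad e (green T ?s) x)\<^sup>2)"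
        by (simp add: G_def power_mult_distrib sum_distrib_left[symmetric] power2_eq_square[of "indicator _ _"] indicator_def)
      also have "\<dots> \<le> indicator (shell n j) ?s * (\<Sum>e\<in>steps. ip (grad e (green T ?s)) (grad e (green T ?s)))"
        by (intro mult_left_mono sum_mono sum_le_ip) auto
      also have "\<dots> \<le> indicator (shell n j) ?s * (2 * c * g)"
        using green_energy[of T ?s] by (intro mult_left_mono) (auto simp: green_diag c_def)
      finally show "(\<Sum>e\<in>steps. \<Sum>x\<in>lbox n j. (G j e x ?s)\<^sup>2) \<le> indicator (shell n j) ?s * (2 * c * g)" .
    qed
    finally show ?thesis by (simp only: int_shell)
  qed
  have H2: "(\<Sum>x\<in>lbox n j. \<integral>y. (H j x (q y))\<^sup>2 \<partial>M) \<le> p j * h" for j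
  proof -
    have "(\<Sum>x\<in>lbox n j. \<integral>y. (H j x (q y))\<^sup>2 \<partial>M) = (\<integral>y. (\<Sum>x\<in>lbox n j. (H j x (q y))\<^sup>2) \<partial>M)"
      by (rule Bochner_Integration.integral_sum[symmetric]) (rule fq_integrable[of "\<lambda>s. (H _ _ s)\<^sup>2"])
    also have "\<dots> \<le> (\<integral>y. indicator (shell n j) (q y) * h \<partial>M)"
    proof (rule integral_mono)
      show "integrable M (\<lambda>y. \<Sum>x\<in>lbox n j. (H j x (q y))\<^sup>2)"
        by (intro Bochner_Integration.integrable_sum fq_integrable[of "\<lambda>s. (H _ _ s)\<^sup>2"])
      show "integrable M (\<lambda>y. indicator (shell n j) (q y) * h)"
        by (rule fq_integrable[of "\<lambda>s. indicator (shell n j) s * h"])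
      fix y
      let ?s = "q y"
      have "(\<Sum>x\<in>lbox n j. (H j x ?s)\<^sup>2) = indicator (shell n j) ?s * (\<Sum>x\<in>lbox n j. ((avg ^^ T) (kdelta ?s) x)\<^sup>2)"
        by (simp add: H_def power_mult_distrib sum_distrib_left[symmetric] power2_eq_square[of "indicator _ _"] indicator_def)
      also have "\<dots> \<le> indicator (shell n j) ?s * ip ((avg ^^ T) (kdelta ?s)) ((avg ^^ T) (kdelta ?s))"
        by (intro mult_left_mono sum_le_ip) auto
      also have "\<dots> = indicator (shell n j) ?s * h" by (simp only: avg_pow_energy diag h_def)
      finally show "(\<Sum>x\<in>lbox n j. (H j x ?s)\<^sup>2) \<le> indicator (shell n j) ?s * h" .
    qed
    finally show ?thesis by (simp only: int_shell)
  qed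
  define b where "b j = real (card (lbox n j :: (int ^ 'm) set))" for j
  have p0: "p j \<ge> 0" for j by (simp add: p_def)
  have EG: "(\<Sum>e\<in>steps. \<Sum>x\<in>lbox n j. \<integral>\<omega>. \<bar>deviation (G j e x) \<omega>\<bar> \<partial>PM) / (2 * c) \<le> sqrt (b j * p j / real N) * sqrt g" for j
  proof -
    define A where "A = (\<lambda>(e, x). (\<integral>y. (G j e x (q y))\<^sup>2 \<partial>M) / real N)"
    have "(\<Sum>e\<in>steps. \<Sum>x\<in>lbox n j. \<integral>\<omega>. \<bar>deviation (G j e x) \<omega>\<bar> \<partial>PM) \<le> (\<Sum>e\<in>steps. \<Sum>x\<in>lbox n j. sqrt (A (e, x)))"
      by (intro sum_mono) (simp add: A_def expectation_deviation)
    also have "\<dots> = (\<Sum>z\<in>steps \<times> lbox n j. sqrt (A z))" by (simp add: sum.cartesian_product)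
    also have "\<dots> \<le> sqrt (real (card ((steps :: (int ^ 'm) set) \<times> (lbox n j :: (int ^ 'm) set))) * (\<Sum>z\<in>steps \<times> lbox n j. A z))"
      by (rule sum_sqrt_le) (auto simp: A_def)
    also have "(\<Sum>z\<in>steps \<times> lbox n j. A z) = (\<Sum>e\<in>steps. \<Sum>x\<in>lbox n j. \<integral>y. (G j e x (q y))\<^sup>2 \<partial>M) / real N"
      by (simp add: A_def sum.cartesian_product[symmetric] sum_divide_distrib)
    also have "real (card ((steps :: (int ^ 'm) set) \<times> (lbox n j :: (int ^ 'm) set))) = c * b j"
      by (simp add: card_cartesian_product card_steps b_def c_def)
    also have "sqrt (c * b j * ((\<Sum>e\<in>steps. \<Sum>x\<in>lbox n j. \<integral>y. (G j e x (q y))\<^sup>2 \<partial>M) / real N))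
        \<le> sqrt (c * b j * (p j * (2 * c * g) / real N))"
      using c by (intro real_sqrt_le_mono mult_left_mono divide_right_mono G2) (auto simp: b_def)
    \<comment> \<open>The factor at hand is \<open>2 * c^2\<close>; enlarging it to a perfect square
      lets the root cancel the normalisation \<open>2 * c\<close>.\<close>
    also have "\<dots> \<le> sqrt ((2 * c)\<^sup>2 * (b j * p j / real N * g))"
    proof (rule real_sqrt_le_mono)
      have "0 \<le> b j * p j / real N * g" using p0 g0 by (auto simp: b_def)
      hence "(2 * c\<^sup>2) * (b j * p j / real N * g) \<le> (4 * c\<^sup>2) * (b j * p j / real N * g)" by (intro mult_right_mono) auto
      thus "c * b j * (p j * (2 * c * g) / real N) \<le> (2 * c)\<^sup>2 * (b j * p j / real N * g)"
        by (simp add: power2_eq_square algebra_simps)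
    qed
    also have "\<dots> = sqrt (b j * p j / real N) * sqrt g * (2 * c)"
    proof -
      have "sqrt ((2 * c)\<^sup>2 * (b j * p j / real N * g)) = sqrt ((2 * c)\<^sup>2) * (sqrt (b j * p j / real N) * sqrt g)"
        by (simp only: real_sqrt_mult)
      moreover have "sqrt ((2 * c)\<^sup>2) = 2 * c" using c by (intro real_sqrt_unique) auto
      ultimately show ?thesis by (simp only: mult.commute)
    qed
    finally show ?thesis by (subst pos_divide_le_eq) (use c in simp_all)
  qed
  have EH: "(\<Sum>x\<in>lbox n j. \<integral>\<omega>. \<bar>deviation (H j x) \<omega>\<bar> \<partial>PM) \<le> sqrt (b j * p j / real N) * sqrt h" for j
  proof -
    have "(\<Sum>x\<in>lbox n j. \<integral>\<omega>. \<bar>deviation (H j x) \<omega>\<bar> \<partial>PM) \<le> (\<Sum>x\<in>lbox n j. sqrt ((\<integral>y. (H j x (q y))\<^sup>2 \<partial>M) / real N))"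
      by (intro sum_mono) (simp add: expectation_deviation)
    also have "\<dots> \<le> sqrt (real (card (lbox n j :: (int ^ 'm) set)) * (\<Sum>x\<in>lbox n j. (\<integral>y. (H j x (q y))\<^sup>2 \<partial>M) / real N))"
      by (rule sum_sqrt_le) auto
    also have "\<dots> \<le> sqrt (b j * (p j * h / real N))"
      unfolding sum_divide_distrib[symmetric] b_def
      by (intro real_sqrt_le_mono mult_left_mono divide_right_mono H2) auto
    also have "\<dots> = sqrt (b j * p j / real N) * sqrt h"
      by (subst real_sqrt_mult[symmetric]) (simp add: mult.assoc)
    finally show ?thesis .
  qed
  have "(\<integral>\<omega>. discrepancy \<omega> \<partial>PM) \<le> (\<integral>\<omega>. \<Phi> \<omega> \<partial>PM)"
    by (intro integral_mono \<Phi>int le\<Phi>) auto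
  also have "\<dots> = (\<Sum>j<J. (\<Sum>e\<in>steps. \<Sum>x\<in>lbox n j. \<integral>\<omega>. \<bar>deviation (G j e x) \<omega>\<bar> \<partial>PM) / (2 * c)
     + 2 * real (j + 1) * real n * (\<Sum>x\<in>lbox n j. \<integral>\<omega>. \<bar>deviation (H j x) \<omega>\<bar> \<partial>PM))"
    unfolding \<Phi>_def
    by (simp add: Bochner_Integration.integral_sum Bochner_Integration.integral_add deviation_integrable)
  also have "\<dots> \<le> (\<Sum>j<J. sqrt (b j * p j / real N) * sqrt g + 2 * real (j + 1) * real n * (sqrt (b j * p j / real N) * sqrt h))"
    by (intro sum_mono add_mono EG mult_left_mono EH) auto
  also have "\<dots> = (\<Sum>j<J. sqrt (b j * p j / real N) * (sqrt g + 2 * real (j + 1) * real n * sqrt h))"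
  proof (rule sum.cong[OF refl])
    have alg: "x * u + d * (x * v) = x * (u + d * v)" for x u d v :: real by (simp add: algebra_simps)
    show "sqrt (b j * p j / real N) * sqrt g + 2 * real (j + 1) * real n * (sqrt (b j * p j / real N) * sqrt h)
      = sqrt (b j * p j / real N) * (sqrt g + 2 * real (j + 1) * real n * sqrt h)" for j
      by (rule alg)
  qed
  finally show ?thesis by (simp only: b_def p_def)
qed

end

section \<open>Diagonal growth of the Green function and the resulting rate\<close>

lemma bwalk_nonneg: "bwalk t k \<ge> 0"
  by (induction t arbitrary: k) auto

lemma bwalk_0_sq_le: "(bwalk t 0)\<^sup>2 \<le> 1 / (real t + 1)"
proof (cases "even t")
  case True
  then obtain s where "t = 2 * s" by (elim evenE)
  thus ?thesis using bwalk_sq_le[of s] by simp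
next
  case False
  hence "bwalk t 0 = 0" by (intro bwalk_odd) auto
  thus ?thesis by simp
qed

lemma sum_inverse_le_ln: "(\<Sum>t<Suc k. 1 / (real t + 1)) \<le> 1 + ln (real (Suc k))"
proof (induction k)
  case (Suc k)
  have "ln ((real k + 1) / (real k + 2)) \<le> (real k + 1) / (real k + 2) - 1" by (rule ln_le_minus_one) simp
  hence "1 / (real k + 2) \<le> ln (real k + 2) - ln (real k + 1)" by (simp add: ln_div field_simps)
  thus ?case using Suc by (simp add: add.commute)
qed simp

lemma sum_inverse_squares_le: "(\<Sum>j<J. 1 / (real j + 1)\<^sup>2) \<le> 2"
proof -
  \<comment> \<open>The subtracted term carries the induction: \<open>1 / (x + 1)^2\<close> is at
    most \<open>1 / x - 1 / (x + 1)\<close>.\<close>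
  have "(\<Sum>j<Suc k. 1 / (real j + 1)\<^sup>2) \<le> 2 - 1 / (real k + 1)" for k
  proof (induction k)
    case (Suc k)
    have "1 / (real k + 2)\<^sup>2 \<le> 1 / (real k + 1) - 1 / (real k + 2)"
    proof -
      define x where "x = real k + 1"
      have x: "x > 0" by (simp add: x_def)
      have "1 / (x + 1)\<^sup>2 \<le> 1 / (x * (x + 1))"
        using x by (intro divide_left_mono) (auto simp: power2_eq_square intro!: mult_right_mono)
      also have "\<dots> = 1 / x - 1 / (x + 1)" using x by (simp add: field_simps)
      finally show ?thesis by (simp add: x_def add.commute)
    qed
    thus ?case using Suc by (simp add: add.commute)
  qed simp
  from this[of "J - 1"] show ?thesis by (cases J) (auto intro: order_trans)
qed

text \<open>For \<open>m >= 2\<close> the return probability at time \<open>t\<close> is at most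
  \<open>1 / (t + 1)\<close>. In dimension one it is only of order \<open>1 / sqrt (t + 1)\<close>,
  but \<open>t < n^2\<close> makes up the difference with one more factor \<open>n\<close>. This is
  the origin of \<open>max m 2\<close> and, through the harmonic sum, of the logarithm.\<close>

lemma sum_bwalk_le:
  fixes m n :: nat
  assumes m: "m > 0" and n: "n > 0"
  shows "real n ^ m * (\<Sum>t<n\<^sup>2. bwalk t 0 ^ m) \<le> real n ^ max m 2 * (1 + 2 * ln (real n))"
proof -
  have each: "real n ^ m * bwalk t 0 ^ m \<le> real n ^ max m 2 * (1 / (real t + 1))" if t: "t < n\<^sup>2" for t
  proof (cases "m = 1")
    case True
    have "(bwalk t 0 * (real t + 1))\<^sup>2 \<le> 1 / (real t + 1) * (real t + 1)\<^sup>2"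
      unfolding power_mult_distrib by (intro mult_right_mono bwalk_0_sq_le) auto
    also have "\<dots> = real (t + 1)" by (simp add: power2_eq_square)
    also have "\<dots> \<le> real (n\<^sup>2)" using t by (intro of_nat_mono) auto
    finally have "(bwalk t 0 * (real t + 1))\<^sup>2 \<le> (real n)\<^sup>2" by simp
    hence "bwalk t 0 * (real t + 1) \<le> real n" by (rule power2_le_imp_le) simp
    hence "real n * (bwalk t 0 * (real t + 1)) \<le> real n * real n" by (intro mult_left_mono) auto
    thus ?thesis using True by (simp add: pos_le_divide_eq power2_eq_square mult.assoc)
  next
    case False
    hence m2: "m \<ge> 2" using m by simp
    have b1: "bwalk t 0 \<le> 1"
    proof (rule power2_le_imp_le)
      have "1 / (real t + 1) \<le> 1" by simp
      thus "(bwalk t 0)\<^sup>2 \<le> 1\<^sup>2" using order_trans[OF bwalk_0_sq_le] by simp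
    qed simp
    have "bwalk t 0 ^ m \<le> (bwalk t 0)\<^sup>2"
      using m2 b1 bwalk_nonneg by (intro power_decreasing) auto
    also have "\<dots> \<le> 1 / (real t + 1)" by (rule bwalk_0_sq_le)
    finally show ?thesis using m2 by (simp only: max_absorb1) (intro mult_left_mono, auto)
  qed
  have "real n ^ m * (\<Sum>t<n\<^sup>2. bwalk t 0 ^ m) \<le> (\<Sum>t<n\<^sup>2. real n ^ max m 2 * (1 / (real t + 1)))"
    unfolding sum_distrib_left by (intro sum_mono each) auto
  also have "\<dots> = real n ^ max m 2 * (\<Sum>t<n\<^sup>2. 1 / (real t + 1))" by (simp only: sum_distrib_left)
  also have "\<dots> \<le> real n ^ max m 2 * (1 + 2 * ln (real n))"
  proof (rule mult_left_mono)
    have "Suc (n\<^sup>2 - 1) = n\<^sup>2" using n by simp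
    hence "(\<Sum>t<n\<^sup>2. 1 / (real t + 1)) \<le> 1 + ln (real (n\<^sup>2))" using sum_inverse_le_ln[of "n\<^sup>2 - 1"] by simp
    thus "(\<Sum>t<n\<^sup>2. 1 / (real t + 1)) \<le> 1 + 2 * ln (real n)" using n by (simp add: ln_realpow)
  qed simp
  finally show ?thesis .
qed

text \<open>At time \<open>2 * n^2\<close> the return probability per coordinate is at most
  \<open>1 / n\<close>: the walk has spread over distance \<open>n\<close>.\<close>

lemma bwalk_diag_le:
  assumes n: "n > 0"
  shows "real n ^ m * bwalk (2 * n\<^sup>2) 0 ^ m \<le> 1"
proof -
  have "(real n * bwalk (2 * n\<^sup>2) 0)\<^sup>2 \<le> (real n)\<^sup>2 * (1 / (real (2 * n\<^sup>2) + 1))"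
    unfolding power_mult_distrib by (intro mult_left_mono bwalk_0_sq_le) auto
  also have "\<dots> \<le> 1\<^sup>2"
  proof -
    have "(real n)\<^sup>2 \<le> real (2 * n\<^sup>2) + 1" by simp
    moreover have "real (2 * n\<^sup>2) + 1 > 0" by (simp add: add_nonneg_pos)
    ultimately show ?thesis by (simp add: pos_divide_le_eq)
  qed
  finally have "real n * bwalk (2 * n\<^sup>2) 0 \<le> 1" by (rule power2_le_imp_le) simp
  hence "(real n * bwalk (2 * n\<^sup>2) 0) ^ m \<le> 1" using bwalk_nonneg by (intro power_le_one) auto
  thus ?thesis by (simp add: power_mult_distrib)
qed

context quantised_sample
begin

text \<open>Why the exponent \<open>m + 6\<close>: the box volume uses up \<open>m\<close> powers of
  \<open>j + 1\<close>, the square root leaves a decay of order 3, one of these is spent on the tent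
  height, and a summable square remains.\<close>

lemma expectation_discrepancy_rate:
  fixes W :: real
  assumes W: "\<And>j. prob {x\<in>space M. q x \<in> shell n j} \<le> W / (real j + 1) ^ (CARD('m) + 6)"
  shows "(\<integral>\<omega>. discrepancy \<omega> \<partial>PM) \<le> 8 * real n * sqrt (7 ^ CARD('m) * W / real N) 
     * sqrt (real n ^ (max CARD('m) 2 - 2) * (1 + 2 * ln (real n)))"
proof -
  define m where "m = CARD('m)"
  have m: "m > 0" by (simp add: m_def)
  define g where "g = (\<Sum>t<n\<^sup>2. bwalk t 0 ^ m)"
  define h where "h = bwalk (2 * n\<^sup>2) 0 ^ m"
  define Y where "Y = sqrt (7 ^ m * W / real N)"
  define Z where "Z = sqrt (real n ^ (max m 2 - 2) * (1 + 2 * ln (real n)))"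
  have gh: "g \<ge> 0" "h \<ge> 0" by (auto simp: g_def h_def intro!: sum_nonneg zero_le_power bwalk_nonneg)
  have W0: "W \<ge> 0" using order_trans[OF measure_nonneg W[of 0]] by simp
  have Y0: "Y \<ge> 0" using W0 by (simp add: Y_def)
  have n1: "real n \<ge> 1" using n by simp
  have Z1: "Z \<ge> 1"
  proof -
    have "1 * 1 \<le> real n ^ (max m 2 - 2) * (1 + 2 * ln (real n))"
      using n1 by (intro mult_mono) auto
    thus ?thesis by (simp add: Z_def)
  qed
  have sg: "sqrt (real n ^ m) * sqrt g \<le> real n * Z"
  proof -
    have "real n ^ m * g \<le> real n ^ max m 2 * (1 + 2 * ln (real n))"
      unfolding g_def by (rule sum_bwalk_le[OF m n])
    also have "real n ^ max m 2 = (real n)\<^sup>2 * real n ^ (max m 2 - 2)"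
    proof -
      have "max m 2 = 2 + (max m 2 - 2)" by simp
      thus ?thesis by (metis power_add)
    qed
    finally have "sqrt (real n ^ m * g) \<le> sqrt ((real n)\<^sup>2 * (real n ^ (max m 2 - 2) * (1 + 2 * ln (real n))))"
      by (simp add: mult.assoc)
    thus ?thesis by (simp only: real_sqrt_mult Z_def real_sqrt_abs abs_of_nat)
  qed
  have sh: "sqrt (real n ^ m) * sqrt h \<le> 1"
    using bwalk_diag_le[OF n, of m] by (simp add: h_def real_sqrt_mult[symmetric])
  have summand: "sqrt (real (card (lbox n j :: (int ^ 'm) set)) * prob {x\<in>space M. q x \<in> shell n j} / real N) 
       * (sqrt g + 2 * real (j + 1) * real n * sqrt h) \<le> (4 * real n * Y * Z) * (1 / (real j + 1)\<^sup>2)" for j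
  proof -
    define J1 where "J1 = real j + 1"
    have J1: "J1 \<ge> 1" by (simp add: J1_def)
    have "card (lbox n j :: (int ^ 'm) set) \<le> (2 * (2 * (j + 1) * n + 1) + 1) ^ m"
      unfolding lbox_def m_def by (rule card_supnorm_box)
    \<comment> \<open>The 7 comes from \<open>4 * a + 3 <= 7 * a\<close> for
      \<open>a = (j + 1) * n\<close>, which is at least 1.\<close>
    also have "\<dots> \<le> (7 * ((j + 1) * n)) ^ m"
    proof (rule power_mono)
      have "1 \<le> (j + 1) * n" using n by simp
      moreover have "2 * (2 * a + 1) + 1 \<le> 7 * a" if "1 \<le> a" for a :: nat using that by simp
      ultimately show "2 * (2 * (j + 1) * n + 1) + 1 \<le> 7 * ((j + 1) * n)" by (simp only: mult.assoc)
    qed simp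
    finally have "real (card (lbox n j :: (int ^ 'm) set)) \<le> real ((7 * ((j + 1) * n)) ^ m)" by (rule of_nat_mono)
    also have "\<dots> = 7 ^ m * real n ^ m * J1 ^ m" 
    proof -
      have "real (7 * ((j + 1) * n)) = 7 * (J1 * real n)" by (simp add: J1_def algebra_simps)
      hence "real ((7 * ((j + 1) * n)) ^ m) = (7 * (J1 * real n)) ^ m" by (simp only: of_nat_power)
      thus ?thesis by (simp only: power_mult_distrib mult.assoc mult.commute[of "J1 ^ m"])
    qed
    finally have card: "real (card (lbox n j :: (int ^ 'm) set)) \<le> 7 ^ m * real n ^ m * J1 ^ m" .
    have "sqrt (real (card (lbox n j :: (int ^ 'm) set)) * prob {x\<in>space M. q x \<in> shell n j} / real N)
      \<le> sqrt (7 ^ m * real n ^ m * J1 ^ m * (W / J1 ^ (m + 6)) / real N)"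
      using W[of j] W0 J1 by (intro real_sqrt_le_mono divide_right_mono mult_mono card) (auto simp: J1_def m_def)
    also have "7 ^ m * real n ^ m * J1 ^ m * (W / J1 ^ (m + 6)) / real N = (7 ^ m * W / real N) * (real n ^ m * (1 / J1 ^ 3)\<^sup>2)"
      using J1 by (simp add: power_add field_simps flip: power_mult)
    also have "sqrt \<dots> = Y * (sqrt (real n ^ m) * (1 / J1 ^ 3))"
      using J1 by (simp only: real_sqrt_mult Y_def real_sqrt_abs) simp
    finally have 1: "sqrt (real (card (lbox n j :: (int ^ 'm) set)) * prob {x\<in>space M. q x \<in> shell n j} / real N)
      \<le> Y * (sqrt (real n ^ m) * (1 / J1 ^ 3))" .
    have "sqrt g + 2 * real (j + 1) * real n * sqrt h \<le> 2 * J1 * sqrt g + 2 * J1 * real n * sqrt h"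
    proof -
      have "1 * sqrt g \<le> 2 * J1 * sqrt g" using J1 gh by (intro mult_right_mono) auto
      thus ?thesis by (simp add: J1_def algebra_simps)
    qed
    hence "sqrt (real (card (lbox n j :: (int ^ 'm) set)) * prob {x\<in>space M. q x \<in> shell n j} / real N) 
       * (sqrt g + 2 * real (j + 1) * real n * sqrt h) \<le> (Y * (sqrt (real n ^ m) * (1 / J1 ^ 3))) * (2 * J1 * sqrt g + 2 * J1 * real n * sqrt h)"
      using gh J1 Y0 by (intro mult_mono 1) auto
    also have "\<dots> = (2 * Y / J1\<^sup>2) * (sqrt (real n ^ m) * sqrt g + real n * (sqrt (real n ^ m) * sqrt h))"
      using J1 by (simp add: divide_simps) (simp add: algebra_simps power2_eq_square power3_eq_cube)
    also have "\<dots> \<le> (2 * Y / J1\<^sup>2) * (real n * Z + real n * Z)"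
    proof -
      have "real n * (sqrt (real n ^ m) * sqrt h) \<le> real n * 1" by (intro mult_left_mono sh) auto
      also have "\<dots> \<le> real n * Z" by (intro mult_left_mono Z1) auto
      finally have "real n * (sqrt (real n ^ m) * sqrt h) \<le> real n * Z" .
      from add_mono[OF sg this] show ?thesis by (rule mult_left_mono) (use Y0 in auto)
    qed
    also have "\<dots> = (4 * real n * Y * Z) * (1 / J1\<^sup>2)" by simp
    finally show ?thesis by (simp only: J1_def)
  qed
  have "(\<integral>\<omega>. discrepancy \<omega> \<partial>PM) \<le> (\<Sum>j<J. (4 * real n * Y * Z) * (1 / (real j + 1)\<^sup>2))"
    using expectation_discrepancy_le[of "n\<^sup>2"] summand unfolding g_def h_def m_def
    by (rule order_trans[OF _ sum_mono])
  also have "\<dots> = (4 * real n * Y * Z) * (\<Sum>j<J. 1 / (real j + 1)\<^sup>2)" by (simp only: sum_distrib_left)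
  also have "\<dots> \<le> (4 * real n * Y * Z) * 2"
    using Y0 Z1 by (intro mult_left_mono sum_inverse_squares_le) auto
  finally show ?thesis by (simp add: Y_def Z_def m_def)
qed

text \<open>Chernoff's bound on top of \<open>product_mgf_bound\<close>. The factor
  \<open>N / n\<close> in \<open>F\<close> normalises the effect of one observation to
  \<open>\<beta> u + \<beta> v\<close>, in the original scale and free of \<open>N\<close>.\<close>

lemma discrepancy_concentration:
  fixes \<beta> :: "'a \<Rightarrow> real"
  assumes \<beta>: "integrable M \<beta>" "\<And>x. x \<in> space M \<Longrightarrow> supnorm (q x) \<le> real n * \<beta> x"
    and B: "B = (\<integral>x. \<beta> x \<partial>M)"
    and K: "integrable M (\<lambda>x. (\<beta> x + B)\<^sup>2 * exp (s0 * (\<beta> x + B)))"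
       "(\<integral>x. (\<beta> x + B)\<^sup>2 * exp (s0 * (\<beta> x + B)) \<partial>M) \<le> K" "K > 0"
    and t: "0 \<le> t" "t \<le> 2 * K * s0"
  shows "PM.prob {\<omega>\<in>space PM. discrepancy \<omega> \<ge> (\<integral>\<omega>. discrepancy \<omega> \<partial>PM) + real n * t} \<le> exp (- (real N * t\<^sup>2 / (4 * K)))"
proof -
  define F where "F \<omega> = (real N / real n) * discrepancy \<omega>" for \<omega>
  \<comment> \<open>The minimiser of \<open>K * s^2 - s * t\<close>; the upper bound on
    \<open>t\<close> keeps it below \<open>s0\<close>.\<close>
  define s where "s = t / (2 * K)"
  define K0 where "K0 = (\<integral>x. (\<beta> x + B)\<^sup>2 * exp (s0 * (\<beta> x + B)) \<partial>M)"
  have s: "0 \<le> s" "s \<le> s0" using t K(3) by (auto simp: s_def field_simps)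
  have [measurable]: "F \<in> borel_measurable PM" unfolding F_def by measurable
  have Fb: "\<bar>F \<omega>\<bar> \<le> (real N / real n) * (2 * (real J * real n))" if "\<omega> \<in> space PM" for \<omega>
    unfolding F_def abs_mult using that discrepancy_bound[of \<omega>] by (intro mult_mono) (auto simp: space_PiM)
  have osc: "\<bar>F (x(i := u)) - F (x(i := v))\<bar> \<le> \<beta> u + \<beta> v"
    if "x \<in> space PM" "i < N" "u \<in> space M" "v \<in> space M" for x i u v
  proof -
    have "\<bar>F (x(i := u)) - F (x(i := v))\<bar> = (real N / real n) * \<bar>discrepancy (x(i := u)) - discrepancy (x(i := v))\<bar>"
      unfolding F_def right_diff_distrib[symmetric] abs_mult by simp
    also have "\<dots> \<le> (real N / real n) * ((supnorm (q u) + supnorm (q v)) / real N)"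
      by (intro mult_left_mono discrepancy_osc that) auto
    also have "\<dots> \<le> (real N / real n) * ((real n * \<beta> u + real n * \<beta> v) / real N)"
      using \<beta>(2) that by (intro mult_left_mono divide_right_mono add_mono) auto
    also have "\<dots> = \<beta> u + \<beta> v" using n N by (simp add: field_simps)
    finally show ?thesis .
  qed
  have mgf: "(\<integral>\<omega>. exp (s * F \<omega>) \<partial>PM) \<le> exp (s * (\<integral>\<omega>. F \<omega> \<partial>PM) + real N * (K0 * s\<^sup>2))"
    by (rule product_mgf_bound[OF \<beta>(1) B K(1) K0_def s _ Fb osc]) auto
  define a where "a = (\<integral>\<omega>. F \<omega> \<partial>PM) + real N * t"
  have Fint: "(\<integral>\<omega>. F \<omega> \<partial>PM) = (real N / real n) * (\<integral>\<omega>. discrepancy \<omega> \<partial>PM)" unfolding F_def by simp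
  have "PM.prob {\<omega>\<in>space PM. exp (s * F \<omega>) \<ge> exp (s * a)} \<le> (\<integral>\<omega>. exp (s * F \<omega>) \<partial>PM) / exp (s * a)"
  proof (rule integral_Markov_inequality_measure[where A="{}"])
    show "integrable PM (\<lambda>\<omega>. exp (s * F \<omega>))"
    proof (rule PM.integrable_const_bound[of _ "exp (s * ((real N / real n) * (2 * (real J * real n))))"])
      have "s * F \<omega> \<le> s * ((real N / real n) * (2 * (real J * real n)))" if "\<omega> \<in> space PM" for \<omega>
        using Fb[OF that] s by (intro mult_left_mono) (auto simp: abs_le_iff)
      thus "AE \<omega> in PM. norm (exp (s * F \<omega>)) \<le> exp (s * ((real N / real n) * (2 * (real J * real n))))"
        by (intro AE_I2) simp
    qed measurable
  qed auto
  also have "\<dots> \<le> exp (s * (\<integral>\<omega>. F \<omega> \<partial>PM) + real N * (K0 * s\<^sup>2)) / exp (s * a)"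
    by (intro divide_right_mono mgf) auto
  also have "\<dots> = exp (real N * (K0 * s\<^sup>2) - s * real N * t)"
    by (simp add: exp_diff[symmetric] a_def algebra_simps)
  also have "\<dots> \<le> exp (- (real N * t\<^sup>2 / (4 * K)))"
  proof -
    have "real N * (K0 * s\<^sup>2) \<le> real N * (K * s\<^sup>2)" using K(2) by (intro mult_left_mono mult_right_mono) (auto simp: K0_def)
    also have "\<dots> = real N * t\<^sup>2 / (4 * K)" using K(3) by (simp add: s_def field_simps power2_eq_square)
    finally have "real N * (K0 * s\<^sup>2) - s * real N * t \<le> real N * t\<^sup>2 / (4 * K) - real N * t\<^sup>2 / (2 * K)"
      by (simp add: s_def power2_eq_square mult.commute mult.left_commute)
    also have "\<dots> = - (real N * t\<^sup>2 / (4 * K))" using K(3) by (simp add: field_simps)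
    finally show ?thesis by simp
  qed
  finally have *: "PM.prob {\<omega>\<in>space PM. exp (s * F \<omega>) \<ge> exp (s * a)} \<le> exp (- (real N * t\<^sup>2 / (4 * K)))" .
  have "PM.prob {\<omega>\<in>space PM. discrepancy \<omega> \<ge> (\<integral>\<omega>. discrepancy \<omega> \<partial>PM) + real n * t} 
    \<le> PM.prob {\<omega>\<in>space PM. exp (s * F \<omega>) \<ge> exp (s * a)}"
  proof (rule PM.finite_measure_mono)
    show "{\<omega>\<in>space PM. discrepancy \<omega> \<ge> (\<integral>\<omega>. discrepancy \<omega> \<partial>PM) + real n * t} \<subseteq> {\<omega>\<in>space PM. exp (s * F \<omega>) \<ge> exp (s * a)}"
    proof
      fix \<omega> assume "\<omega> \<in> {\<omega>\<in>space PM. discrepancy \<omega> \<ge> (\<integral>\<omega>. discrepancy \<omega> \<partial>PM) + real n * t}"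
      hence d: "\<omega> \<in> space PM" "discrepancy \<omega> \<ge> (\<integral>\<omega>. discrepancy \<omega> \<partial>PM) + real n * t" by auto
      have "a = (real N / real n) * ((\<integral>\<omega>. discrepancy \<omega> \<partial>PM) + real n * t)"
        unfolding a_def Fint using n by (simp add: field_simps)
      also have "\<dots> \<le> F \<omega>" unfolding F_def using d by (intro mult_left_mono) auto
      finally show "\<omega> \<in> {\<omega>\<in>space PM. exp (s * F \<omega>) \<ge> exp (s * a)}" using s d by (simp add: mult_left_mono)
    qed
  qed measurable
  thus ?thesis using * by linarith
qed

end

section \<open>Transport rate of the empirical measure\<close>

text \<open>Points outside the ball go to the origin so that the range is finite; moments pay for
  the displacement.\<close>

definition quantise :: "nat \<Rightarrow> nat \<Rightarrow> real ^ 'm \<Rightarrow> int ^ 'm" where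
  "quantise n R x = (if norm x \<le> real R then (\<chi> i. \<lfloor>real n * x $ i\<rfloor>) else 0)"

definition unscale :: "nat \<Rightarrow> int ^ 'm \<Rightarrow> real ^ 'm" where
  "unscale n z = (\<chi> i. real_of_int (z $ i) / real n)"

lemma norm_le_component_bound:
  fixes x :: "real ^ 'm"
  assumes "\<And>i. \<bar>x $ i\<bar> \<le> b"
  shows "norm x \<le> real CARD('m) * b"
proof -
  have "norm x \<le> (\<Sum>i\<in>UNIV. \<bar>x $ i\<bar>)" by (rule norm_le_l1_cart)
  also have "\<dots> \<le> (\<Sum>i\<in>(UNIV :: 'm set). b)" by (intro sum_mono assms)
  finally show ?thesis by simp
qed

lemma quantise_error:
  fixes x :: "real ^ 'm"
  assumes "norm x \<le> real R" "n > 0"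
  shows "norm (x - unscale n (quantise n R x)) \<le> real CARD('m) / real n"
proof -
  have "\<bar>x $ i - real_of_int \<lfloor>real n * x $ i\<rfloor> / real n\<bar> \<le> 1 / real n" for i
  proof -
    have "x $ i - real_of_int \<lfloor>real n * x $ i\<rfloor> / real n = (real n * x $ i - real_of_int \<lfloor>real n * x $ i\<rfloor>) / real n"
      using assms by (simp add: diff_divide_distrib)
    also have "\<bar>\<dots>\<bar> \<le> 1 / real n" unfolding abs_divide abs_of_nat
      by (intro divide_right_mono) (simp_all add: abs_le_iff, linarith+)
    finally show ?thesis .
  qed
  thus ?thesis using assms norm_le_component_bound[of "x - unscale n (quantise n R x)" "1 / real n"]
    by (simp add: unscale_def quantise_def)
qed

lemma unscale_0 [simp]: "unscale n 0 = 0"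
  by (simp add: unscale_def vec_eq_iff)

text \<open>Outside the ball the error is the norm itself, which is there at most its square over
  \<open>R\<close>.\<close>

lemma quantise_error_le:
  fixes x :: "real ^ 'm"
  assumes n: "n > 0" and R: "R > 0"
  shows "norm (x - unscale n (quantise n R x)) \<le> real CARD('m) / real n + (norm x)\<^sup>2 / real R"
proof (cases "norm x \<le> real R")
  case True
  have "(norm x)\<^sup>2 / real R \<ge> 0" by simp
  thus ?thesis using quantise_error[OF True n] by linarith
next
  case False
  hence "norm x * real R \<le> (norm x)\<^sup>2" unfolding power2_eq_square by (intro mult_left_mono) auto
  hence "norm x \<le> (norm x)\<^sup>2 / real R" using R by (simp add: pos_le_divide_eq)
  moreover have "real CARD('m) / real n \<ge> 0" by simp
  moreover have "norm (x - unscale n (quantise n R x)) = norm x" using False by (simp add: quantise_def)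
  ultimately show ?thesis by linarith
qed

lemma supnorm_quantise_le:
  fixes x :: "real ^ 'm"
  shows "supnorm (quantise n R x) \<le> real n * norm x + 1"
proof (cases "norm x \<le> real R")
  case True
  have "\<bar>real_of_int \<lfloor>real n * x $ i\<rfloor>\<bar> \<le> real n * norm x + 1" for i
  proof -
    have "\<bar>real_of_int \<lfloor>real n * x $ i\<rfloor>\<bar> \<le> \<bar>real n * x $ i\<bar> + 1" by linarith
    also have "\<bar>real n * x $ i\<bar> \<le> real n * norm x"
      unfolding abs_mult abs_of_nat by (intro mult_left_mono component_le_norm_cart) auto
    finally show ?thesis by simp
  qed
  thus ?thesis using True by (simp add: supnorm_le_iff quantise_def)
qed (simp add: quantise_def)

lemma supnorm_quantise_less:
  assumes "n > 0"
  shows "supnorm (quantise n R x) < real (R + 2) * real n"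
proof (cases "norm x \<le> real R")
  case True
  have "supnorm (quantise n R x) \<le> real n * norm x + 1" by (rule supnorm_quantise_le)
  also have "real n * norm x \<le> real n * real R" using True by (intro mult_left_mono) auto
  also have "real n * real R + 1 < real (R + 2) * real n" using assms by (simp add: algebra_simps)
  finally show ?thesis by simp
qed (use assms in \<open>simp add: quantise_def\<close>)

lemma norm_unscale_diff_le:
  fixes z w :: "int ^ 'm"
  shows "norm (unscale n z - unscale n w) \<le> real CARD('m) / real n * supnorm (z - w)"
proof -
  have "\<bar>(unscale n z - unscale n w) $ i\<bar> \<le> supnorm (z - w) / real n" for i
  proof -
    have "(unscale n z - unscale n w) $ i = real_of_int ((z - w) $ i) / real n"
      by (simp add: unscale_def diff_divide_distrib)
    thus ?thesis unfolding abs_divide abs_of_nat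
      by (metis abs_divide abs_of_nat component_le_supnorm divide_right_mono of_nat_0_le_iff)
  qed
  from norm_le_component_bound[OF this] show ?thesis by simp
qed

lemma quantise_measurable: "quantise n R \<in> measurable borel (count_space UNIV)"
proof (subst measurable_count_space_eq2_countable, intro conjI ballI)
  fix z :: "int ^ 'm"
  have *: "(\<lambda>x :: real ^ 'm. real n * x $ i) \<in> borel_measurable borel" for i
    by (intro borel_measurable_continuous_onI continuous_intros)
  have [measurable]: "{x :: real ^ 'm. \<lfloor>real n * x $ i\<rfloor> = z $ i} \<in> sets borel" for i
  proof -
    have "{x :: real ^ 'm. \<lfloor>real n * x $ i\<rfloor> = z $ i} = {x. real_of_int (z $ i) \<le> real n * x $ i \<and> real n * x $ i < real_of_int (z $ i) + 1}"
      by (auto simp: floor_eq_iff)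
    also have "\<dots> \<in> sets borel" using * by measurable
    finally show ?thesis .
  qed
  have "quantise n R -` {z} \<inter> space borel = 
     {x. (norm x \<le> real R \<and> (\<forall>i. \<lfloor>real n * x $ i\<rfloor> = z $ i)) \<or> (\<not> norm x \<le> real R \<and> 0 = z)}"
    by (auto simp: quantise_def vec_eq_iff split: if_splits)
  also have "\<dots> \<in> sets borel" by measurable
  finally show "quantise n R -` {z} \<inter> space borel \<in> sets borel" .
qed auto

lemma dists_onD:
  assumes "P \<in> dists_on \<Xi>"
  shows "prob_space P" "sets P = sets (restrict_space borel \<Xi>)" "space P = \<Xi>"
proof -
  show 1: "prob_space P" "sets P = sets (restrict_space borel \<Xi>)"
    using assms by (auto simp: dists_on_def space_prob_algebra)
  show "space P = \<Xi>" using sets_eq_imp_space_eq[OF 1(2)] by (simp add: space_restrict_space)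
qed

lemma measurable_on_dist:
  assumes "P \<in> dists_on \<Xi>" "f \<in> measurable borel N"
  shows "f \<in> measurable P N"
  using measurable_restrict_space1[OF assms(2), of \<Xi>] dists_onD(2)[OF assms(1)]
  by (simp cong: measurable_cong_sets)

text \<open>The truncation radius is the sample size, so that the mass lost is of order
  \<open>1 / N\<close> and a whole sample rarely leaves the ball. Rounding costs the two extra
  shells in \<open>J\<close>.\<close>

lemma quantised_sampleI:
  assumes P: "P \<in> dists_on \<Xi>" and "n > 0" "N > 0" and J: "J = N + 2"
  shows "quantised_sample P (quantise n N) n J N"
proof -
  interpret prob_space P by (rule dists_onD(1)[OF P])
  show ?thesis
  proof
    show "quantise n N \<in> measurable P (count_space UNIV)"
      by (rule measurable_on_dist[OF P quantise_measurable])
    show "supnorm (quantise n N x) < real J * real n" for x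
      unfolding J by (rule supnorm_quantise_less) fact
  qed fact+
qed

lemma empirical_dists_on:
  assumes "N > 0" "\<And>i. i < N \<Longrightarrow> \<omega> i \<in> \<Xi>"
  shows "empirical \<Xi> N \<omega> \<in> dists_on \<Xi>"
proof -
  have m: "\<omega> \<in> measurable (uniform_count_measure {..<N}) (restrict_space borel \<Xi>)"
    using assms by (auto simp: measurable_def space_restrict_space space_uniform_count_measure
        sets_uniform_count_measure)
  have "prob_space (uniform_count_measure {..<N})"
    using assms by (intro prob_space_uniform_count_measure) auto
  from prob_space.prob_space_distr[OF this m] show ?thesis
    by (simp add: dists_on_def space_prob_algebra empirical_def)
qed

lemma nn_integral_empirical_le:
  assumes N: "N > 0" "\<And>i. i < N \<Longrightarrow> \<omega> i \<in> \<Xi>" and f: "f \<in> borel_measurable (restrict_space borel \<Xi>)"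
    and b: "\<And>i. i < N \<Longrightarrow> f (\<omega> i) \<le> b"
  shows "(\<integral>\<^sup>+x. f x \<partial>empirical \<Xi> N \<omega>) \<le> b"
proof -
  have m: "\<omega> \<in> measurable (uniform_count_measure {..<N}) (restrict_space borel \<Xi>)"
    using N by (auto simp: measurable_def space_restrict_space space_uniform_count_measure
        sets_uniform_count_measure)
  interpret U: prob_space "uniform_count_measure {..<N}"
    using N by (intro prob_space_uniform_count_measure) auto
  have "(\<integral>\<^sup>+x. f x \<partial>empirical \<Xi> N \<omega>) = (\<integral>\<^sup>+i. f (\<omega> i) \<partial>uniform_count_measure {..<N})"
    unfolding empirical_def by (rule nn_integral_distr[OF m]) (use f in simp)
  also have "\<dots> \<le> (\<integral>\<^sup>+i. b \<partial>uniform_count_measure {..<N})"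
    by (intro nn_integral_mono b) (auto simp: space_uniform_count_measure)
  finally show ?thesis by (simp add: U.emeasure_space_1)
qed

text \<open>The cost is split along point, cell, partner's cell, partner. The outer legs cost about
  \<open>m / n\<close> each, plus a truncation term on the side of \<open>P\<close> only, since the
  sample lies in the ball. The middle leg is an optimal lattice plan, bounded by the discrepancy and
  rescaled by \<open>m / n\<close>, where \<open>m\<close> compares norms.\<close>

lemma empirical_coupling:
  fixes P :: "(real ^ 'm) measure"
  assumes P: "P \<in> dists_on \<Xi>" and int2: "integrable P (\<lambda>x. (norm x)\<^sup>2)"
    and n: "n > 0" and N: "N > 0" and \<omega>: "\<And>i. i < N \<Longrightarrow> \<omega> i \<in> \<Xi>" "\<And>i. i < N \<Longrightarrow> norm (\<omega> i) \<le> real N"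
  shows "\<exists>R\<in>couplings (empirical \<Xi> N \<omega>) P. (\<integral>\<^sup>+z. ennreal (norm (fst z - snd z)) \<partial>R) \<le>
     ennreal (2 * real CARD('m) / real n + real CARD('m) / real n * quantised_sample.discrepancy P (quantise n N) N \<omega>
        + (\<integral>x. (norm x)\<^sup>2 \<partial>P) / real N)"
proof -
  define m where "m = real CARD('m)"
  define E where "E = empirical \<Xi> N \<omega>"
  define q where "q = (quantise n N :: real ^ 'm \<Rightarrow> int ^ 'm)"
  define J where "J = N + 2"
  interpret Q: quantised_sample P q n J N
    unfolding q_def by (rule quantised_sampleI[OF P n N J_def])
  have E: "E \<in> dists_on \<Xi>" unfolding E_def using N \<omega>(1) by (rule empirical_dists_on)
  note PD = dists_onD[OF P] and ED = dists_onD[OF E]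
  have qm: "q \<in> measurable P (count_space UNIV)" "q \<in> measurable E (count_space UNIV)"
    unfolding q_def by (intro measurable_on_dist[OF P] measurable_on_dist[OF E] quantise_measurable)+
  have sp: "\<And>i. i < N \<Longrightarrow> \<omega> i \<in> space P" using \<omega> PD by simp
  define \<mu> where "\<mu> s = measure E {x\<in>space E. q x = s}" for s
  define \<nu> where "\<nu> s = measure P {x\<in>space P. q x = s}" for s
  have qE: "q x \<in> Q.grid" if "x \<in> space E" for x using that Q.q_grid ED PD by simp
  have sum1: "(\<Sum>s\<in>Q.grid. measure M {x\<in>space M. q x = s}) = 1"
    if "prob_space M" "q \<in> measurable M (count_space UNIV)" "\<And>x. x \<in> space M \<Longrightarrow> q x \<in> Q.grid" for M
  proof -
    interpret M: prob_space M by fact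
    have "(\<Sum>s\<in>Q.grid. ennreal (1::real) * emeasure M {x\<in>space M. q x = s}) = (\<integral>\<^sup>+x. ennreal 1 \<partial>M)"
      by (rule nn_integral_finite_range[OF Q.finite_grid that(2,3), symmetric])
    hence "ennreal (\<Sum>s\<in>Q.grid. measure M {x\<in>space M. q x = s}) = 1"
      by (simp add: M.emeasure_eq_measure sum_ennreal M.emeasure_space_1 del: sum_ennreal ennreal_1)
         (simp add: sum_ennreal M.prob_space)
    thus ?thesis by (simp add: M.prob_space)
  qed
  have w: "Q.weight \<omega> s = \<mu> s - \<nu> s" for s
  proof -
    have "{x\<in>space E. q x = s} \<in> sets (restrict_space borel \<Xi>)"
      unfolding ED(2)[symmetric] using qm(2) by measurable
    hence "measure E {x\<in>space E. q x = s} = (\<Sum>i<N. indicator {x\<in>space E. q x = s} (\<omega> i)) / real N"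
      unfolding E_def by (intro measure_empirical N \<omega>)
    also have "(\<Sum>i<N. indicator {x\<in>space E. q x = s} (\<omega> i)) = (\<Sum>i<N. of_bool (q (\<omega> i) = s) :: real)"
      using \<omega> ED by (intro sum.cong) (auto simp: indicator_def)
    finally show ?thesis by (simp add: Q.weight_def \<mu>_def \<nu>_def)
  qed
  have \<mu>1: "sum \<mu> Q.grid = 1" unfolding \<mu>_def by (rule sum1[OF ED(1) qm(2) qE])
  have \<nu>1: "sum \<nu> Q.grid = 1" unfolding \<nu>_def by (rule sum1[OF PD(1) qm(1) Q.q_grid])
  have "\<exists>\<pi>. (\<forall>x\<in>Q.grid. \<forall>y\<in>Q.grid. \<pi> x y \<ge> 0) \<and> (\<forall>x\<in>Q.grid. (\<Sum>y\<in>Q.grid. \<pi> x y) = \<mu> x) \<and>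
     (\<forall>y\<in>Q.grid. (\<Sum>x\<in>Q.grid. \<pi> x y) = \<nu> y) \<and> (\<Sum>x\<in>Q.grid. \<Sum>y\<in>Q.grid. \<pi> x y * supnorm (x - y)) \<le> Q.discrepancy \<omega>"
  proof (rule finite_kantorovich)
    show "finite Q.grid" by simp
    show "Q.grid \<noteq> {}" using \<mu>1 by auto
    show "supnorm (x - z) \<le> supnorm (x - y) + supnorm (y - z)" for x y z :: "int ^ 'm"
      using supnorm_triangle[of "x - y" "y - z"] by simp
    show "supnorm (x - y) = supnorm (y - x)" for x y :: "int ^ 'm"
      using supnorm_minus[of "x - y"] by simp
    fix g :: "int ^ 'm \<Rightarrow> real" assume g: "\<And>x y. g x - g y \<le> supnorm (x - y)"
    \<comment> \<open>Both laws have total mass one, so subtracting \<open>g 0\<close> leaves the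
      dual pairing unchanged and brings the potential into \<open>lip0\<close>.\<close>
    have "(\<lambda>x. g x - g 0) \<in> lip0" using g by (simp add: lip0_def)
    with sp have "Q.deviation (\<lambda>x. g x - g 0) \<omega> \<le> Q.discrepancy \<omega>"
      by (intro Q.deviation_le_discrepancy) auto
    moreover have "Q.deviation (\<lambda>x. g x - g 0) \<omega> = (\<Sum>s\<in>Q.grid. Q.weight \<omega> s * (g s - g 0))"
      using sp by (intro Q.deviation_eq) auto
    ultimately have "(\<Sum>s\<in>Q.grid. (\<mu> s - \<nu> s) * (g s - g 0)) \<le> Q.discrepancy \<omega>"
      by (simp only: w)
    moreover have "(\<Sum>s\<in>Q.grid. (\<mu> s - \<nu> s) * (g s - g 0)) = (\<Sum>s\<in>Q.grid. (\<mu> s - \<nu> s) * g s) - (sum \<mu> Q.grid - sum \<nu> Q.grid) * g 0"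
      by (simp only: right_diff_distrib sum_subtractf sum_distrib_right[symmetric])
    ultimately show "(\<Sum>s\<in>Q.grid. (\<mu> s - \<nu> s) * g s) \<le> Q.discrepancy \<omega>" by (simp add: \<mu>1 \<nu>1)
  qed (auto simp: \<mu>1 \<nu>1, auto simp: \<mu>_def \<nu>_def)
  then obtain \<pi> where \<pi>: "\<And>x y. x \<in> Q.grid \<Longrightarrow> y \<in> Q.grid \<Longrightarrow> \<pi> x y \<ge> 0"
      "\<And>x. x \<in> Q.grid \<Longrightarrow> (\<Sum>y\<in>Q.grid. \<pi> x y) = \<mu> x" "\<And>y. y \<in> Q.grid \<Longrightarrow> (\<Sum>x\<in>Q.grid. \<pi> x y) = \<nu> y"
      "(\<Sum>x\<in>Q.grid. \<Sum>y\<in>Q.grid. \<pi> x y * supnorm (x - y)) \<le> Q.discrepancy \<omega>"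
    by blast
  obtain R where R: "R \<in> couplings E P"
    and Rw: "\<And>w. (\<forall>s\<in>Q.grid. \<forall>t\<in>Q.grid. w s t \<ge> 0) \<Longrightarrow> 
      (\<integral>\<^sup>+z. ennreal (w (q (fst z)) (q (snd z))) \<partial>R) = ennreal (\<Sum>s\<in>Q.grid. \<Sum>t\<in>Q.grid. \<pi> s t * w s t)"
    using coupling_of_quantisation[OF ED(1) PD(1) Q.finite_grid qm(2) qE qm(1) Q.q_grid \<pi>(1)
        \<pi>(2)[unfolded \<mu>_def] \<pi>(3)[unfolded \<nu>_def]] by blast
  have setsR: "sets R = sets (E \<Otimes>\<^sub>M P)" using R by (auto simp: couplings_def space_prob_algebra)
  define e where "e x = norm (x - unscale n (q x))" for x
  have em: "(\<lambda>x. ennreal (e x)) \<in> borel_measurable borel"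
  proof -
    have "(\<lambda>x. unscale n (q x)) \<in> borel_measurable borel"
      unfolding q_def by (rule measurable_compose[OF quantise_measurable]) simp
    thus ?thesis unfolding e_def by measurable
  qed
  have emE: "(\<lambda>x. ennreal (e x)) \<in> borel_measurable E" and emP: "(\<lambda>x. ennreal (e x)) \<in> borel_measurable P"
    by (rule measurable_on_dist[OF E em], rule measurable_on_dist[OF P em])
  have mf: "(\<lambda>z. ennreal (e (fst z))) \<in> borel_measurable R" "(\<lambda>z. ennreal (e (snd z))) \<in> borel_measurable R"
    using measurable_compose[OF measurable_fst emE, of P] measurable_compose[OF measurable_snd emP, of E] setsR
    by (simp_all cong: measurable_cong_sets)
  have mq: "(\<lambda>z. ennreal (m / real n * supnorm (q (fst z) - q (snd z)))) \<in> borel_measurable R"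
  proof -
    have "(\<lambda>z. (q (fst z), q (snd z))) \<in> measurable (E \<Otimes>\<^sub>M P) (count_space UNIV \<Otimes>\<^sub>M count_space UNIV)"
      using qm by measurable
    hence "(\<lambda>z. (q (fst z), q (snd z))) \<in> measurable R (count_space UNIV)"
      using setsR by (simp add: pair_measure_countable cong: measurable_cong_sets)
    moreover have "(\<lambda>p. ennreal (m / real n * supnorm (fst p - snd p))) \<in> borel_measurable (count_space UNIV)"
      by (subst measurable_count_space_eq1) (simp only: space_borel Pi_UNIV UNIV_I)
    ultimately have "(\<lambda>z. ennreal (m / real n * supnorm (fst (q (fst z), q (snd z)) - snd (q (fst z), q (snd z))))) \<in> borel_measurable R"
      by (rule measurable_compose)
    thus ?thesis by (simp only: fst_conv snd_conv)
  qed
  have en3: "ennreal a + (ennreal b + ennreal c) = ennreal (a + (b + c))" if "0 \<le> a" "0 \<le> b" "0 \<le> c" for a b c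
    using that by simp
  have "(\<integral>\<^sup>+z. ennreal (norm (fst z - snd z)) \<partial>R) \<le> 
    (\<integral>\<^sup>+z. ennreal (e (fst z)) + (ennreal (m / real n * supnorm (q (fst z) - q (snd z))) + ennreal (e (snd z))) \<partial>R)"
  proof (rule nn_integral_mono)
    fix z :: "(real ^ 'm) \<times> (real ^ 'm)"
    define u v where "u = unscale n (q (fst z))" and "v = unscale n (q (snd z))"
    have "fst z - snd z = (fst z - u) + (u - v) - (snd z - v)" by simp
    also have "norm \<dots> \<le> norm (fst z - u) + norm (u - v) + norm (snd z - v)"
      by (rule order_trans[OF norm_triangle_ineq4 add_right_mono[OF norm_triangle_ineq]])
    also have "norm (u - v) \<le> m / real n * supnorm (q (fst z) - q (snd z))"
      unfolding u_def v_def m_def by (rule norm_unscale_diff_le)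
    finally have "norm (fst z - snd z) \<le> e (fst z) + (m / real n * supnorm (q (fst z) - q (snd z)) + e (snd z))"
      by (simp add: e_def u_def v_def)
    moreover have "0 \<le> e (fst z)" "0 \<le> e (snd z)" "0 \<le> m / real n * supnorm (q (fst z) - q (snd z))"
      by (simp_all add: e_def m_def)
    ultimately show "ennreal (norm (fst z - snd z)) \<le> ennreal (e (fst z)) + (ennreal (m / real n * supnorm (q (fst z) - q (snd z))) + ennreal (e (snd z)))"
      by (simp only: en3 ennreal_leI)
  qed
  also have "\<dots> = (\<integral>\<^sup>+z. ennreal (e (fst z)) \<partial>R) + ((\<integral>\<^sup>+z. ennreal (m / real n * supnorm (q (fst z) - q (snd z))) \<partial>R) + (\<integral>\<^sup>+z. ennreal (e (snd z)) \<partial>R))"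
    by (subst nn_integral_add[OF mf(1) borel_measurable_add[OF mq mf(2)]], subst nn_integral_add[OF mq mf(2)]) (rule refl)
  also have "(\<integral>\<^sup>+z. ennreal (e (fst z)) \<partial>R) = (\<integral>\<^sup>+x. ennreal (e x) \<partial>E)"
    by (rule couplings_nn_integral_fst[OF R emE])
  also have "(\<integral>\<^sup>+z. ennreal (e (snd z)) \<partial>R) = (\<integral>\<^sup>+x. ennreal (e x) \<partial>P)"
    by (rule couplings_nn_integral_snd[OF R emP])
  also have "(\<integral>\<^sup>+z. ennreal (m / real n * supnorm (q (fst z) - q (snd z))) \<partial>R) = 
     ennreal (\<Sum>s\<in>Q.grid. \<Sum>t\<in>Q.grid. \<pi> s t * (m / real n * supnorm (s - t)))"
    by (rule Rw) (auto simp: m_def)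
  also have "(\<Sum>s\<in>Q.grid. \<Sum>t\<in>Q.grid. \<pi> s t * (m / real n * supnorm (s - t))) = m / real n * (\<Sum>s\<in>Q.grid. \<Sum>t\<in>Q.grid. \<pi> s t * supnorm (s - t))"
    by (simp only: sum_distrib_left mult.left_commute)
  finally have bound: "(\<integral>\<^sup>+z. ennreal (norm (fst z - snd z)) \<partial>R) \<le> (\<integral>\<^sup>+x. ennreal (e x) \<partial>E) + (ennreal (m / real n * (\<Sum>s\<in>Q.grid. \<Sum>t\<in>Q.grid. \<pi> s t * supnorm (s - t))) + (\<integral>\<^sup>+x. ennreal (e x) \<partial>P))" .
  have eE: "(\<integral>\<^sup>+x. ennreal (e x) \<partial>E) \<le> ennreal (m / real n)"
    unfolding E_def
  proof (rule nn_integral_empirical_le[OF N \<omega>(1)])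
    show "(\<lambda>x. ennreal (e x)) \<in> borel_measurable (restrict_space borel \<Xi>)" by (rule measurable_restrict_space1[OF em])
    show "ennreal (e (\<omega> i)) \<le> ennreal (m / real n)" if "i < N" for i
      unfolding e_def q_def m_def by (intro ennreal_leI quantise_error \<omega> that n)
  qed
  have eP: "(\<integral>\<^sup>+x. ennreal (e x) \<partial>P) \<le> ennreal (m / real n + (\<integral>x. (norm x)\<^sup>2 \<partial>P) / real N)"
  proof -
    have "(\<integral>\<^sup>+x. ennreal (e x) \<partial>P) \<le> (\<integral>\<^sup>+x. ennreal (m / real n + (norm x)\<^sup>2 / real N) \<partial>P)"
      unfolding e_def q_def m_def by (intro nn_integral_mono ennreal_leI quantise_error_le n N)
    also have "\<dots> = ennreal (\<integral>x. m / real n + (norm x)\<^sup>2 / real N \<partial>P)"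
      using int2 by (intro nn_integral_eq_integral) (auto simp: m_def)
    also have "(\<integral>x. m / real n + (norm x)\<^sup>2 / real N \<partial>P) = m / real n + (\<integral>x. (norm x)\<^sup>2 \<partial>P) / real N"
      using int2 by (simp add: Q.prob_space)
    finally show ?thesis .
  qed
  note bound
  also have "(\<integral>\<^sup>+x. ennreal (e x) \<partial>E) + (ennreal (m / real n * (\<Sum>s\<in>Q.grid. \<Sum>t\<in>Q.grid. \<pi> s t * supnorm (s - t))) + (\<integral>\<^sup>+x. ennreal (e x) \<partial>P))
    \<le> ennreal (m / real n) + (ennreal (m / real n * (\<Sum>s\<in>Q.grid. \<Sum>t\<in>Q.grid. \<pi> s t * supnorm (s - t))) + ennreal (m / real n + (\<integral>x. (norm x)\<^sup>2 \<partial>P) / real N))"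
    by (intro add_mono eE eP order_refl)
  also have "ennreal (m / real n) + (ennreal (m / real n * (\<Sum>s\<in>Q.grid. \<Sum>t\<in>Q.grid. \<pi> s t * supnorm (s - t))) + ennreal (m / real n + (\<integral>x. (norm x)\<^sup>2 \<partial>P) / real N))
    \<le> ennreal (2 * m / real n + m / real n * Q.discrepancy \<omega> + (\<integral>x. (norm x)\<^sup>2 \<partial>P) / real N)"
  proof -
    define T where "T = (\<Sum>s\<in>Q.grid. \<Sum>t\<in>Q.grid. \<pi> s t * supnorm (s - t))"
    have T0: "T \<ge> 0" unfolding T_def using \<pi>(1) by (intro sum_nonneg mult_nonneg_nonneg) auto
    have m0: "m / real n \<ge> 0" by (simp add: m_def)
    have "m / real n * T \<le> m / real n * Q.discrepancy \<omega>" using \<pi>(4) m0 unfolding T_def by (rule mult_left_mono)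
    moreover have "(\<integral>x. (norm x)\<^sup>2 \<partial>P) / real N \<ge> 0" by simp
    ultimately have le: "m / real n + (m / real n * T + (m / real n + (\<integral>x. (norm x)\<^sup>2 \<partial>P) / real N))
        \<le> 2 * m / real n + m / real n * Q.discrepancy \<omega> + (\<integral>x. (norm x)\<^sup>2 \<partial>P) / real N" by simp
    have "ennreal (m / real n) + (ennreal (m / real n * T) + ennreal (m / real n + (\<integral>x. (norm x)\<^sup>2 \<partial>P) / real N))
      = ennreal (m / real n + (m / real n * T + (m / real n + (\<integral>x. (norm x)\<^sup>2 \<partial>P) / real N)))"
      by (rule en3) (use T0 m0 in \<open>auto intro!: mult_nonneg_nonneg simp del: times_divide_eq_left\<close>)
    thus ?thesis unfolding T_def[symmetric] using ennreal_leI[OF le] by (simp only:)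
  qed
  finally have fin: "(\<integral>\<^sup>+z. ennreal (norm (fst z - snd z)) \<partial>R) \<le> 
    ennreal (2 * m / real n + m / real n * Q.discrepancy \<omega> + (\<integral>x. (norm x)\<^sup>2 \<partial>P) / real N)" .
  show ?thesis
    using fin R unfolding E_def q_def m_def by (intro bexI[of _ R])
qed

section \<open>Exponential moments and the probability of atypical samples\<close>

lemma power_le_exp:
  fixes y :: real
  assumes "y \<ge> 0" "\<mu> > 0"
  shows "y ^ k \<le> fact k / \<mu> ^ k * exp (\<mu> * y)"
proof -
  obtain t where t: "exp (\<mu> * y) = (\<Sum>i<Suc k. ((\<mu> * y) ^ i) / fact i) + (exp t / fact (Suc k)) * (\<mu> * y) ^ Suc k"
    using Maclaurin_exp_le[of "\<mu> * y" "Suc k"] by blast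
  have "(\<mu> * y) ^ k / fact k \<le> (\<Sum>i<Suc k. ((\<mu> * y) ^ i) / fact i)"
    using assms by (simp add: sum_nonneg)
  also have "\<dots> \<le> exp (\<mu> * y)" unfolding t using assms by simp
  finally show ?thesis using assms by (simp add: power_mult_distrib field_simps)
qed

lemma power_moment_integrable:
  assumes P: "P \<in> dists_on (\<Xi> :: (real ^ 'm) set)" and l: "l > 0" and int: "integrable P (\<lambda>x. exp (l * norm x))"
    and b: "b \<ge> 0"
  shows "integrable P (\<lambda>x. (norm x + b) ^ k)"
proof -
  have ms: "(\<lambda>x. norm x) \<in> borel_measurable P" by (rule measurable_on_dist[OF P]) measurable
  show "integrable P (\<lambda>x. (norm x + b) ^ k)"
  proof (rule Bochner_Integration.integrable_bound)
    show "integrable P (\<lambda>x. fact k / l ^ k * exp (l * b) * exp (l * norm x))" using int by simp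
    show "AE x in P. norm ((norm x + b) ^ k) \<le> norm (fact k / l ^ k * exp (l * b) * exp (l * norm x))"
    proof (rule AE_I2)
      fix x
      have "(norm x + b) ^ k \<le> fact k / l ^ k * exp (l * (norm x + b))" using b l by (intro power_le_exp) auto
      also have "\<dots> = fact k / l ^ k * exp (l * b) * exp (l * norm x)" by (simp add: distrib_left exp_add)
      finally show "norm ((norm x + b) ^ k) \<le> norm (fact k / l ^ k * exp (l * b) * exp (l * norm x))"
        using b l by simp
    qed
  qed (use ms in measurable)
qed

text \<open>Only half of the available exponent stands in the weight; the other half absorbs the
  square.\<close>

lemma weighted_moment_integrable:
  assumes P: "P \<in> dists_on (\<Xi> :: (real ^ 'm) set)" and l: "l > 0" and int: "integrable P (\<lambda>x. exp (l * norm x))"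
    and b: "b \<ge> 0"
  shows "integrable P (\<lambda>x. (norm x + b)\<^sup>2 * exp (l / 2 * (norm x + b)))"
proof -
  have ms: "(\<lambda>x. norm x) \<in> borel_measurable P" by (rule measurable_on_dist[OF P]) measurable
  show "integrable P (\<lambda>x. (norm x + b)\<^sup>2 * exp (l / 2 * (norm x + b)))"
  proof (rule Bochner_Integration.integrable_bound)
    let ?C = "fact 2 / (l / 2) ^ 2 * exp (l * b)"
    show "integrable P (\<lambda>x. ?C * exp (l * norm x))" using int by simp
    show "AE x in P. norm ((norm x + b)\<^sup>2 * exp (l / 2 * (norm x + b))) \<le> norm (?C * exp (l * norm x))"
    proof (rule AE_I2)
      fix x
      have "(norm x + b)\<^sup>2 \<le> fact 2 / (l / 2) ^ 2 * exp (l / 2 * (norm x + b))" using b l by (intro power_le_exp) auto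
      hence "(norm x + b)\<^sup>2 * exp (l / 2 * (norm x + b)) \<le> fact 2 / (l / 2) ^ 2 * exp (l / 2 * (norm x + b)) * exp (l / 2 * (norm x + b))"
        by (intro mult_right_mono) auto
      also have "\<dots> = fact 2 / (l / 2) ^ 2 * exp (l / 2 * (norm x + b) + l / 2 * (norm x + b))" by (simp only: exp_add mult.assoc)
      also have "l / 2 * (norm x + b) + l / 2 * (norm x + b) = l * b + l * norm x" by (simp add: field_simps)
      also have "fact 2 / (l / 2) ^ 2 * exp (l * b + l * norm x) = ?C * exp (l * norm x)" by (simp only: exp_add mult.assoc)
      finally show "norm ((norm x + b)\<^sup>2 * exp (l / 2 * (norm x + b))) \<le> norm (?C * exp (l * norm x))"
        using b l by simp
    qed
  qed (use ms in measurable)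
qed

text \<open>Rounding moves a point by at most one unit in the original scale, so on shell
  \<open>j\<close> the norm is at least \<open>j - 1\<close>; then Markov's inequality.\<close>

lemma shell_prob_le:
  assumes P: "P \<in> dists_on (\<Xi> :: (real ^ 'm) set)" and n: "n > 0"
    and int: "integrable P (\<lambda>x. (norm x + 2) ^ k)"
  shows "measure P {x\<in>space P. quantise n R x \<in> shell n j} \<le> (\<integral>x. (norm x + 2) ^ k \<partial>P) / (real j + 1) ^ k"
proof -
  interpret prob_space P by (rule dists_onD(1)[OF P])
  have [measurable]: "(\<lambda>x. norm x) \<in> borel_measurable P" by (rule measurable_on_dist[OF P]) measurable
  have "measure P {x\<in>space P. quantise n R x \<in> shell n j} \<le> measure P {x\<in>space P. (norm x + 2) ^ k \<ge> (real j + 1) ^ k}"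
  proof (rule finite_measure_mono)
    show "{x\<in>space P. quantise n R x \<in> shell n j} \<subseteq> {x\<in>space P. (norm x + 2) ^ k \<ge> (real j + 1) ^ k}"
    proof
      fix x assume x: "x \<in> {x\<in>space P. quantise n R x \<in> shell n j}"
      hence "real j * real n \<le> real n * norm x + 1"
        using supnorm_quantise_le[of n R x] by (auto simp: shell_def)
      also have "\<dots> \<le> (norm x + 1) * real n" using n by (simp add: algebra_simps)
      finally have "real j \<le> norm x + 1" using n by (simp only: mult_le_cancel_right_pos of_nat_0_less_iff)
      thus "x \<in> {x\<in>space P. (norm x + 2) ^ k \<ge> (real j + 1) ^ k}" using x by (auto intro!: power_mono)
    qed
  qed measurable
  also have "\<dots> \<le> (\<integral>x. (norm x + 2) ^ k \<partial>P) / (real j + 1) ^ k"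
    by (rule integral_Markov_inequality_measure[OF int, where A="{}"]) auto
  finally show ?thesis .
qed

text \<open>The third moment is the right one: a union bound over \<open>N\<close> observations must
  still leave a summable \<open>1 / N^2\<close>.\<close>

lemma tail_prob_le:
  assumes P: "P \<in> dists_on (\<Xi> :: (real ^ 'm) set)" and N: "N > 0"
    and int: "integrable P (\<lambda>x. norm x ^ 3)"
  shows "measure P {x\<in>space P. norm x > real N} \<le> (\<integral>x. norm x ^ 3 \<partial>P) / real N ^ 3"
proof -
  interpret prob_space P by (rule dists_onD(1)[OF P])
  have [measurable]: "(\<lambda>x. norm x) \<in> borel_measurable P" by (rule measurable_on_dist[OF P]) measurable
  have "measure P {x\<in>space P. norm x > real N} \<le> measure P {x\<in>space P. norm x ^ 3 \<ge> real N ^ 3}"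
    by (rule finite_measure_mono) (auto intro!: power_mono)
  also have "\<dots> \<le> (\<integral>x. norm x ^ 3 \<partial>P) / real N ^ 3"
    using N by (intro integral_Markov_inequality_measure[OF int, where A="{}"]) auto
  finally show ?thesis .
qed

text \<open>The discrepancy looks at the first \<open>N\<close> coordinates only, so its law under
  the infinite product is the finite-product one, where concentration applies. A union bound adds
  the chance of leaving the truncation ball.\<close>

lemma bad_event_prob_le:
  fixes P :: "(real ^ 'm) measure"
  assumes P: "P \<in> dists_on \<Xi>" and l: "l > 0" and int: "integrable P (\<lambda>x. exp (l * norm x))"
    and n: "n > 0" and N: "N > 0"
    and B: "B = (\<integral>x. norm x + 1 \<partial>P)"
    and K: "(\<integral>x. (norm x + 1 + B)\<^sup>2 * exp (l / 2 * (norm x + 1 + B)) \<partial>P) \<le> K" "K > 0"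
    and t: "0 \<le> t" "t \<le> K * l"
  defines "D \<equiv> quantised_sample.discrepancy P (quantise n N) N"
  defines "A \<equiv> {\<omega>\<in>space (\<Pi>\<^sub>M i\<in>UNIV. P). D \<omega> \<ge> (\<integral>\<omega>. D \<omega> \<partial>(\<Pi>\<^sub>M i\<in>{..<N}. P)) + real n * t \<or> (\<exists>i<N. norm (\<omega> i) > real N)}"
  shows "A \<in> sets (\<Pi>\<^sub>M i\<in>UNIV. P)"
    and "measure (\<Pi>\<^sub>M i\<in>UNIV. P) A \<le> exp (- (real N * t\<^sup>2 / (4 * K))) + (\<integral>x. norm x ^ 3 \<partial>P) / (real N)\<^sup>2"
proof -
  interpret p: prob_space P by (rule dists_onD(1)[OF P])
  define J where "J = N + 2"
  interpret Q: quantised_sample P "quantise n N" n J N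
    by (rule quantised_sampleI[OF P n N J_def])
  interpret PP: product_prob_space "\<lambda>_. P" "UNIV :: nat set" ..
  let ?\<Omega> = "\<Pi>\<^sub>M i\<in>(UNIV :: nat set). P"
  have ms[measurable]: "(\<lambda>x. norm x) \<in> borel_measurable P" by (rule measurable_on_dist[OF P]) measurable
  have D_restrict: "D (restrict \<omega> {..<N}) = D \<omega>" for \<omega>
    by (simp add: D_def Q.discrepancy_def Q.deviation_def)
  have Dm[measurable]: "D \<in> borel_measurable (PiM {..<N} (\<lambda>_. P))" unfolding D_def by measurable
  have rm[measurable]: "(\<lambda>\<omega>. restrict \<omega> {..<N}) \<in> measurable ?\<Omega> (PiM {..<N} (\<lambda>_. P))"
    by (rule measurable_restrict_subset) simp
  define c where "c = (\<integral>\<omega>. D \<omega> \<partial>(PiM {..<N} (\<lambda>_. P))) + real n * t"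
  define A1 where "A1 = {\<omega>\<in>space (PiM {..<N} (\<lambda>_. P)). D \<omega> \<ge> c}"
  have A1m[measurable]: "A1 \<in> sets (PiM {..<N} (\<lambda>_. P))" unfolding A1_def by measurable
  define A2 where "A2 i = {\<omega>\<in>space ?\<Omega>. norm (\<omega> i) > real N}" for i
  have A2m[measurable]: "A2 i \<in> sets ?\<Omega>" for i unfolding A2_def by measurable
  let ?V = "(\<lambda>\<omega>. restrict \<omega> {..<N}) -` A1 \<inter> space ?\<Omega>"
  have Vm[measurable]: "?V \<in> sets ?\<Omega>" by (rule measurable_sets[OF rm A1m])
  have AV: "A = ?V \<union> (\<Union>i<N. A2 i)"
    using measurable_space[OF rm] by (auto simp: A_def A1_def A2_def c_def D_restrict)
  show "A \<in> sets ?\<Omega>" unfolding AV by measurable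
  have "measure ?\<Omega> A \<le> measure ?\<Omega> ?V + measure ?\<Omega> (\<Union>i<N. A2 i)"
    unfolding AV by (rule measure_Un_le) measurable
  also have "measure ?\<Omega> ?V = measure (distr ?\<Omega> (PiM {..<N} (\<lambda>_. P)) (\<lambda>\<omega>. restrict \<omega> {..<N})) A1"
    by (rule measure_distr[OF rm A1m, symmetric])
  also have "distr ?\<Omega> (PiM {..<N} (\<lambda>_. P)) (\<lambda>\<omega>. restrict \<omega> {..<N}) = PiM {..<N} (\<lambda>_. P)"
    by (rule PP.distr_PiM_restrict_finite) auto
  also have "measure (PiM {..<N} (\<lambda>_. P)) A1 \<le> exp (- (real N * t\<^sup>2 / (4 * K)))"
    unfolding A1_def c_def D_def
  proof (rule Q.discrepancy_concentration)
    show "integrable P (\<lambda>x. norm x + 1)" using power_moment_integrable[OF P l int, of 1 1] by simp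
    show "supnorm (quantise n N x) \<le> real n * (norm x + 1)" for x
      using supnorm_quantise_le[of n N x] n by (simp add: algebra_simps)
    have B0: "B \<ge> 0" unfolding B by (rule Bochner_Integration.integral_nonneg) simp
    show "integrable P (\<lambda>x. (norm x + 1 + B)\<^sup>2 * exp (l / 2 * (norm x + 1 + B)))"
      using weighted_moment_integrable[OF P l int, of "1 + B"] B0 by (simp add: add.assoc)
    show "t \<le> 2 * K * (l / 2)" using t by simp
  qed (use B K t in auto)
  also have "measure ?\<Omega> (\<Union>i<N. A2 i) \<le> (\<Sum>i<N. measure ?\<Omega> (A2 i))"
    by (rule PP.finite_measure_subadditive_finite) auto
  also have "\<dots> \<le> (\<Sum>i<N. (\<integral>x. norm x ^ 3 \<partial>P) / real N ^ 3)"
  proof (rule sum_mono)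
    fix i
    have "measure ?\<Omega> (A2 i) = measure (distr ?\<Omega> P (\<lambda>\<omega>. \<omega> i)) {x\<in>space P. norm x > real N}"
      by (subst measure_distr) (auto simp: A2_def space_PiM intro!: arg_cong[where f="measure _"])
    also have "distr ?\<Omega> P (\<lambda>\<omega>. \<omega> i) = P" by (rule PP.PiM_component) auto
    also have "measure P {x\<in>space P. norm x > real N} \<le> (\<integral>x. norm x ^ 3 \<partial>P) / real N ^ 3"
      by (rule tail_prob_le[OF P N power_moment_integrable[OF P l int, of 0 3, simplified]])
    finally show "measure ?\<Omega> (A2 i) \<le> (\<integral>x. norm x ^ 3 \<partial>P) / real N ^ 3" .
  qed
  also have "\<dots> = (\<integral>x. norm x ^ 3 \<partial>P) / (real N)\<^sup>2"
    using N by (simp add: power2_eq_square power3_eq_cube)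
  finally show "measure ?\<Omega> A \<le> exp (- (real N * t\<^sup>2 / (4 * K))) + (\<integral>x. norm x ^ 3 \<partial>P) / (real N)\<^sup>2"
    by (simp add: add_mono)
qed

section \<open>Choice of the mesh and almost sure convergence rate\<close>

definition rate :: "nat \<Rightarrow> nat \<Rightarrow> real" where
  "rate m N = (ln (real N) / real N) powr (1 / real (max m 2))"

text \<open>Once \<open>ln N >= 1\<close>, the mesh width \<open>1 / mesh\<close> lies between half
  the rate and the rate, so lattice error and fluctuation are balanced.\<close>

definition mesh :: "nat \<Rightarrow> nat \<Rightarrow> nat" where
  "mesh m N = Suc (nat \<lfloor>1 / rate m N\<rfloor>)"

lemma rate_facts:
  assumes "ln (real N) \<ge> 1"
  shows "0 < rate m N" "rate m N \<le> 1" "rate m N ^ max m 2 = ln (real N) / real N"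
    "ln (real N) / real N \<le> (rate m N)\<^sup>2" "1 / real N \<le> rate m N"
proof -
  have N: "real N > 0" using assms by (cases "N = 0") auto
  define x where "x = ln (real N) / real N"
  define p where "p = 1 / real (max m 2)"
  have p: "0 < p" "p \<le> 1 / 2" by (auto simp: p_def divide_simps)
  have x: "0 < x" "x \<le> 1" using N assms ln_le_minus_one[OF N] by (auto simp: x_def divide_simps)
  have r: "rate m N = x powr p" by (simp add: rate_def x_def p_def)
  show "0 < rate m N" using x by (simp add: r)
  show r1: "rate m N \<le> 1" using x p powr_mono2[of p x 1] by (simp add: r)
  show "rate m N ^ max m 2 = ln (real N) / real N"
  proof -
    have "rate m N ^ max m 2 = (x powr p) powr real (max m 2)"
      using x by (simp add: r powr_realpow)
    also have "\<dots> = x" using x by (simp add: powr_powr p_def)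
    finally show ?thesis by (simp add: x_def)
  qed
  show r2: "ln (real N) / real N \<le> (rate m N)\<^sup>2"
  proof -
    have "x powr (1 / 2) \<le> x powr p" using x p by (intro powr_mono') auto
    hence "(x powr (1 / 2))\<^sup>2 \<le> (x powr p)\<^sup>2" by (intro power_mono) auto
    moreover have "(x powr (1 / 2))\<^sup>2 = x" using x by (simp add: powr_half_sqrt)
    ultimately show ?thesis unfolding r by (simp only: x_def)
  qed
  have "1 / real N \<le> x" unfolding x_def using N assms by (intro divide_right_mono) auto
  also have "x \<le> (rate m N)\<^sup>2" using r2 by (simp add: x_def)
  also have "\<dots> \<le> rate m N" using r1 \<open>0 < rate m N\<close> by (simp add: power2_eq_square mult_left_le)
  finally show "1 / real N \<le> rate m N" .
qed

text \<open>As \<open>rate ^ max m 2\<close> equals \<open>ln N / N\<close>, the power of the mesh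
  cancels all but two factors of the rate.\<close>

lemma mesh_facts:
  assumes N: "ln (real N) \<ge> 1"
  shows "1 / real (mesh m N) \<le> rate m N"
    "real (mesh m N) ^ (max m 2 - 2) * (1 + 2 * ln (real (mesh m N))) / real N \<le> 5 * 2 ^ (max m 2 - 2) * (rate m N)\<^sup>2"
proof -
  note r = rate_facts[OF N, of m]
  have N0: "real N > 0" using N by (cases "N = 0") auto
  define n where "n = real (mesh m N)"
  have "real (nat \<lfloor>1 / rate m N\<rfloor>) = of_int \<lfloor>1 / rate m N\<rfloor>" using r(1) by simp
  hence n: "1 / rate m N \<le> n" "n \<le> 1 / rate m N + 1" unfolding n_def mesh_def of_nat_Suc by linarith+
  have n1: "n \<ge> 1" by (simp add: n_def mesh_def)
  show "1 / real (mesh m N) \<le> rate m N"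
    using n(1) n1 r(1) unfolding n_def[symmetric] by (simp add: field_simps)
  have "1 \<le> 1 / rate m N" using r by simp
  hence n2: "n \<le> 2 / rate m N" using n(2) by simp
  have "1 / rate m N \<le> real N" using r(1,5) N0 by (simp add: field_simps)
  hence "n \<le> 2 * real N" using n2 by simp
  hence "ln n \<le> ln (2 * real N)" using n1 by simp
  also have "\<dots> = ln 2 + ln (real N)" using N0 by (simp add: ln_mult)
  also have "ln 2 \<le> (1::real)" using ln_le_minus_one[of 2] by simp
  \<comment> \<open>The mesh is at most \<open>2 * N\<close>, so the left side is at most
    \<open>3 + 2 * ln N\<close>, hence at most \<open>5 * ln N\<close> because
    \<open>ln N >= 1\<close>.\<close>
  finally have L: "1 + 2 * ln n \<le> 5 * ln (real N)" using N by simp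
  have "n ^ (max m 2 - 2) * (1 + 2 * ln n) \<le> (2 / rate m N) ^ (max m 2 - 2) * (5 * ln (real N))"
    using n1 r(1) by (intro mult_mono power_mono n2 L) auto
  hence "n ^ (max m 2 - 2) * (1 + 2 * ln n) / real N \<le> (2 / rate m N) ^ (max m 2 - 2) * (5 * ln (real N)) / real N"
    by (rule divide_right_mono) simp
  also have "\<dots> = 5 * 2 ^ (max m 2 - 2) * ((ln (real N) / real N) / rate m N ^ (max m 2 - 2))"
    by (simp add: power_divide mult.commute)
  also have "(ln (real N) / real N) / rate m N ^ (max m 2 - 2) = (rate m N)\<^sup>2"
  proof -
    have "max m 2 = 2 + (max m 2 - 2)" by simp
    hence "rate m N ^ max m 2 = (rate m N)\<^sup>2 * rate m N ^ (max m 2 - 2)" by (metis power_add)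
    thus ?thesis using r(1) unfolding r(3)[symmetric] by simp
  qed
  finally show "real (mesh m N) ^ (max m 2 - 2) * (1 + 2 * ln (real (mesh m N))) / real N \<le> 5 * 2 ^ (max m 2 - 2) * (rate m N)\<^sup>2"
    by (simp only: n_def)
qed

text \<open>Half of \<open>\<epsilon> N\<close> covers lattice error, truncation and mean
  discrepancy, all constant multiples of the rate or smaller; the other half covers the fluctuation,
  whose probability is of order \<open>1 / N^2\<close>. Borel-Cantelli concludes.\<close>

theorem empirical_transport_rate:
  fixes P :: "(real ^ 'm) measure" and \<epsilon> :: "nat \<Rightarrow> real"
  assumes P: "P \<in> dists_on \<Xi>" and l: "l > 0" and int: "integrable P (\<lambda>x. exp (l * norm x))"
    and \<epsilon>: "\<forall>\<^sub>F N in sequentially. \<epsilon> N > 0" "\<epsilon> \<longlonglongrightarrow> 0" "(\<lambda>N. rate CARD('m) N / \<epsilon> N) \<longlonglongrightarrow> 0"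
  shows "AE \<omega> in (\<Pi>\<^sub>M i\<in>(UNIV :: nat set). P). \<forall>\<^sub>F N in sequentially.
     \<exists>R\<in>couplings (empirical \<Xi> N \<omega>) P. (\<integral>\<^sup>+z. ennreal (norm (fst z - snd z)) \<partial>R) \<le> ennreal (\<epsilon> N)"
proof -
  interpret p: prob_space P by (rule dists_onD(1)[OF P])
  interpret PP: product_prob_space "\<lambda>_. P" "UNIV :: nat set" ..
  let ?\<Omega> = "\<Pi>\<^sub>M i\<in>(UNIV :: nat set). P"
  define m where "m = real CARD('m)"
  have m: "m \<ge> 1" by (simp add: m_def Suc_leI)
  define r where "r N = rate CARD('m) N" for N
  define n where "n N = mesh CARD('m) N" for N
  have n0: "n N > 0" for N by (simp add: n_def mesh_def)
  define W where "W = (\<integral>x. (norm x + 2) ^ (CARD('m) + 6) \<partial>P)"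
  have W0: "W \<ge> 0" unfolding W_def by (rule Bochner_Integration.integral_nonneg) simp
  define V where "V = (\<integral>x. (norm x)\<^sup>2 \<partial>P)"
  have V0: "V \<ge> 0" by (simp add: V_def)
  define V3 where "V3 = (\<integral>x. norm x ^ 3 \<partial>P)"
  define B where "B = (\<integral>x. norm x + 1 \<partial>P)"
  define K where "K = (\<integral>x. (norm x + 1 + B)\<^sup>2 * exp (l / 2 * (norm x + 1 + B)) \<partial>P) + 1"
  have K: "(\<integral>x. (norm x + 1 + B)\<^sup>2 * exp (l / 2 * (norm x + 1 + B)) \<partial>P) \<le> K" "K > 0"
  proof -
    have "0 \<le> (\<integral>x. (norm x + 1 + B)\<^sup>2 * exp (l / 2 * (norm x + 1 + B)) \<partial>P)"
      by (rule Bochner_Integration.integral_nonneg) simp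
    thus "(\<integral>x. (norm x + 1 + B)\<^sup>2 * exp (l / 2 * (norm x + 1 + B)) \<partial>P) \<le> K" "K > 0"
      unfolding K_def by linarith+
  qed
  define C where "C = 8 * sqrt (7 ^ CARD('m) * W) * sqrt (5 * 2 ^ (max CARD('m) 2 - 2))"
  have C0: "C \<ge> 0" using W0 by (simp add: C_def)
  define D where "D N = quantised_sample.discrepancy P (quantise (n N) N) N" for N
  define ED where "ED N = (\<integral>\<omega>. D N \<omega> \<partial>(\<Pi>\<^sub>M i\<in>{..<N}. P))" for N
  \<comment> \<open>A fluctuation \<open>n * t\<close> of the discrepancy becomes
    \<open>m * t\<close>, half of \<open>\<epsilon>\<close>, after rescaling by
    \<open>m / n\<close>.\<close>
  define t where "t N = \<epsilon> N / (2 * m)" for N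
  define A where "A N = {\<omega>\<in>space ?\<Omega>. D N \<omega> \<ge> ED N + real (n N) * t N \<or> (\<exists>i<N. norm (\<omega> i) > real N)}" for N
  have ED_le: "ED N \<le> real (n N) * (C * r N)" if N: "ln (real N) \<ge> 1" for N
  proof -
    have N0: "N > 0" using N by (cases "N = 0") auto
    define J where "J = N + 2"
    interpret Q: quantised_sample P "quantise (n N) N" "n N" J N
      by (rule quantised_sampleI[OF P n0 N0 J_def])
    define Y where "Y = real (n N) ^ (max CARD('m) 2 - 2) * (1 + 2 * ln (real (n N)))"
    have "ED N \<le> 8 * real (n N) * sqrt (7 ^ CARD('m) * W / real N) * sqrt Y"
      unfolding ED_def D_def Y_def
      by (rule Q.expectation_discrepancy_rate)
         (unfold W_def, rule shell_prob_le[OF P n0 power_moment_integrable[OF P l int]], simp)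
    also have "sqrt (7 ^ CARD('m) * W / real N) * sqrt Y = sqrt (7 ^ CARD('m) * W) * sqrt (Y / real N)"
      by (simp add: real_sqrt_mult[symmetric])
    hence "8 * real (n N) * sqrt (7 ^ CARD('m) * W / real N) * sqrt Y = 8 * real (n N) * sqrt (7 ^ CARD('m) * W) * sqrt (Y / real N)"
      by (simp only: mult.assoc)
    also have "\<dots> \<le> 8 * real (n N) * sqrt (7 ^ CARD('m) * W) * sqrt (5 * 2 ^ (max CARD('m) 2 - 2) * (r N)\<^sup>2)"
      using mesh_facts(2)[OF N, of "CARD('m)"] W0 unfolding Y_def n_def r_def
      by (intro mult_left_mono real_sqrt_le_mono) auto
    also have "sqrt (5 * 2 ^ (max CARD('m) 2 - 2) * (r N)\<^sup>2) = sqrt (5 * 2 ^ (max CARD('m) 2 - 2)) * r N"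
      using rate_facts(1)[OF N] by (simp add: real_sqrt_mult r_def less_imp_le)
    finally show ?thesis by (simp add: C_def mult.assoc mult.left_commute)
  qed
  have small: "\<forall>\<^sub>F N in sequentially. c * r N \<le> \<epsilon> N" if c: "c > 0" for c
  proof -
    have "\<forall>\<^sub>F N in sequentially. rate CARD('m) N / \<epsilon> N < 1 / c" by (rule order_tendstoD(2)[OF \<epsilon>(3)]) (use c in simp)
    with \<epsilon>(1) show ?thesis
      by eventually_elim (use c in \<open>simp add: r_def field_simps\<close>)
  qed
  have lnN: "\<forall>\<^sub>F N in sequentially. ln (real N) \<ge> 1"
    using filterlim_compose[OF ln_at_top filterlim_real_sequentially] by (simp add: filterlim_at_top)
  have coupling: "\<forall>\<^sub>F N in sequentially. \<forall>\<omega>\<in>space ?\<Omega>. \<omega> \<notin> A N \<longrightarrow>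
     (\<exists>R\<in>couplings (empirical \<Xi> N \<omega>) P. (\<integral>\<^sup>+z. ennreal (norm (fst z - snd z)) \<partial>R) \<le> ennreal (\<epsilon> N))"
  proof -
    \<comment> \<open>Twice the total constant in front of the rate, so that these errors fill at
      most half of \<open>\<epsilon> N\<close>.\<close>
    define c where "c = 2 * (2 * m + m * C + V) "
    have c0: "c > 0" using m C0 V0 by (simp add: c_def add_pos_nonneg)
    from lnN small[OF c0] \<epsilon>(1) show ?thesis
    proof eventually_elim
      case (elim N)
      note rf = rate_facts[OF elim(1), of "CARD('m)", folded r_def] and mf = mesh_facts[OF elim(1), of "CARD('m)", folded r_def n_def]
      have N0: "N > 0" using elim by (cases "N = 0") auto
      show ?case
      proof (intro ballI impI)
        fix \<omega> assume \<omega>: "\<omega> \<in> space ?\<Omega>" "\<omega> \<notin> A N"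
        have in\<Xi>: "\<omega> i \<in> \<Xi>" for i using \<omega>(1) dists_onD(3)[OF P] by (auto simp: space_PiM)
        have bd: "norm (\<omega> i) \<le> real N" if "i < N" for i using \<omega> that by (force simp: A_def)
        have "D N \<omega> < ED N + real (n N) * t N" using \<omega> by (auto simp: A_def)
        also have "\<dots> \<le> real (n N) * (C * r N + t N)" using ED_le[OF elim(1)] by (simp add: distrib_left)
        finally have "m / real (n N) * D N \<omega> \<le> m / real (n N) * (real (n N) * (C * r N + t N))"
          using m by (intro mult_left_mono) auto
        also have "\<dots> = m * C * r N + \<epsilon> N / 2" using n0[of N] m by (simp add: t_def field_simps)
        finally have 1: "m / real (n N) * D N \<omega> \<le> m * C * r N + \<epsilon> N / 2" .
        have "2 * m * (1 / real (n N)) \<le> 2 * m * r N" using mf m by (intro mult_left_mono) auto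
        hence 2: "2 * m / real (n N) \<le> 2 * m * r N" by simp
        have "V * (1 / real N) \<le> V * r N" using rf V0 by (intro mult_left_mono) auto
        hence 3: "V / real N \<le> V * r N" by simp
        have "2 * m / real (n N) + m / real (n N) * D N \<omega> + V / real N \<le> (2 * m + m * C + V) * r N + \<epsilon> N / 2"
          using 1 2 3 by (simp add: distrib_right)
        also have "\<dots> \<le> \<epsilon> N" using elim(2) unfolding c_def by (simp only: mult.assoc)
        finally have le: "2 * m / real (n N) + m / real (n N) * D N \<omega> + V / real N \<le> \<epsilon> N" .
        have i2: "integrable P (\<lambda>x. (norm x)\<^sup>2)" using power_moment_integrable[OF P l int, of 0 2] by simp
        obtain R where R: "R \<in> couplings (empirical \<Xi> N \<omega>) P"
          "(\<integral>\<^sup>+z. ennreal (norm (fst z - snd z)) \<partial>R) \<le> ennreal (2 * m / real (n N) + m / real (n N) * D N \<omega> + V / real N)"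
        proof -
          have "\<exists>R\<in>couplings (empirical \<Xi> N \<omega>) P. (\<integral>\<^sup>+z. ennreal (norm (fst z - snd z)) \<partial>R) \<le> ennreal (2 * m / real (n N) + m / real (n N) * D N \<omega> + V / real N)"
            unfolding m_def D_def V_def by (rule empirical_coupling[OF P i2 n0 N0 in\<Xi>]) (rule bd)
          thus ?thesis using that by blast
        qed
        show "\<exists>R\<in>couplings (empirical \<Xi> N \<omega>) P. (\<integral>\<^sup>+z. ennreal (norm (fst z - snd z)) \<partial>R) \<le> ennreal (\<epsilon> N)"
          by (rule bexI[OF _ R(1)]) (rule order_trans[OF R(2) ennreal_leI[OF le]])
      qed
    qed
  qed
  have AN: "A N \<in> sets ?\<Omega>" 
    "measure ?\<Omega> (A N) \<le> exp (- (real N * (t N)\<^sup>2 / (4 * K))) + V3 / (real N)\<^sup>2" 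
    if "N > 0" "0 \<le> t N" "t N \<le> K * l" for N
    using bad_event_prob_le[OF P l int n0 that(1) B_def K that(2,3)]
    unfolding A_def ED_def D_def V3_def by blast+
  have prob: "\<forall>\<^sub>F N in sequentially. A N \<in> sets ?\<Omega> \<and> measure ?\<Omega> (A N) \<le> (1 + V3) / (real N)\<^sup>2"
  proof -
    \<comment> \<open>Chosen so that \<open>N * t^2 / (4 * K)\<close>, which is
      \<open>N * \<epsilon>^2 / (16 * m^2 * K)\<close>, is at least \<open>2 * ln N\<close>; this
      uses \<open>ln N / N <= rate^2\<close>.\<close>
    define c where "c = sqrt (32 * m\<^sup>2 * K)"
    have c0: "c > 0" using m K by (simp add: c_def)
    have "\<forall>\<^sub>F N in sequentially. \<epsilon> N < 2 * m * (K * l)"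
      by (rule order_tendstoD(2)[OF \<epsilon>(2)]) (use m K l in simp)
    from lnN small[OF c0] \<epsilon>(1) this show ?thesis
    proof eventually_elim
      case (elim N)
      note rf = rate_facts[OF elim(1), of "CARD('m)", folded r_def]
      have N0: "N > 0" using elim by (cases "N = 0") auto
      have t: "0 \<le> t N" "t N \<le> K * l" using elim m by (auto simp: t_def field_simps)
      have "(c * r N)\<^sup>2 \<le> (\<epsilon> N)\<^sup>2" using elim(2) c0 rf by (intro power_mono) auto
      hence "32 * m\<^sup>2 * K * (r N)\<^sup>2 \<le> (\<epsilon> N)\<^sup>2" using m K by (simp add: c_def power_mult_distrib)
      moreover have "32 * m\<^sup>2 * K * (ln (real N) / real N) \<le> 32 * m\<^sup>2 * K * (r N)\<^sup>2"
        using rf m K by (intro mult_left_mono) auto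
      ultimately have "32 * m\<^sup>2 * K * (ln (real N) / real N) \<le> (\<epsilon> N)\<^sup>2" by simp
      hence "32 * m\<^sup>2 * K * ln (real N) \<le> real N * (\<epsilon> N)\<^sup>2" using N0 by (simp add: field_simps)
      hence "2 * ln (real N) \<le> real N * (\<epsilon> N)\<^sup>2 / (16 * m\<^sup>2 * K)"
        using m K by (simp add: pos_le_divide_eq mult.commute mult.left_commute)
      also have "\<dots> = real N * (t N)\<^sup>2 / (4 * K)" using m K by (simp add: t_def power_divide power_mult_distrib)
      finally have "exp (- (real N * (t N)\<^sup>2 / (4 * K))) \<le> exp (- (2 * ln (real N)))" by simp
      also have "\<dots> = 1 / (real N)\<^sup>2"
      proof -
        have "exp (2 * ln (real N)) = (real N)\<^sup>2" using N0 by (simp add: exp_of_nat_mult[of 2, simplified])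
        thus ?thesis by (simp add: exp_minus inverse_eq_divide)
      qed
      finally have e: "exp (- (real N * (t N)\<^sup>2 / (4 * K))) \<le> 1 / (real N)\<^sup>2" .
      show ?case using AN[OF N0 t] e by (simp add: add_divide_distrib)
    qed
  qed
  \<comment> \<open>Borel-Cantelli asks for measurability at every \<open>N\<close>, whereas it has
    been shown only eventually.\<close>
  define A' where "A' N = (if A N \<in> sets ?\<Omega> then A N else {})" for N
  have "AE \<omega> in ?\<Omega>. \<forall>\<^sub>F N in sequentially. \<omega> \<in> space ?\<Omega> - A' N"
  proof (rule borel_cantelli_AE1)
    show "A' N \<in> sets ?\<Omega>" for N by (simp add: A'_def)
    show "emeasure ?\<Omega> (A' N) < \<infinity>" for N by (simp add: PP.emeasure_eq_measure)
    show "summable (\<lambda>N. measure ?\<Omega> (A' N))"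
    proof (rule summable_comparison_test_ev)
      show "\<forall>\<^sub>F N in sequentially. norm (measure ?\<Omega> (A' N)) \<le> (1 + V3) * (inverse (real N ^ 2))"
        using prob by eventually_elim (simp add: A'_def field_simps)
      show "summable (\<lambda>N. (1 + V3) * inverse (real N ^ 2))"
        by (intro summable_mult inverse_power_summable) simp
    qed
  qed
  thus ?thesis
  proof (rule AE_mp, intro AE_I2 impI)
    fix \<omega> assume \<omega>: "\<omega> \<in> space ?\<Omega>" and ev: "\<forall>\<^sub>F N in sequentially. \<omega> \<in> space ?\<Omega> - A' N"
    from ev coupling prob show "\<forall>\<^sub>F N in sequentially. \<exists>R\<in>couplings (empirical \<Xi> N \<omega>) P.
        (\<integral>\<^sup>+z. ennreal (norm (fst z - snd z)) \<partial>R) \<le> ennreal (\<epsilon> N)"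
      by eventually_elim (use \<omega> in \<open>auto simp: A'_def\<close>)
  qed
qed

section \<open>Ambiguity balls and sup-convolution\<close>

lemma is_norm_equivalent:
  fixes nrm :: "real ^ 'm \<Rightarrow> real"
  assumes "is_norm nrm"
  shows "\<And>x. nrm x \<ge> 0" "\<And>x y. nrm (x - y) = nrm (y - x)"
    and "\<exists>\<kappa>>0. \<forall>x. nrm x \<le> \<kappa> * norm x" "\<exists>\<kappa>>0. \<forall>x. norm x \<le> \<kappa> * nrm x"
    and "continuous_on UNIV nrm"
proof -
  have z: "nrm x = 0 \<longleftrightarrow> x = 0" and s: "nrm (c *\<^sub>R x) = \<bar>c\<bar> * nrm x" and t: "nrm (x + y) \<le> nrm x + nrm y" for c x y
    using assms by (auto simp: is_norm_def)
  have minus: "nrm (- x) = nrm x" for x using s[of "-1" x] by simp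
  show nn: "nrm x \<ge> 0" for x using t[of x "- x"] minus[of x] z[of 0] by simp
  show sym: "nrm (x - y) = nrm (y - x)" for x y using minus[of "x - y"] by simp
  define C where "C = (\<Sum>i\<in>(UNIV :: 'm set). nrm (axis i 1)) + 1"
  have C0: "C > 0" using nn by (simp add: C_def add_nonneg_pos sum_nonneg)
  have sum_le: "nrm (\<Sum>i\<in>I. f i) \<le> (\<Sum>i\<in>I. nrm (f i))" if "finite I" for I :: "'m set" and f
    using that by (induction I rule: finite_induct) (use z[of 0] in \<open>auto intro: order_trans[OF t]\<close>)
  have C: "nrm x \<le> C * norm x" for x
  proof -
    have "nrm x = nrm (\<Sum>i\<in>UNIV. x $ i *\<^sub>R axis i 1)"
      by (simp add: basis_expansion flip: scalar_mult_eq_scaleR)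
    also have "\<dots> \<le> (\<Sum>i\<in>UNIV. nrm (x $ i *\<^sub>R axis i 1))" by (rule sum_le) simp
    also have "\<dots> \<le> (\<Sum>i\<in>UNIV. norm x * nrm (axis i 1))"
      unfolding s by (intro sum_mono mult_right_mono component_le_norm_cart nn)
    also have "\<dots> \<le> C * norm x" 
      unfolding C_def sum_distrib_left[symmetric] by (simp add: distrib_right mult.commute[of "norm x"])
    finally show ?thesis .
  qed
  show "\<exists>\<kappa>>0. \<forall>x. nrm x \<le> \<kappa> * norm x" using C C0 by blast
  have lip: "\<bar>nrm x - nrm y\<bar> \<le> C * norm (x - y)" for x y
    using t[of "x - y" y] t[of "y - x" x] sym[of x y] C[of "x - y"] by simp
  have "C-lipschitz_on UNIV nrm"
    by (rule lipschitz_onI) (use lip C0 in \<open>auto simp: dist_norm\<close>)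
  thus cont: "continuous_on UNIV nrm" by (rule lipschitz_on_continuous_on)
  have "\<exists>x\<in>sphere 0 1. \<forall>y\<in>sphere (0 :: real ^ 'm) 1. nrm x \<le> nrm y"
  proof (rule continuous_attains_inf)
    have "axis undefined 1 \<in> sphere (0 :: real ^ 'm) 1" by (simp add: norm_axis_1)
    thus "sphere (0 :: real ^ 'm) 1 \<noteq> {}" by blast
  qed (auto intro: continuous_on_subset[OF cont])
  then obtain x0 where x0: "norm x0 = 1" "\<And>y. norm y = 1 \<Longrightarrow> nrm x0 \<le> nrm y" by auto
  have p: "nrm x0 > 0" using x0(1) z[of x0] nn[of x0] by force
  have "norm x \<le> 1 / nrm x0 * nrm x" for x
  proof (cases "x = 0")
    case False
    have "nrm x0 \<le> nrm ((1 / norm x) *\<^sub>R x)" using False by (intro x0) simp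
    also have "\<dots> = nrm x / norm x" by (simp add: s)
    finally show ?thesis using False p by (simp add: field_simps)
  qed (simp add: nn p less_imp_le)
  thus "\<exists>\<kappa>>0. \<forall>x. norm x \<le> \<kappa> * nrm x" using p by (intro exI[of _ "1 / nrm x0"]) auto
qed

lemma couplingsD:
  assumes "R \<in> couplings A B"
  shows "prob_space R" "sets R = sets (A \<Otimes>\<^sub>M B)" "distr R A fst = A" "distr R B snd = B"
  using assms by (auto simp: couplings_def space_prob_algebra)

lemma coupling_measurable:
  assumes A: "A \<in> dists_on \<Xi>" and B: "B \<in> dists_on (\<Xi> :: (real ^ 'm) set)" and R: "R \<in> couplings A B"
  shows "fst \<in> measurable R A" "snd \<in> measurable R B" "f \<in> borel_measurable borel \<Longrightarrow> (\<lambda>z. f (fst z - snd z)) \<in> borel_measurable R"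
proof -
  note sR = couplingsD(2)[OF R]
  show 1: "fst \<in> measurable R A" "snd \<in> measurable R B" using sR by (simp_all cong: measurable_cong_sets)
  have "(\<lambda>x. x) \<in> measurable A borel" "(\<lambda>x. x) \<in> measurable B borel"
    by (rule measurable_on_dist[OF A], simp, rule measurable_on_dist[OF B], simp)
  hence [measurable]: "fst \<in> measurable R borel" "snd \<in> measurable R borel"
    using measurable_compose[OF 1(1)] measurable_compose[OF 1(2)] by auto
  assume f: "f \<in> borel_measurable borel"
  have "(\<lambda>z. fst z - snd z) \<in> measurable R borel" by measurable
  thus "(\<lambda>z. f (fst z - snd z)) \<in> borel_measurable R" using f by (rule measurable_compose)
qed

locale transport_setting =
  fixes \<Xi> :: "(real ^ 'm) set" and nrm :: "real ^ 'm \<Rightarrow> real" and H :: "(real \<Rightarrow> real) set" and c :: real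
  assumes nrm: "is_norm nrm" and H: "H \<noteq> {}"
    and conv: "\<forall>g\<in>H. distortion g \<and> convex_on {0..1} g"
    and deriv: "\<forall>g\<in>H. \<exists>D\<le>c. (g has_real_derivative D) (at_left 1)"
begin

lemmas nrm_nonneg [simp] = is_norm_equivalent(1)[OF nrm]
lemmas nrm_sym = is_norm_equivalent(2)[OF nrm]

lemma nrm_triangle: "nrm (x + y) \<le> nrm x + nrm y"
  using nrm by (simp add: is_norm_def)

lemma nrm_borel [measurable]: "nrm \<in> borel_measurable borel"
  by (rule borel_measurable_continuous_onI[OF is_norm_equivalent(5)[OF nrm]])

lemma risk_le:
  assumes A: "A \<in> dists_on \<Xi>" and B: "B \<in> dists_on \<Xi>" and R: "R \<in> couplings A B"
  shows "risk H R (\<lambda>(x, y). nrm (x - y)) \<le> enn2ereal (ennreal (max c 0) * (\<integral>\<^sup>+z. ennreal (nrm (fst z - snd z)) \<partial>R))"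
  unfolding risk_def split_beta'
proof (rule SUP_least)
  fix g assume "g \<in> H"
  with conv deriv obtain D where "distortion g" "convex_on {0..1} g" "D \<le> c" "(g has_real_derivative D) (at_left 1)"
    by blast
  thus "distortion_integral R (\<lambda>z. nrm (fst z - snd z)) g \<le> enn2ereal (ennreal (max c 0) * (\<integral>\<^sup>+z. ennreal (nrm (fst z - snd z)) \<partial>R))"
    by (intro distortion_integral_le_nn_integral couplingsD(1)[OF R] coupling_measurable(3)[OF A B R]) auto
qed

lemma le_risk:
  assumes A: "A \<in> dists_on \<Xi>" and B: "B \<in> dists_on \<Xi>" and R: "R \<in> couplings A B"
  shows "enn2ereal (\<integral>\<^sup>+z. ennreal (nrm (fst z - snd z)) \<partial>R) \<le> risk H R (\<lambda>(x, y). nrm (x - y))"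
proof -
  obtain g where g: "g \<in> H" using H by auto
  with conv deriv obtain D where "distortion g" "convex_on {0..1} g" "(g has_real_derivative D) (at_left 1)"
    by blast
  hence "enn2ereal (\<integral>\<^sup>+z. ennreal (nrm (fst z - snd z)) \<partial>R) \<le> distortion_integral R (\<lambda>z. nrm (fst z - snd z)) g"
    by (intro nn_integral_le_distortion_integral couplingsD(1)[OF R] coupling_measurable(3)[OF A B R]) auto
  also have "\<dots> \<le> risk H R (\<lambda>(x, y). nrm (x - y))"
    unfolding risk_def split_beta' by (rule SUP_upper[OF g])
  finally show ?thesis .
qed

lemma in_transport_ballI:
  assumes A: "A \<in> dists_on \<Xi>" and B: "B \<in> dists_on \<Xi>" and R: "R \<in> couplings A B" and e: "e \<ge> 0"
    and le: "(\<integral>\<^sup>+z. ennreal (nrm (fst z - snd z)) \<partial>R) \<le> ennreal e" and c: "max c 0 * e \<le> \<epsilon>"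
  shows "B \<in> transport_ball nrm H \<Xi> \<epsilon> A"
proof -
  have "transport_dist nrm H A B \<le> risk H R (\<lambda>(x, y). nrm (x - y))"
    unfolding transport_dist_def by (rule INF_lower[OF R])
  also have "\<dots> \<le> enn2ereal (ennreal (max c 0) * (\<integral>\<^sup>+z. ennreal (nrm (fst z - snd z)) \<partial>R))"
    by (rule risk_le[OF A B R])
  also have "\<dots> \<le> enn2ereal (ennreal (max c 0) * ennreal e)"
    using le by (simp add: less_eq_ennreal.rep_eq[symmetric] mult_left_mono)
  also have "ennreal (max c 0) * ennreal e = ennreal (max c 0 * e)" using e by (intro ennreal_mult[symmetric]) auto
  also have "enn2ereal \<dots> = ereal (max c 0 * e)" using e by (intro enn2ereal_ennreal) auto
  also have "\<dots> \<le> ereal \<epsilon>" using c by simp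
  finally show ?thesis using B by (simp add: transport_ball_def)
qed

text \<open>The infimum over couplings need not be attained; the factor 2 leaves room for a nearly
  optimal one.\<close>

lemma transport_ballD:
  assumes A: "A \<in> dists_on \<Xi>" and B: "B \<in> transport_ball nrm H \<Xi> \<epsilon> A" and \<epsilon>: "\<epsilon> > 0"
  shows "B \<in> dists_on \<Xi>" "\<exists>R\<in>couplings A B. (\<integral>\<^sup>+z. ennreal (nrm (fst z - snd z)) \<partial>R) \<le> ennreal (2 * \<epsilon>)"
proof -
  show B': "B \<in> dists_on \<Xi>" using B by (simp add: transport_ball_def)
  have "transport_dist nrm H A B \<le> ereal \<epsilon>" using B by (simp add: transport_ball_def)
  also have "\<dots> < ereal (2 * \<epsilon>)" using \<epsilon> by simp
  finally obtain R where R: "R \<in> couplings A B" "risk H R (\<lambda>(x, y). nrm (x - y)) < ereal (2 * \<epsilon>)"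
    by (auto simp: transport_dist_def INF_less_iff)
  have "enn2ereal (\<integral>\<^sup>+z. ennreal (nrm (fst z - snd z)) \<partial>R) < ereal (2 * \<epsilon>)"
    using le_risk[OF A B' R(1)] R(2) by (rule le_less_trans)
  also have "\<dots> = enn2ereal (ennreal (2 * \<epsilon>))" using \<epsilon> by (simp add: enn2ereal_ennreal)
  finally have "(\<integral>\<^sup>+z. ennreal (nrm (fst z - snd z)) \<partial>R) \<le> ennreal (2 * \<epsilon>)"
    by (simp add: less_ennreal.rep_eq[symmetric] less_imp_le)
  thus "\<exists>R\<in>couplings A B. (\<integral>\<^sup>+z. ennreal (nrm (fst z - snd z)) \<partial>R) \<le> ennreal (2 * \<epsilon>)" using R(1) by blast
qed

text \<open>Members of the ball carry no moment assumption of their own; a finite transport cost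
  hands the first moment from \<open>P\<close> to the empirical measure and on to them.\<close>

lemma coupling_integrable_iff:
  assumes A: "A \<in> dists_on \<Xi>" and B: "B \<in> dists_on \<Xi>" and R: "R \<in> couplings A B"
    and le: "(\<integral>\<^sup>+z. ennreal (nrm (fst z - snd z)) \<partial>R) \<le> ennreal e"
  shows "integrable A nrm \<longleftrightarrow> integrable B nrm"
proof -
  note ms = coupling_measurable[OF A B R]
  have mA: "nrm \<in> borel_measurable A" and mB: "nrm \<in> borel_measurable B"
    by (rule measurable_on_dist[OF A nrm_borel], rule measurable_on_dist[OF B nrm_borel])
  have cost: "integrable R (\<lambda>z. nrm (fst z - snd z))"
    using le by (intro integrableI_bounded ms(3)) (auto simp: top_unique less_top intro: le_less_trans)
  have iA: "integrable A nrm \<longleftrightarrow> integrable R (\<lambda>z. nrm (fst z))"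
    using integrable_distr_eq[OF ms(1) , of nrm] mA by (simp add: couplingsD(3)[OF R])
  have iB: "integrable B nrm \<longleftrightarrow> integrable R (\<lambda>z. nrm (snd z))"
    using integrable_distr_eq[OF ms(2) , of nrm] mB by (simp add: couplingsD(4)[OF R])
  have m1: "(\<lambda>z. nrm (fst z)) \<in> borel_measurable R" "(\<lambda>z. nrm (snd z)) \<in> borel_measurable R"
    using measurable_compose[OF ms(1) mA] measurable_compose[OF ms(2) mB] by auto
  show ?thesis unfolding iA iB
  proof
    assume i: "integrable R (\<lambda>z. nrm (fst z))"
    show "integrable R (\<lambda>z. nrm (snd z))"
    proof (rule Bochner_Integration.integrable_bound[OF Bochner_Integration.integrable_add[OF i cost] m1(2)], rule AE_I2)
      fix z show "norm (nrm (snd z)) \<le> norm (nrm (fst z) + nrm (fst z - snd z))"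
        using nrm_triangle[of "fst z" "snd z - fst z"] nrm_sym[of "fst z" "snd z"] by simp
    qed
  next
    assume i: "integrable R (\<lambda>z. nrm (snd z))"
    show "integrable R (\<lambda>z. nrm (fst z))"
    proof (rule Bochner_Integration.integrable_bound[OF Bochner_Integration.integrable_add[OF i cost] m1(1)], rule AE_I2)
      fix z show "norm (nrm (fst z)) \<le> norm (nrm (snd z) + nrm (fst z - snd z))"
        using nrm_triangle[of "snd z" "fst z - snd z"] by simp
    qed
  qed
qed

lemma coupling_integral_diff_le:
  assumes A: "A \<in> dists_on \<Xi>" and B: "B \<in> dists_on \<Xi>" and R: "R \<in> couplings A B"
    and le: "(\<integral>\<^sup>+z. ennreal (nrm (fst z - snd z)) \<partial>R) \<le> ennreal e" and e: "e \<ge> 0"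
    and f: "integrable A f" "integrable B f" and lip: "\<And>x y. \<bar>f x - f y\<bar> \<le> k * nrm (x - y)" and k: "k \<ge> 0"
  shows "\<bar>(\<integral>x. f x \<partial>A) - (\<integral>x. f x \<partial>B)\<bar> \<le> k * e"
proof -
  note ms = coupling_measurable[OF A B R]
  have cost: "integrable R (\<lambda>z. nrm (fst z - snd z))"
    using le by (intro integrableI_bounded ms(3)) (auto simp: top_unique less_top intro: le_less_trans)
  have fA: "integrable R (\<lambda>z. f (fst z))" "(\<integral>x. f x \<partial>A) = (\<integral>z. f (fst z) \<partial>R)"
    using integrable_distr_eq[OF ms(1), of f] integral_distr[OF ms(1), of f] f(1) by (auto simp: couplingsD(3)[OF R])
  have fB: "integrable R (\<lambda>z. f (snd z))" "(\<integral>x. f x \<partial>B) = (\<integral>z. f (snd z) \<partial>R)"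
    using integrable_distr_eq[OF ms(2), of f] integral_distr[OF ms(2), of f] f(2) by (auto simp: couplingsD(4)[OF R])
  have "\<bar>(\<integral>x. f x \<partial>A) - (\<integral>x. f x \<partial>B)\<bar> = \<bar>\<integral>z. f (fst z) - f (snd z) \<partial>R\<bar>"
    using fA fB by simp
  also have "\<dots> \<le> (\<integral>z. \<bar>f (fst z) - f (snd z)\<bar> \<partial>R)" by (rule integral_abs_bound)
  also have "\<dots> \<le> (\<integral>z. k * nrm (fst z - snd z) \<partial>R)"
    using fA fB cost lip by (intro integral_mono) auto
  also have "\<dots> = k * (\<integral>z. nrm (fst z - snd z) \<partial>R)" by simp
  also have "(\<integral>z. nrm (fst z - snd z) \<partial>R) \<le> e"
  proof -
    have "ennreal (\<integral>z. nrm (fst z - snd z) \<partial>R) = (\<integral>\<^sup>+z. ennreal (nrm (fst z - snd z)) \<partial>R)"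
      by (rule nn_integral_eq_integral[symmetric, OF cost]) simp
    hence "ennreal (\<integral>z. nrm (fst z - snd z) \<partial>R) \<le> ennreal e" using le by (simp only:)
    thus ?thesis using e by (simp only: ennreal_le_iff)
  qed
  finally show ?thesis using k by (simp add: mult_left_mono)
qed

end

text \<open>Strict sublevel sets are relatively open, so this holds for arbitrary, even
  nonmeasurable, \<open>\<Xi>\<close>.\<close>

lemma usc_on_borel:
  fixes f :: "real ^ 'm \<Rightarrow> real"
  assumes "usc_on \<Xi> f"
  shows "f \<in> borel_measurable (restrict_space borel \<Xi>)"
proof (rule borel_measurableI_less)
  fix y :: real
  have "openin (top_of_set \<Xi>) {x\<in>\<Xi>. f x < y}"
    unfolding openin_subopen[of _ "{x\<in>\<Xi>. f x < y}"]
  proof safe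
    fix x assume x: "x \<in> \<Xi>" "f x < y"
    hence "\<forall>\<^sub>F z in at x within \<Xi>. f z < y" using assms by (auto simp: usc_on_def)
    then obtain T where T: "open T" "x \<in> T" "\<And>z. z \<in> T \<Longrightarrow> z \<noteq> x \<Longrightarrow> z \<in> \<Xi> \<Longrightarrow> f z < y"
      by (auto simp: eventually_at_topological)
    have "T \<inter> \<Xi> \<subseteq> {x\<in>\<Xi>. f x < y}" using T(3) x by force
    moreover have "openin (top_of_set \<Xi>) (T \<inter> \<Xi>)" using openin_open_Int[OF T(1), of \<Xi>] by (simp only: Int_commute)
    ultimately show "\<exists>T. openin (top_of_set \<Xi>) T \<and> x \<in> T \<and> T \<subseteq> {x\<in>\<Xi>. f x < y}" using T(2) x(1) by blast
  qed
  then obtain T where "open T" "{x\<in>\<Xi>. f x < y} = \<Xi> \<inter> T" by (auto simp: openin_open)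
  thus "{x \<in> space (restrict_space borel \<Xi>). f x < y} \<in> sets (restrict_space borel \<Xi>)"
    by (auto simp: space_restrict_space sets_restrict_space)
qed

context transport_setting
begin

definition supconv :: "(real ^ 'm \<Rightarrow> real) \<Rightarrow> real \<Rightarrow> real ^ 'm \<Rightarrow> real" where
  "supconv f k x = (SUP y\<in>\<Xi>. f y - k * nrm (x - y))"

context
  fixes f :: "real ^ 'm \<Rightarrow> real" and L :: real
  assumes \<Xi>: "\<Xi> \<noteq> {}" and L: "L \<ge> 0" and growth: "\<And>x. x \<in> \<Xi> \<Longrightarrow> \<bar>f x\<bar> \<le> L * (1 + nrm x)"
begin

text \<open>For \<open>k >= L\<close> the last term is nonpositive, which makes the supremum finite
  with a growth bound free of \<open>k\<close>, as dominated convergence requires. For larger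
  \<open>k\<close> it penalises distant points.\<close>

lemma supconv_term_le:
  assumes "y \<in> \<Xi>" shows "f y - k * nrm (x - y) \<le> L * (1 + nrm x) + (L - k) * nrm (x - y)"
proof -
  have "f y \<le> L * (1 + nrm y)" using growth[OF assms] by simp
  also have "\<dots> \<le> L * (1 + nrm x + nrm (x - y))"
    using nrm_triangle[of x "y - x"] nrm_sym[of x y] L by (intro mult_left_mono) auto
  finally show ?thesis by (simp add: algebra_simps)
qed

lemma supconv_bdd:
  assumes "k \<ge> L" shows "bdd_above ((\<lambda>y. f y - k * nrm (x - y)) ` \<Xi>)"
proof (rule bdd_aboveI2)
  fix y assume "y \<in> \<Xi>"
  from supconv_term_le[OF this, of k x] show "f y - k * nrm (x - y) \<le> L * (1 + nrm x)"
    using assms mult_nonpos_nonneg[of "L - k" "nrm (x - y)"] by simp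
qed

lemma supconv_upper: "k \<ge> L \<Longrightarrow> supconv f k x \<le> L * (1 + nrm x)"
  unfolding supconv_def
proof (rule cSUP_least[OF \<Xi>])
  fix y assume "k \<ge> L" "y \<in> \<Xi>"
  from supconv_term_le[OF this(2), of k x] show "f y - k * nrm (x - y) \<le> L * (1 + nrm x)"
    using \<open>k \<ge> L\<close> mult_nonpos_nonneg[of "L - k" "nrm (x - y)"] by simp
qed

lemma supconv_ge: "k \<ge> L \<Longrightarrow> x \<in> \<Xi> \<Longrightarrow> f x \<le> supconv f k x"
proof -
  assume k: "k \<ge> L" and x: "x \<in> \<Xi>"
  have "nrm 0 = 0" using nrm by (simp add: is_norm_def)
  moreover have "f x - k * nrm (x - x) \<le> supconv f k x"
    unfolding supconv_def by (rule cSUP_upper[OF x supconv_bdd[OF k]])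
  ultimately show ?thesis by simp
qed

lemma supconv_lipschitz:
  assumes k: "k \<ge> L"
  shows "\<bar>supconv f k x - supconv f k y\<bar> \<le> k * nrm (x - y)"
proof -
  have *: "supconv f k x \<le> supconv f k y + k * nrm (x - y)" for x y
    unfolding supconv_def[of f k x]
  proof (rule cSUP_least[OF \<Xi>])
    fix z assume z: "z \<in> \<Xi>"
    have "f z - k * nrm (y - z) \<le> supconv f k y"
      unfolding supconv_def by (rule cSUP_upper[OF z supconv_bdd[OF k]])
    moreover have "k * nrm (y - z) \<le> k * (nrm (x - z) + nrm (x - y))"
      using nrm_triangle[of "y - x" "x - z"] nrm_sym[of x y] k L by (intro mult_left_mono) auto
    ultimately show "f z - k * nrm (x - z) \<le> supconv f k y + k * nrm (x - y)" by (simp add: algebra_simps)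
  qed
  show ?thesis using *[of x y] *[of y x] nrm_sym[of x y] by (simp add: abs_le_iff)
qed

lemma supconv_abs_le:
  assumes k: "k \<ge> L" and x: "x \<in> \<Xi>"
  shows "\<bar>supconv f k x\<bar> \<le> L * (1 + nrm x)"
  using supconv_upper[OF k, of x] supconv_ge[OF k x] growth[OF x] by (simp add: abs_le_iff)

lemma supconv_borel:
  assumes k: "k \<ge> L" shows "supconv f k \<in> borel_measurable borel"
proof -
  obtain \<kappa> where \<kappa>: "\<kappa> > 0" "\<And>x. nrm x \<le> \<kappa> * norm x" using is_norm_equivalent(3)[OF nrm] by blast
  have "(k * \<kappa>)-lipschitz_on UNIV (supconv f k)"
  proof (rule lipschitz_onI)
    fix x y
    have "k * nrm (x - y) \<le> k * (\<kappa> * norm (x - y))" using k L by (intro mult_left_mono \<kappa>) auto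
    thus "dist (supconv f k x) (supconv f k y) \<le> k * \<kappa> * dist x y"
      using supconv_lipschitz[OF k, of x y] by (simp add: dist_norm dist_real_def mult.assoc)
  qed (use k L \<kappa> in auto)
  thus ?thesis by (intro borel_measurable_continuous_onI lipschitz_on_continuous_on)
qed

text \<open>Points near \<open>x\<close> contribute little more than \<open>f x\<close> by
  semicontinuity; all others are suppressed once the excess \<open>n\<close> of the penalty over
  \<open>L\<close> outweighs the linear growth.\<close>

lemma supconv_tendsto:
  assumes usc: "usc_on \<Xi> f" and x: "x \<in> \<Xi>"
  shows "(\<lambda>n. supconv f (L + real n) x) \<longlonglongrightarrow> f x"
proof (rule order_tendstoI)
  fix a assume "a < f x"
  thus "\<forall>\<^sub>F n in sequentially. a < supconv f (L + real n) x"
    using supconv_ge[of "L + real n" x for n] x by (intro always_eventually) (auto intro: less_le_trans)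
next
  fix a assume a: "a > f x"
  then obtain b where b: "f x < b" "b < a" using dense by blast
  hence "\<forall>\<^sub>F z in at x within \<Xi>. f z < b" using usc x by (auto simp: usc_on_def)
  then obtain d where d: "d > 0" "\<And>z. z \<in> \<Xi> \<Longrightarrow> z \<noteq> x \<Longrightarrow> dist z x < d \<Longrightarrow> f z < b"
    by (auto simp: eventually_at)
  obtain \<kappa> where \<kappa>: "\<kappa> > 0" "\<And>x. norm x \<le> \<kappa> * nrm x" using is_norm_equivalent(4)[OF nrm] by blast
  define e where "e = d / \<kappa>"
  have e: "e > 0" using d \<kappa> by (simp add: e_def)
  have near: "f z < b" if "z \<in> \<Xi>" "nrm (x - z) < e" for z
  proof (cases "z = x")
    case False
    have "norm (x - z) \<le> \<kappa> * nrm (x - z)" by (rule \<kappa>)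
    also have "\<dots> < d" using that(2) \<kappa>(1) by (simp add: e_def field_simps)
    finally show ?thesis using d(2)[OF that(1) False] by (simp add: dist_norm norm_minus_commute)
  qed (use b in simp)
  have "\<forall>\<^sub>F n in sequentially. real n \<ge> (L * (1 + nrm x) - b) / e"
    by (rule eventually_sequentiallyI[of "nat \<lceil>(L * (1 + nrm x) - b) / e\<rceil>"]) linarith
  thus "\<forall>\<^sub>F n in sequentially. supconv f (L + real n) x < a"
  proof eventually_elim
    case (elim n)
    have "supconv f (L + real n) x \<le> b" unfolding supconv_def
    proof (rule cSUP_least[OF \<Xi>])
      fix z assume z: "z \<in> \<Xi>"
      show "f z - (L + real n) * nrm (x - z) \<le> b"
      proof (cases "nrm (x - z) < e")
        case True
        have "(L + real n) * nrm (x - z) \<ge> 0" using L by simp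
        thus ?thesis using near[OF z True] by simp
      next
        case False
        have "L * (1 + nrm x) - b \<le> real n * e" using elim e by (simp add: field_simps)
        also have "\<dots> \<le> real n * nrm (x - z)" using False by (intro mult_left_mono) auto
        finally show ?thesis using supconv_term_le[OF z, of "L + real n" x] by simp
      qed
    qed
    thus ?case using b by simp
  qed
qed

lemma growth_integrable:
  assumes Q: "Q \<in> dists_on \<Xi>" "integrable Q nrm" and g: "g \<in> borel_measurable Q" "\<And>x. x \<in> \<Xi> \<Longrightarrow> \<bar>g x\<bar> \<le> L * (1 + nrm x)"
  shows "integrable Q g"
proof (rule Bochner_Integration.integrable_bound)
  interpret prob_space Q by (rule dists_onD(1)[OF Q(1)])
  show "integrable Q (\<lambda>x. L * (1 + nrm x))" using Q(2) by simp
  show "AE x in Q. norm (g x) \<le> norm (L * (1 + nrm x))"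
    using g(2) dists_onD(3)[OF Q(1)] L by (intro AE_I2) auto
qed (rule g)

lemma integral_supconv_tendsto:
  assumes usc: "usc_on \<Xi> f" and P: "P \<in> dists_on \<Xi>" "integrable P nrm"
  shows "(\<lambda>n. \<integral>x. supconv f (L + real n) x \<partial>P) \<longlonglongrightarrow> (\<integral>x. f x \<partial>P)"
proof (rule integral_dominated_convergence)
  interpret prob_space P by (rule dists_onD(1)[OF P(1)])
  show "f \<in> borel_measurable P"
    using usc_on_borel[OF usc] dists_onD(2)[OF P(1)] by (simp cong: measurable_cong_sets)
  show "supconv f (L + real n) \<in> borel_measurable P" for n
    by (rule measurable_on_dist[OF P(1) supconv_borel]) simp
  show "integrable P (\<lambda>x. L * (1 + nrm x))" using P(2) by simp
  show "AE x in P. (\<lambda>n. supconv f (L + real n) x) \<longlonglongrightarrow> f x"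
    using supconv_tendsto[OF usc] dists_onD(3)[OF P(1)] by (intro AE_I2) auto
  show "AE x in P. norm (supconv f (L + real n) x) \<le> L * (1 + nrm x)" for n
    using supconv_abs_le[of "L + real n"] dists_onD(3)[OF P(1)] by (intro AE_I2) auto
qed

text \<open>The empirical measure is the intermediate station: the Lipschitz majorant is compared
  between \<open>Q\<close> and \<open>E\<close> at cost \<open>2 * \<epsilon>\<close>, then between
  \<open>E\<close> and \<open>P\<close> at cost \<open>e\<close>.\<close>

lemma integral_le_of_ball:
  assumes usc: "usc_on \<Xi> f" and P: "P \<in> dists_on \<Xi>" "integrable P nrm"
    and E: "E \<in> dists_on \<Xi>" and R: "R \<in> couplings E P" "(\<integral>\<^sup>+z. ennreal (nrm (fst z - snd z)) \<partial>R) \<le> ennreal e" "e \<ge> 0"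
    and Q: "Q \<in> transport_ball nrm H \<Xi> \<epsilon> E" and \<epsilon>: "\<epsilon> > 0"
  shows "(\<integral>x. f x \<partial>Q) \<le> (\<integral>x. supconv f (L + real n) x \<partial>P) + (L + real n) * (e + 2 * \<epsilon>)"
proof -
  let ?g = "supconv f (L + real n)"
  note QD = transport_ballD[OF E Q \<epsilon>]
  obtain R' where R': "R' \<in> couplings E Q" "(\<integral>\<^sup>+z. ennreal (nrm (fst z - snd z)) \<partial>R') \<le> ennreal (2 * \<epsilon>)"
    using QD(2) by blast
  have iE: "integrable E nrm" using coupling_integrable_iff[OF E P(1) R(1,2)] P(2) by simp
  have iQ: "integrable Q nrm" using coupling_integrable_iff[OF E QD(1) R'] iE by simp
  have g: "integrable M ?g" if "M \<in> dists_on \<Xi>" "integrable M nrm" for M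
    by (rule growth_integrable[OF that measurable_on_dist[OF that(1) supconv_borel]]) (auto intro: supconv_abs_le)
  have fQ: "integrable Q f"
    by (rule growth_integrable[OF QD(1) iQ _ growth])
       (use usc_on_borel[OF usc] dists_onD(2)[OF QD(1)] in \<open>simp cong: measurable_cong_sets\<close>)
  have "(\<integral>x. f x \<partial>Q) \<le> (\<integral>x. ?g x \<partial>Q)"
    using dists_onD(3)[OF QD(1)] by (intro integral_mono fQ g QD(1) iQ supconv_ge) auto
  moreover have "\<bar>(\<integral>x. ?g x \<partial>E) - (\<integral>x. ?g x \<partial>Q)\<bar> \<le> (L + real n) * (2 * \<epsilon>)"
    using \<epsilon> L by (intro coupling_integral_diff_le[OF E QD(1) R'] g E iE QD(1) iQ supconv_lipschitz) auto
  moreover have "\<bar>(\<integral>x. ?g x \<partial>E) - (\<integral>x. ?g x \<partial>P)\<bar> \<le> (L + real n) * e"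
    using R(3) L by (intro coupling_integral_diff_le[OF E P(1) R(1,2)] g E iE P supconv_lipschitz) auto
  ultimately show ?thesis by (simp add: abs_le_iff distrib_left)
qed

text \<open>The order of limits matters: the regularisation index is fixed first, by the strict
  inequality for \<open>y\<close>, and its Lipschitz constant is then beaten by the shrinking
  radii.\<close>

lemma worst_case_eventually_le:
  assumes usc: "usc_on \<Xi> f" and P: "P \<in> dists_on \<Xi>" "integrable P nrm"
    and E: "\<forall>\<^sub>F N in sequentially. E N \<in> dists_on \<Xi> \<and> (\<exists>R\<in>couplings (E N) P. (\<integral>\<^sup>+z. ennreal (nrm (fst z - snd z)) \<partial>R) \<le> ennreal (e N))"
    and e: "\<forall>\<^sub>F N in sequentially. 0 \<le> e N" "e \<longlonglongrightarrow> 0"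
    and \<epsilon>: "\<forall>\<^sub>F N in sequentially. 0 < \<epsilon> N" "\<epsilon> \<longlonglongrightarrow> 0" and y: "(\<integral>x. f x \<partial>P) < y"
  shows "\<forall>\<^sub>F N in sequentially. \<forall>Q\<in>transport_ball nrm H \<Xi> (\<epsilon> N) (E N). (\<integral>x. f x \<partial>Q) \<le> y"
proof -
  have "\<forall>\<^sub>F n in sequentially. (\<integral>x. supconv f (L + real n) x \<partial>P) < y"
    by (rule order_tendstoD(2)[OF integral_supconv_tendsto[OF usc P] y])
  then obtain n where n: "(\<integral>x. supconv f (L + real n) x \<partial>P) < y" by (auto simp: eventually_sequentially)
  have "(\<lambda>N. (\<integral>x. supconv f (L + real n) x \<partial>P) + (L + real n) * (e N + 2 * \<epsilon> N)) \<longlonglongrightarrow> (\<integral>x. supconv f (L + real n) x \<partial>P) + (L + real n) * (0 + 2 * 0)"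
    by (intro tendsto_intros e \<epsilon>)
  hence "\<forall>\<^sub>F N in sequentially. (\<integral>x. supconv f (L + real n) x \<partial>P) + (L + real n) * (e N + 2 * \<epsilon> N) < y"
    by (rule order_tendstoD(2)) (use n in simp)
  from this E e(1) \<epsilon>(1) show ?thesis
  proof eventually_elim
    case (elim N)
    then obtain R where R: "R \<in> couplings (E N) P" "(\<integral>\<^sup>+z. ennreal (nrm (fst z - snd z)) \<partial>R) \<le> ennreal (e N)" by blast
    show ?case
    proof
      fix Q assume "Q \<in> transport_ball nrm H \<Xi> (\<epsilon> N) (E N)"
      hence "(\<integral>x. f x \<partial>Q) \<le> (\<integral>x. supconv f (L + real n) x \<partial>P) + (L + real n) * (e N + 2 * \<epsilon> N)"
        using elim by (intro integral_le_of_ball[OF usc P _ R]) auto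
      thus "(\<integral>x. f x \<partial>Q) \<le> y" using elim(1) by simp
    qed
  qed
qed

end

end

section \<open>Asymptotics of the radii, moments of the reference law, and both parts of the
  statement\<close>

lemma radius_facts:
  fixes k :: "nat \<Rightarrow> real"
  assumes k: "\<forall>N\<ge>1. k N > 0" and \<delta>: "\<delta> < 1" "(\<lambda>N. k N / real N powr \<delta>) \<longlonglongrightarrow> 0"
    and ln: "(\<lambda>N. ln (real N) / k N) \<longlonglongrightarrow> 0"
  shows "\<forall>\<^sub>F N in sequentially. radius m k N > 0" "radius m k \<longlonglongrightarrow> 0" "(\<lambda>N. rate m N / radius m k N) \<longlonglongrightarrow> 0"
proof -
  have N1: "\<forall>\<^sub>F N in sequentially. N \<ge> (1 :: nat)" by (rule eventually_ge_at_top)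
  define p where "p = 1 / real (max m 2)"
  have p: "p > 0" by (simp add: p_def)
  show "\<forall>\<^sub>F N in sequentially. radius m k N > 0"
    using N1
  proof eventually_elim
    case (elim N)
    hence "k N / real N > 0" using k by simp
    thus ?case unfolding radius_def by (simp only: powr_gt_zero)
  qed
  have tendsto_powr: "(\<lambda>N. u N powr p) \<longlonglongrightarrow> 0" if "u \<longlonglongrightarrow> 0" "\<forall>\<^sub>F N in sequentially. u N \<ge> 0" for u :: "nat \<Rightarrow> real"
    using tendsto_zero_powrI[OF that(1) tendsto_const[of p] that(2)] p by simp
  have "(\<lambda>N. real N powr (\<delta> - 1)) \<longlonglongrightarrow> 0"
    using tendsto_neg_powr[OF _ filterlim_real_sequentially, of "\<delta> - 1"] \<delta>(1) by simp
  from tendsto_mult[OF \<delta>(2) this]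
  have "(\<lambda>N. k N / real N powr \<delta> * real N powr (\<delta> - 1)) \<longlonglongrightarrow> 0" by simp
  moreover have "\<forall>\<^sub>F N in sequentially. k N / real N powr \<delta> * real N powr (\<delta> - 1) = k N / real N"
    using N1
  proof eventually_elim
    case (elim N)
    thus ?case by (simp add: powr_diff)
  qed
  ultimately have "(\<lambda>N. k N / real N) \<longlonglongrightarrow> 0" by (rule Lim_transform_eventually)
  moreover have "\<forall>\<^sub>F N in sequentially. k N / real N \<ge> 0"
    using N1 by eventually_elim (use k in \<open>simp add: less_imp_le\<close>)
  ultimately have "(\<lambda>N. (k N / real N) powr p) \<longlonglongrightarrow> 0" by (rule tendsto_powr)
  moreover have "radius m k = (\<lambda>N. (k N / real N) powr p)" by (simp add: fun_eq_iff radius_def p_def)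
  ultimately show "radius m k \<longlonglongrightarrow> 0" by (simp only:)
  have "\<forall>\<^sub>F N in sequentially. ln (real N) / k N \<ge> 0"
    using N1 by eventually_elim (use k in \<open>simp add: less_imp_le\<close>)
  from tendsto_powr[OF ln this] have "(\<lambda>N. (ln (real N) / k N) powr p) \<longlonglongrightarrow> 0" .
  moreover have "\<forall>\<^sub>F N in sequentially. (ln (real N) / k N) powr p = rate m N / radius m k N"
    using N1
  proof eventually_elim
    case (elim N)
    hence "k N > 0" using k by simp
    hence "ln (real N) / k N = (ln (real N) / real N) / (k N / real N)" using elim by simp
    thus ?case using elim \<open>k N > 0\<close>
      by (simp add: rate_def radius_def p_def[symmetric] powr_divide[symmetric])
  qed
  ultimately show "(\<lambda>N. rate m N / radius m k N) \<longlonglongrightarrow> 0" by (rule Lim_transform_eventually)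
qed

text \<open>A nonnegative \<open>y\<close> is at most \<open>1 + y powr a\<close>, and norms are
  equivalent.\<close>

lemma exp_norm_integrable:
  fixes nrm :: "real ^ 'm \<Rightarrow> real"
  assumes nrm: "is_norm nrm" and P: "P \<in> dists_on \<Xi>" and a: "a > 1" and int: "integrable P (\<lambda>x. exp (nrm x powr a))"
  shows "\<exists>l>0. integrable P (\<lambda>x. exp (l * norm x))"
proof -
  obtain \<kappa> where \<kappa>: "\<kappa> > 0" "\<And>x. norm x \<le> \<kappa> * nrm x" using is_norm_equivalent(4)[OF nrm] by blast
  have "integrable P (\<lambda>x. exp (1 / \<kappa> * norm x))"
  proof (rule Bochner_Integration.integrable_bound)
    show "integrable P (\<lambda>x. exp 1 * exp (nrm x powr a))" using int by simp
    show "(\<lambda>x. exp (1 / \<kappa> * norm x)) \<in> borel_measurable P" by (rule measurable_on_dist[OF P]) measurable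
    show "AE x in P. norm (exp (1 / \<kappa> * norm x)) \<le> norm (exp 1 * exp (nrm x powr a))"
    proof (rule AE_I2)
      fix x
      have "1 / \<kappa> * norm x \<le> nrm x" using \<kappa>(1) \<kappa>(2)[of x] by (simp add: field_simps)
      also have "nrm x \<le> 1 + nrm x powr a"
      proof (cases "nrm x \<le> 1")
        case False
        hence "nrm x powr 1 \<le> nrm x powr a" using a by (intro powr_mono) auto
        thus ?thesis using False by simp
      next
        case True
        have "nrm x powr a \<ge> 0" by simp
        thus ?thesis using True by linarith
      qed
      finally have "exp (1 / \<kappa> * norm x) \<le> exp (1 + nrm x powr a)" by (simp only: exp_le_cancel_iff)
      thus "norm (exp (1 / \<kappa> * norm x)) \<le> norm (exp 1 * exp (nrm x powr a))" by (simp add: exp_add)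
    qed
  qed
  thus ?thesis using \<kappa>(1) by (intro exI[of _ "1 / \<kappa>"]) auto
qed

lemma nrm_integrable:
  fixes nrm :: "real ^ 'm \<Rightarrow> real"
  assumes nrm: "is_norm nrm" and P: "P \<in> dists_on \<Xi>" and l: "l > 0" and int: "integrable P (\<lambda>x. exp (l * norm x))"
  shows "integrable P nrm"
proof -
  obtain \<kappa> where \<kappa>: "\<kappa> > 0" "\<And>x. nrm x \<le> \<kappa> * norm x" using is_norm_equivalent(3)[OF nrm] by blast
  show ?thesis
  proof (rule Bochner_Integration.integrable_bound)
    show "integrable P (\<lambda>x. \<kappa> * norm x)" using power_moment_integrable[OF P l int, of 0 1] by simp
    show "nrm \<in> borel_measurable P"
      by (rule measurable_on_dist[OF P borel_measurable_continuous_onI[OF is_norm_equivalent(5)[OF nrm]]])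
    show "AE x in P. norm (nrm x) \<le> norm (\<kappa> * norm x)"
      using \<kappa> is_norm_equivalent(1)[OF nrm] by (intro AE_I2) simp
  qed
qed

text \<open>Fatou needs nonnegative functions; adding the integrable growth bound \<open>b\<close>
  provides them and shifts both sides by the same constant.\<close>

lemma (in transport_setting) integral_lsc_limit_le:
  fixes h :: "'b::topological_space \<Rightarrow> real ^ 'm \<Rightarrow> real"
  assumes P: "P \<in> dists_on \<Xi>" "integrable P nrm" and L: "L \<ge> 0"
    and usc: "\<And>x. x \<in> X \<Longrightarrow> usc_on \<Xi> (h x)"
    and growth: "\<And>x \<xi>. x \<in> X \<Longrightarrow> \<xi> \<in> \<Xi> \<Longrightarrow> \<bar>h x \<xi>\<bar> \<le> L * (1 + nrm \<xi>)"
    and lsc: "\<And>\<xi>. \<xi> \<in> \<Xi> \<Longrightarrow> lsc_on X (\<lambda>x. h x \<xi>)"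
    and z: "\<And>i. z i \<in> X" "z \<longlonglongrightarrow> x" "x \<in> X"
    and y: "\<forall>\<^sub>F i in sequentially. (\<integral>\<xi>. h (z i) \<xi> \<partial>P) \<le> y"
  shows "(\<integral>\<xi>. h x \<xi> \<partial>P) \<le> y"
proof -
  interpret prob_space P by (rule dists_onD(1)[OF P(1)])
  have \<Xi>: "\<Xi> \<noteq> {}" using not_empty dists_onD(3)[OF P(1)] by simp
  define b where "b \<xi> = L * (1 + nrm \<xi>)" for \<xi>
  have b: "integrable P b" unfolding b_def using P(2) by simp
  have hm: "h x \<in> borel_measurable P" if "x \<in> X" for x
    using usc_on_borel[OF usc[OF that]] dists_onD(2)[OF P(1)] by (simp cong: measurable_cong_sets)
  have hi: "integrable P (h x)" if "x \<in> X" for x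
    by (rule growth_integrable[OF \<Xi> L growth[OF that] P hm[OF that] growth[OF that]])
  have pos: "0 \<le> h x \<xi> + b \<xi>" if "x \<in> X" "\<xi> \<in> space P" for x \<xi>
    using growth[OF that(1), of \<xi>] that(2) dists_onD(3)[OF P(1)] by (simp add: b_def abs_le_iff)
  have "ennreal ((\<integral>\<xi>. h x \<xi> \<partial>P) + (\<integral>\<xi>. b \<xi> \<partial>P)) = (\<integral>\<^sup>+\<xi>. ennreal (h x \<xi> + b \<xi>) \<partial>P)"
    using hi[OF z(3)] b pos[OF z(3)] by (subst nn_integral_eq_integral) auto
  also have "\<dots> \<le> (\<integral>\<^sup>+\<xi>. liminf (\<lambda>i. ennreal (h (z i) \<xi> + b \<xi>)) \<partial>P)"
  proof (rule nn_integral_mono)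
    fix \<xi> assume \<xi>: "\<xi> \<in> space P"
    hence \<xi>': "\<xi> \<in> \<Xi>" using dists_onD(3)[OF P(1)] by simp
    show "ennreal (h x \<xi> + b \<xi>) \<le> liminf (\<lambda>i. ennreal (h (z i) \<xi> + b \<xi>))"
      unfolding le_Liminf_iff
    proof (intro allI impI)
      fix w assume w: "w < ennreal (h x \<xi> + b \<xi>)"
      then obtain v where v: "w = ennreal v" "v \<ge> 0" by (cases w) auto
      with w have "v - b \<xi> < h x \<xi>" by (simp add: ennreal_less_iff)
      hence "\<forall>\<^sub>F u in at x within X. v - b \<xi> < h u \<xi>" using lsc[OF \<xi>'] z(3) by (auto simp: lsc_on_def)
      then obtain T where T: "open T" "x \<in> T" "\<And>u. u \<in> T \<Longrightarrow> u \<noteq> x \<Longrightarrow> u \<in> X \<Longrightarrow> v - b \<xi> < h u \<xi>"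
        by (auto simp: eventually_at_topological)
      have "\<forall>\<^sub>F i in sequentially. z i \<in> T" using topological_tendstoD[OF z(2) T(1,2)] .
      thus "\<forall>\<^sub>F i in sequentially. w < ennreal (h (z i) \<xi> + b \<xi>)"
      proof eventually_elim
        case (elim i)
        have "v - b \<xi> < h (z i) \<xi>" using T(3)[OF elim _ z(1)] \<open>v - b \<xi> < h x \<xi>\<close> by (cases "z i = x") auto
        thus ?case using v by (simp add: ennreal_less_iff)
      qed
    qed
  qed
  also have "\<dots> \<le> liminf (\<lambda>i. \<integral>\<^sup>+\<xi>. ennreal (h (z i) \<xi> + b \<xi>) \<partial>P)"
    using hm z(1) b by (intro nn_integral_liminf) auto
  also have "\<dots> \<le> ennreal (y + (\<integral>\<xi>. b \<xi> \<partial>P))"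
  proof (rule order_trans[OF Liminf_le_Limsup Limsup_bounded])
    show "\<forall>\<^sub>F i in sequentially. (\<integral>\<^sup>+\<xi>. ennreal (h (z i) \<xi> + b \<xi>) \<partial>P) \<le> ennreal (y + (\<integral>\<xi>. b \<xi> \<partial>P))"
      using y
    proof eventually_elim
      case (elim i)
      have "(\<integral>\<^sup>+\<xi>. ennreal (h (z i) \<xi> + b \<xi>) \<partial>P) = ennreal ((\<integral>\<xi>. h (z i) \<xi> \<partial>P) + (\<integral>\<xi>. b \<xi> \<partial>P))"
        using hi[OF z(1)] b pos[OF z(1)] by (subst nn_integral_eq_integral) auto
      thus ?case using elim by (simp add: ennreal_leI)
    qed
  qed simp
  finally have "ennreal ((\<integral>\<xi>. h x \<xi> \<partial>P) + (\<integral>\<xi>. b \<xi> \<partial>P)) \<le> ennreal (y + (\<integral>\<xi>. b \<xi> \<partial>P))" .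
  \<comment> \<open>\<open>ennreal\<close> truncates at 0, so the comparison returns to the reals
    only once the right-hand side is known to be nonnegative.\<close>
  moreover have "0 \<le> y + (\<integral>\<xi>. b \<xi> \<partial>P)"
  proof -
    obtain i where i: "(\<integral>\<xi>. h (z i) \<xi> \<partial>P) \<le> y" using y by (auto simp: eventually_sequentially)
    have "0 \<le> (\<integral>\<xi>. h (z i) \<xi> + b \<xi> \<partial>P)" using pos[OF z(1)] by (rule Bochner_Integration.integral_nonneg)
    thus ?thesis using i hi[OF z(1)] b by simp
  qed
  ultimately show ?thesis by (simp add: ennreal_le_iff)
qed

theorem proposition5:
  fixes \<Xi> :: "(real ^ 'm) set"
    and X :: "(real ^ 'n) set"
    and nrm :: "real ^ 'm \<Rightarrow> real"
    and h :: "real ^ 'n \<Rightarrow> real ^ 'm \<Rightarrow> real"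
    and H :: "(real \<Rightarrow> real) set"
    and P :: "(real ^ 'm) measure"
    and k :: "nat \<Rightarrow> real"
    and a c \<delta> :: real
    and xhat :: "nat \<Rightarrow> (nat \<Rightarrow> real ^ 'm) \<Rightarrow> real ^ 'n"
  assumes "convex \<Xi>"
    and "is_norm nrm"
    and "H \<noteq> {}"
    and "\<forall>g\<in>H. distortion g \<and> convex_on {0..1} g"
    and "\<forall>g\<in>H. \<exists>D\<le>c. (g has_real_derivative D) (at_left 1)"
    and "P \<in> dists_on \<Xi>"
    and "a > 1"
    and "integrable P (\<lambda>\<xi>. exp (nrm \<xi> powr a))"
    and "\<forall>N\<ge>1. k N > 0"
    and "\<delta> < 1"
    and "(\<lambda>N. k N / real N powr \<delta>) \<longlonglongrightarrow> 0"
    and "(\<lambda>N. ln (real N) / k N) \<longlonglongrightarrow> 0"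
    and "\<forall>x\<in>X. usc_on \<Xi> (h x)"
    and "\<exists>L\<ge>0. \<forall>x\<in>X. \<forall>\<xi>\<in>\<Xi>. \<bar>h x \<xi>\<bar> \<le> L * (1 + nrm \<xi>)"
  shows "(AE \<omega> in (\<Pi>\<^sub>M i\<in>(UNIV :: nat set). P).
           converges_from_above
             (\<lambda>N. optimal_value
                (worst_case nrm H \<Xi> (radius CARD('m) k N) (empirical \<Xi> N \<omega>) h) X)
             (optimal_value (\<lambda>x. ereal (\<integral>\<xi>. h x \<xi> \<partial>P)) X)) \<and>
         (closed X \<longrightarrow>
          (\<forall>\<xi>\<in>\<Xi>. lsc_on X (\<lambda>x. h x \<xi>)) \<longrightarrow>
          (AE \<omega> in (\<Pi>\<^sub>M i\<in>(UNIV :: nat set). P). \<forall>N\<ge>1.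
            is_arg_min (worst_case nrm H \<Xi> (radius CARD('m) k N) (empirical \<Xi> N \<omega>) h)
              (\<lambda>x. x \<in> X) (xhat N \<omega>)) \<longrightarrow>
          (AE \<omega> in (\<Pi>\<^sub>M i\<in>(UNIV :: nat set). P). \<forall>x.
            accumulation_point (\<lambda>N. xhat N \<omega>) x \<longrightarrow>
            is_arg_min (\<lambda>x. \<integral>\<xi>. h x \<xi> \<partial>P) (\<lambda>x. x \<in> X) x))"
proof -
  obtain L where L: "L \<ge> 0" "\<And>x \<xi>. x \<in> X \<Longrightarrow> \<xi> \<in> \<Xi> \<Longrightarrow> \<bar>h x \<xi>\<bar> \<le> L * (1 + nrm \<xi>)"
    using assms(14) by blast
  note P = assms(6)
  interpret T: transport_setting \<Xi> nrm H c
    by standard (fact assms)+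
  interpret p: prob_space P by (rule dists_onD(1)[OF P])
  have \<Xi>: "\<Xi> \<noteq> {}" using p.not_empty dists_onD(3)[OF P] by simp
  have usc: "usc_on \<Xi> (h x)" if "x \<in> X" for x using assms(13) that by blast
  obtain l where l: "l > 0" "integrable P (\<lambda>x. exp (l * norm x))"
    using exp_norm_integrable[OF assms(2) P assms(7,8)] by blast
  have Pn: "integrable P nrm" by (rule nrm_integrable[OF assms(2) P l])
  obtain \<kappa> where \<kappa>: "\<kappa> > 0" "\<And>x. nrm x \<le> \<kappa> * norm x" using is_norm_equivalent(3)[OF assms(2)] by blast
  define \<epsilon> where "\<epsilon> = radius CARD('m) k"
  note \<epsilon> = radius_facts[OF assms(9,10,11,12), of "CARD('m)", folded \<epsilon>_def]
  \<comment> \<open>Dividing by \<open>max c 1\<close> pays for the factor lost between mean and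
    risk while keeping the denominator positive; \<open>\<eta>\<close> below accounts for passing
    from \<open>nrm\<close> to the Euclidean norm.\<close>
  define e where "e N = \<epsilon> N / max c 1" for N
  define \<eta> where "\<eta> N = e N / \<kappa>" for N
  let ?\<Omega> = "\<Pi>\<^sub>M i\<in>(UNIV :: nat set). P"
  have e: "\<forall>\<^sub>F N in sequentially. 0 \<le> e N" "e \<longlonglongrightarrow> 0"
  proof -
    show "\<forall>\<^sub>F N in sequentially. 0 \<le> e N" using \<epsilon>(1) by eventually_elim (simp add: e_def)
    show "e \<longlonglongrightarrow> 0" unfolding e_def using tendsto_divide[OF \<epsilon>(2) tendsto_const[of "max c 1"]] by simp
  qed
  have rate: "AE \<omega> in ?\<Omega>. \<forall>\<^sub>F N in sequentially.
     \<exists>R\<in>couplings (empirical \<Xi> N \<omega>) P. (\<integral>\<^sup>+z. ennreal (norm (fst z - snd z)) \<partial>R) \<le> ennreal (\<eta> N)"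
  proof (rule empirical_transport_rate[OF P l])
    show "\<forall>\<^sub>F N in sequentially. \<eta> N > 0" using \<epsilon>(1) by eventually_elim (use \<kappa> in \<open>simp add: \<eta>_def e_def\<close>)
    show "\<eta> \<longlonglongrightarrow> 0" unfolding \<eta>_def using tendsto_divide[OF e(2) tendsto_const[of \<kappa>]] \<kappa> by simp
    have "(\<lambda>N. rate CARD('m) N / \<eta> N) = (\<lambda>N. (max c 1 * \<kappa>) * (rate CARD('m) N / \<epsilon> N))"
      using \<kappa> by (simp add: \<eta>_def e_def fun_eq_iff)
    thus "(\<lambda>N. rate CARD('m) N / \<eta> N) \<longlonglongrightarrow> 0" using tendsto_mult_right_zero[OF \<epsilon>(3)] by simp
  qed
  \<comment> \<open>All randomness enters through this property. It does not mention
    \<open>x\<close>, so one null set serves every decision and every accumulation point.\<close>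
  define good where "good \<omega> \<longleftrightarrow> (\<forall>\<^sub>F N in sequentially. empirical \<Xi> N \<omega> \<in> dists_on \<Xi> \<and>
     (\<exists>R\<in>couplings (empirical \<Xi> N \<omega>) P. (\<integral>\<^sup>+z. ennreal (nrm (fst z - snd z)) \<partial>R) \<le> ennreal (e N)))" for \<omega>
  have good: "AE \<omega> in ?\<Omega>. good \<omega>"
    using rate
  proof (rule AE_mp, intro AE_I2 impI)
    fix \<omega> assume \<omega>: "\<omega> \<in> space ?\<Omega>"
      and ev: "\<forall>\<^sub>F N in sequentially. \<exists>R\<in>couplings (empirical \<Xi> N \<omega>) P. (\<integral>\<^sup>+z. ennreal (norm (fst z - snd z)) \<partial>R) \<le> ennreal (\<eta> N)"
    have in\<Xi>: "\<omega> i \<in> \<Xi>" for i using \<omega> dists_onD(3)[OF P] by (auto simp: space_PiM)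
    from ev eventually_gt_at_top[of 0] e(1) show "good \<omega>" unfolding good_def
    proof eventually_elim
      case (elim N)
      have E: "empirical \<Xi> N \<omega> \<in> dists_on \<Xi>" by (rule empirical_dists_on) (use elim in\<Xi> in auto)
      obtain R where R: "R \<in> couplings (empirical \<Xi> N \<omega>) P" "(\<integral>\<^sup>+z. ennreal (norm (fst z - snd z)) \<partial>R) \<le> ennreal (\<eta> N)"
        using elim by blast
      have "(\<integral>\<^sup>+z. ennreal (nrm (fst z - snd z)) \<partial>R) \<le> (\<integral>\<^sup>+z. ennreal \<kappa> * ennreal (norm (fst z - snd z)) \<partial>R)"
        using \<kappa> by (intro nn_integral_mono) (simp add: ennreal_mult[symmetric] ennreal_leI)
      also have "\<dots> = ennreal \<kappa> * (\<integral>\<^sup>+z. ennreal (norm (fst z - snd z)) \<partial>R)"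
        by (intro nn_integral_cmult measurable_compose[OF _ measurable_ennreal] coupling_measurable(3)[OF E P R(1)]) measurable
      also have "\<dots> \<le> ennreal \<kappa> * ennreal (\<eta> N)" by (intro mult_left_mono R) auto
      also have "\<dots> = ennreal (\<kappa> * \<eta> N)"
        using \<kappa>(1) elim(3) by (intro ennreal_mult[symmetric]) (auto simp: \<eta>_def)
      also have "\<kappa> * \<eta> N = e N" using \<kappa> by (simp add: \<eta>_def)
      finally show ?case using E R(1) by blast
    qed
  qed
  have lower: "\<forall>\<^sub>F N in sequentially. P \<in> transport_ball nrm H \<Xi> (\<epsilon> N) (empirical \<Xi> N \<omega>)" if "good \<omega>" for \<omega>
    using that e(1) unfolding good_def
  proof eventually_elim
    case (elim N)
    have "max c 0 * e N \<le> max c 1 * e N" using elim by (intro mult_right_mono) auto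
    also have "\<dots> = \<epsilon> N" by (simp add: e_def)
    finally have "max c 0 * e N \<le> \<epsilon> N" .
    thus ?case using elim by (blast intro: T.in_transport_ballI[OF _ P])
  qed
  let ?J = "\<lambda>\<omega> N. worst_case nrm H \<Xi> (\<epsilon> N) (empirical \<Xi> N \<omega>) h"
  have lower': "\<forall>\<^sub>F N in sequentially. \<forall>x. ereal (\<integral>\<xi>. h x \<xi> \<partial>P) \<le> ?J \<omega> N x" if "good \<omega>" for \<omega>
    using lower[OF that] by eventually_elim (auto simp: worst_case_def intro: SUP_upper)
  have upper: "\<forall>\<^sub>F N in sequentially. ?J \<omega> N x \<le> ereal y"
    if "good \<omega>" "x \<in> X" "(\<integral>\<xi>. h x \<xi> \<partial>P) < y" for \<omega> x y
  proof -
    have "\<forall>\<^sub>F N in sequentially. \<forall>Q\<in>transport_ball nrm H \<Xi> (\<epsilon> N) (empirical \<Xi> N \<omega>). (\<integral>\<xi>. h x \<xi> \<partial>Q) \<le> y"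
      by (rule T.worst_case_eventually_le[OF \<Xi> L(1) L(2)[OF that(2)] usc[OF that(2)] P Pn that(1)[unfolded good_def] e \<epsilon>(1,2) that(3)])
    thus ?thesis by eventually_elim (auto simp: worst_case_def intro: SUP_least)
  qed
  have part1: "converges_from_above (\<lambda>N. optimal_value (?J \<omega> N) X) (optimal_value (\<lambda>x. ereal (\<integral>\<xi>. h x \<xi> \<partial>P)) X)"
    if g: "good \<omega>" for \<omega>
  proof -
    let ?l = "optimal_value (\<lambda>x. ereal (\<integral>\<xi>. h x \<xi> \<partial>P)) X"
    have low: "\<forall>\<^sub>F N in sequentially. ?l \<le> optimal_value (?J \<omega> N) X"
      using lower'[OF g] by eventually_elim (auto simp: optimal_value_def intro: INF_mono)
    have "(\<lambda>N. optimal_value (?J \<omega> N) X) \<longlonglongrightarrow> ?l"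
    proof (rule order_tendstoI)
      fix a assume a: "a < ?l"
      show "\<forall>\<^sub>F N in sequentially. a < optimal_value (?J \<omega> N) X"
        using low by eventually_elim (rule less_le_trans[OF a])
    next
      fix a assume "?l < a"
      then obtain x where x: "x \<in> X" "ereal (\<integral>\<xi>. h x \<xi> \<partial>P) < a" by (auto simp: optimal_value_def INF_less_iff)
      then obtain y where y: "ereal (\<integral>\<xi>. h x \<xi> \<partial>P) < ereal y" "ereal y < a" using ereal_dense2 by blast
      have "\<forall>\<^sub>F N in sequentially. ?J \<omega> N x \<le> ereal y" by (rule upper[OF g x(1)]) (use y in simp)
      thus "\<forall>\<^sub>F N in sequentially. optimal_value (?J \<omega> N) X < a"
      proof eventually_elim
        case (elim N)
        have "optimal_value (?J \<omega> N) X \<le> ?J \<omega> N x" unfolding optimal_value_def by (rule INF_lower[OF x(1)])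
        thus ?case using elim y(2) by simp
      qed
    qed
    thus ?thesis using low by (simp add: converges_from_above_def)
  qed
  have part2: "is_arg_min (\<lambda>x. \<integral>\<xi>. h x \<xi> \<partial>P) (\<lambda>x. x \<in> X) x"
    if "closed X" and lsc: "\<forall>\<xi>\<in>\<Xi>. lsc_on X (\<lambda>x. h x \<xi>)" and g: "good \<omega>"
      and opt: "\<forall>N\<ge>1. is_arg_min (?J \<omega> N) (\<lambda>x. x \<in> X) (xhat N \<omega>)"
      and acc: "accumulation_point (\<lambda>N. xhat N \<omega>) x" for \<omega> x
  proof -
    obtain r :: "nat \<Rightarrow> nat" where r: "strict_mono r" "(\<lambda>i. xhat (r i) \<omega>) \<longlonglongrightarrow> x"
      using acc by (auto simp: accumulation_point_def o_def)
    \<comment> \<open>The minimisers are controlled from index 1 on, while \<open>r 0\<close> may be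
      0; dropping the first term makes every index positive.\<close>
    define s where "s i = r (Suc i)" for i
    have s: "strict_mono s" using r(1) by (simp add: s_def strict_mono_Suc_iff)
    have s1: "s i \<ge> 1" for i using strict_mono_imp_increasing[OF r(1), of "Suc i"] by (simp add: s_def)
    define z where "z i = xhat (s i) \<omega>" for i
    have zX: "z i \<in> X" for i using opt s1[of i] by (simp add: z_def is_arg_min_def)
    have zx: "z \<longlonglongrightarrow> x" unfolding z_def s_def using LIMSEQ_Suc[OF r(2)] .
    have xX: "x \<in> X" using closed_sequentially[OF \<open>closed X\<close> _ zx] zX by blast
    have "(\<integral>\<xi>. h x \<xi> \<partial>P) \<le> (\<integral>\<xi>. h x' \<xi> \<partial>P)" if x': "x' \<in> X" for x'
    proof (rule dense_ge)
      fix y assume y: "(\<integral>\<xi>. h x' \<xi> \<partial>P) < y"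
      \<comment> \<open>Since \<open>P\<close> lies in the ball, the true cost of
        \<open>xhat N\<close> is at most its worst case, which is at most that of the competitor
        \<open>x'\<close> and eventually at most \<open>y\<close>.\<close>
      have "\<forall>\<^sub>F N in sequentially. N \<ge> 1 \<longrightarrow> (\<integral>\<xi>. h (xhat N \<omega>) \<xi> \<partial>P) \<le> y"
        using upper[OF g x' y] lower'[OF g]
      proof eventually_elim
        case (elim N)
        show ?case
        proof
          assume "N \<ge> 1"
          hence "?J \<omega> N (xhat N \<omega>) \<le> ?J \<omega> N x'" using opt x' by (auto simp: is_arg_min_def not_less)
          hence "ereal (\<integral>\<xi>. h (xhat N \<omega>) \<xi> \<partial>P) \<le> ereal y" using elim by (meson order_trans)
          thus "(\<integral>\<xi>. h (xhat N \<omega>) \<xi> \<partial>P) \<le> y" by simp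
        qed
      qed
      from eventually_compose_filterlim[OF this filterlim_subseq[OF s]]
      have "\<forall>\<^sub>F i in sequentially. (\<integral>\<xi>. h (z i) \<xi> \<partial>P) \<le> y" using s1 by (simp add: z_def)
      with P Pn L usc zX zx xX lsc show "(\<integral>\<xi>. h x \<xi> \<partial>P) \<le> y"
        by (intro T.integral_lsc_limit_le[where X=X and z=z and L=L]) auto
    qed
    thus ?thesis using xX by (auto simp: is_arg_min_def not_less)
  qed
  show ?thesis
  proof (intro conjI impI)
    show "AE \<omega> in ?\<Omega>. converges_from_above
        (\<lambda>N. optimal_value (worst_case nrm H \<Xi> (radius CARD('m) k N) (empirical \<Xi> N \<omega>) h) X)
        (optimal_value (\<lambda>x. ereal (\<integral>\<xi>. h x \<xi> \<partial>P)) X)"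
      using good part1 unfolding \<epsilon>_def by (rule eventually_mono)
  next
    assume X: "closed X" "\<forall>\<xi>\<in>\<Xi>. lsc_on X (\<lambda>x. h x \<xi>)"
      and opt: "AE \<omega> in ?\<Omega>. \<forall>N\<ge>1. is_arg_min (worst_case nrm H \<Xi> (radius CARD('m) k N) (empirical \<Xi> N \<omega>) h)
              (\<lambda>x. x \<in> X) (xhat N \<omega>)"
    from good opt show "AE \<omega> in ?\<Omega>. \<forall>x. accumulation_point (\<lambda>N. xhat N \<omega>) x \<longrightarrow>
        is_arg_min (\<lambda>x. \<integral>\<xi>. h x \<xi> \<partial>P) (\<lambda>x. x \<in> X) x"
      by eventually_elim (use part2[OF X] in \<open>simp add: \<epsilon>_def\<close>)
  qed
qed

end
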